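(* Let $\mathbf{B}$ be a constant real $n\times n$ matrix. Suppose that $w,w_1,w_2\in\mathbb{R}^n\times\mathbb{S}_0^{n\times n}$ satisfy $$w=\mu_1w_1+\mu_2w_2,\quad \mu_1+\mu_2=1,\ \mu_i>0,\qquad\text{and}\qquad \bar w=w_2-w_1\in\Lambda .$$ Given an open space-time set $\mathcal{O}\subset\mathbb{R}^n\times\mathbb{R}$ and $\varepsilon>0$, there exists $\tilde w\in C_c^\infty(\mathcal{O};\mathbb{R}^n\times\mathbb{S}_0^{n\times n})$ satisfying the following properties: 1. $\tilde w(\cdot,t)\in L^1(\mathbb{R}^n)$ with $\int_{\mathbb{R}^n}\tilde w(x,t)\,dx=0$ for every $t$, and $\mathscr{L}\tilde w=0$; 2. $\mathrm{dist}(w+\tilde w(x,t),[w_1,w_2])<\varepsilon$ for $(x,t)\in\mathcal{O}$; 3. there exist two disjoint open sets $\mathcal{O}_1,\mathcal{O}_2\subset\mathcal{O}$ such that for $i=1,2$, $$|w+\tilde w(x,t)-w_i|<\varepsilon\ \text{ for }(x,t)\in\mathcal{O}_i,\qquad |\mathcal{H}^{n+1}(\mathcal{O}_i)-\mu_i\mathcal{H}^{n+1}(\mathcal{O})|<\varepsilon .$$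
   Context: Here $n$ is the space dimension, $\mathbb{S}_0^{n\times n}$ is the space of real symmetric trace-free $n\times n$ matrices, $[w_1,w_2]$ is the line segment joining $w_1$ and $w_2$, and $\mathcal{H}^{n+1}$ is the $(n+1)$-dimensional Hausdorff measure. For functions $(\mathbf{n},\mathbf{V})$ of $(x,t)\in\mathbb{R}^n\times\mathbb{R}$ with values in $\mathbb{R}^n\times\mathbb{S}_0^{n\times n}$, $$\mathscr{L}(\mathbf{n},\mathbf{V})=(\nabla\cdot\mathbf{n},\ \partial_t\mathbf{n}+\nabla\cdot\mathbf{V}-\mathbf{B}\mathbf{n}),$$ and $\mathscr{L}_0$ denotes the same operator with $\mathbf{B}=0$ (the divergence $\nabla\cdot$ acts in $x$ only). $\Lambda$ is the set of $(\bar{\mathbf{n}},\bar{\mathbf{V}})\in\mathbb{R}^n\times\mathbb{S}_0^{n\times n}$ for which there exists $(\tau,\xi)\in\mathbb{R}\times S^{n-1}$ (with $S^{n-1}$ the unit sphere of $\mathbb{R}^n$) such that $(\mathbf{n},\mathbf{V})(x,t)=(\bar{\mathbf{n}},\bar{\mathbf{V}})\,h(\tau t+\xi\cdot x)$ solves $\mathscr{L}_0(\mathbf{n},\mathbf{V})=0$ for every smooth function $h:\mathbb{R}\to\mathbb{R}$.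
   Formalization: The two estimates comparing the measures of O_1, O_2 with that of O are claimed only when O has finite (n+1)-dimensional Hausdorff measure; for infinite measure they fail (e.g. O the whole space, w_1 ≠ w_2, small ε) or are undefined. All other claims are made for every open O. *)

theory Defs
  imports "HOL-Analysis.Analysis"
begin

text \<open>Maps of class \<open>C^k\<close> on the whole space: all iterated directional derivatives of order
  less than \<open>k\<close> are Frechet differentiable, and those of order \<open>k\<close> are continuous.\<close>

primrec C_k :: "nat \<Rightarrow> ('a::euclidean_space \<Rightarrow> 'b::real_normed_vector) \<Rightarrow> bool" where
  "C_k 0 f \<longleftrightarrow> continuous_on UNIV f"
| "C_k (Suc k) f \<longleftrightarrow>
     (\<forall>x. f differentiable (at x)) \<and> (\<forall>v. C_k k (\<lambda>x. frechet_derivative f (at x) v))"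

definition smooth :: "('a::euclidean_space \<Rightarrow> 'b::real_normed_vector) \<Rightarrow> bool" where
  "smooth f \<longleftrightarrow> (\<forall>k. C_k k f)"

text \<open>Compactly supported smooth maps on an open set \<open>U\<close> with values in \<open>S\<close>. Such maps are
  represented by their extension by zero, which is smooth on the whole space.\<close>

definition test_maps ::
    "'a::euclidean_space set \<Rightarrow> 'b::real_normed_vector set \<Rightarrow> ('a \<Rightarrow> 'b) set" where
  "test_maps U S = {f. smooth f \<and> range f \<subseteq> S \<and>
     compact (closure (support_on UNIV f)) \<and> closure (support_on UNIV f) \<subseteq> U}"

text \<open>The \<open>d\<close>-dimensional Hausdorff measure (as an outer measure), with the normalisation for
  which it agrees with Lebesgue measure in dimension \<open>d\<close>. Covering sets are required to be bounded
  because \<^const>\<open>diameter\<close> carries no information for unbounded sets. The separate treatment of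
  the empty set only matters for \<open>d = 0\<close>.\<close>

definition hausdorff_content :: "nat \<Rightarrow> real \<Rightarrow> 'a::metric_space set \<Rightarrow> ennreal" where
  "hausdorff_content d \<delta> A =
     (INF C \<in> {C :: nat \<Rightarrow> 'a set. A \<subseteq> (\<Union>i. C i) \<and> (\<forall>i. bounded (C i) \<and> diameter (C i) \<le> \<delta>)}.
        \<Sum>i. if C i = {} then 0
            else ennreal (unit_ball_vol (real d) * (diameter (C i) / 2) ^ d))"

definition hausdorff_measure :: "nat \<Rightarrow> 'a::metric_space set \<Rightarrow> ennreal" where
  "hausdorff_measure d A = (SUP \<delta> \<in> {0<..}. hausdorff_content d \<delta> A)"

definition sym_tracefree :: "(real^'n^'n) set" where
  "sym_tracefree = {A. transpose A = A \<and> trace A = 0}"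

definition state_space :: "((real^'n) \<times> (real^'n^'n)) set" where
  "state_space = UNIV \<times> sym_tracefree"

text \<open>Points of space-time are pairs \<open>(x, t)\<close>.\<close>

definition space_partial ::
    "'n \<Rightarrow> ((real^'n) \<times> real \<Rightarrow> real) \<Rightarrow> (real^'n) \<times> real \<Rightarrow> real" where
  "space_partial j f = (\<lambda>(x, t). deriv (\<lambda>s. f (x + s *\<^sub>R axis j 1, t)) 0)"

definition time_derivative ::
    "((real^'n) \<times> real \<Rightarrow> real^'n) \<Rightarrow> (real^'n) \<times> real \<Rightarrow> real^'n" where
  "time_derivative f = (\<lambda>(x, t). vector_derivative (\<lambda>s. f (x, s)) (at t))"

definition div_vec ::
    "((real^'n) \<times> real \<Rightarrow> real^'n) \<Rightarrow> (real^'n) \<times> real \<Rightarrow> real" where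
  "div_vec f p = (\<Sum>j\<in>UNIV. space_partial j (\<lambda>q. f q $ j) p)"

definition div_mat ::
    "((real^'n) \<times> real \<Rightarrow> real^'n^'n) \<Rightarrow> (real^'n) \<times> real \<Rightarrow> real^'n" where
  "div_mat F p = (\<chi> i. \<Sum>j\<in>UNIV. space_partial j (\<lambda>q. F q $ i $ j) p)"

definition lin_op ::
    "real^'n^'n \<Rightarrow> ((real^'n) \<times> real \<Rightarrow> (real^'n) \<times> (real^'n^'n)) \<Rightarrow>
     (real^'n) \<times> real \<Rightarrow> real \<times> (real^'n)" where
  "lin_op B w p =
     (div_vec (fst \<circ> w) p,
      time_derivative (fst \<circ> w) p + div_mat (snd \<circ> w) p - B *v fst (w p))"

definition wave_cone :: "((real^'n) \<times> (real^'n^'n)) set" where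
  "wave_cone = {w \<in> state_space. \<exists>\<tau> :: real. \<exists>\<xi> \<in> sphere 0 1. \<forall>h :: real \<Rightarrow> real. smooth h \<longrightarrow>
     (\<forall>p. lin_op 0 (\<lambda>(x, t). h (\<tau> * t + \<xi> \<bullet> x) *\<^sub>R w) p = 0)}"

end

theory Submission
  imports Defs
begin

text \<open>
  Put \<open>z = w\<^sub>2 - w\<^sub>1 \<in> \<Lambda>\<close>, with direction \<open>(\<xi>, \<tau>)\<close>. The perturbation is a cut off plane wave
  \<open>h (r (\<xi> \<bullet> x + \<tau> t)) z\<close> of high frequency \<open>r\<close>, where \<open>h\<close> is periodic with mean zero and equals
  \<open>- \<mu>\<^sub>2\<close> on a fraction \<open>\<mu>\<^sub>1\<close> of each period and \<open>\<mu>\<^sub>1\<close> on the remaining fraction, up to short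
  transitions and a small constant: \<open>w - \<mu>\<^sub>2 z = w\<^sub>1\<close> and \<open>w + \<mu>\<^sub>1 z = w\<^sub>2\<close>.

  To cut off without destroying the equations, the wave is written as \<open>P \<phi>\<close> with a differential
  operator \<open>P\<close> whose values solve the full system, with \<open>B\<close>, for every scalar \<open>\<phi>\<close>. For
  \<open>z = (a, A)\<close> let \<open>m = \<Delta>\<phi> a - \<nabla>(a \<bullet> \<nabla>\<phi>)\<close>, which is divergence free, and let \<open>E\<close> be the
  third-order operator with symmetric trace-free values and \<open>div (E u) = \<Delta>\<^sup>2 u\<close>. Then
  \<open>n = \<Delta>\<^sup>2 m\<close> and \<open>V = \<Delta>\<^sup>3\<phi> A + E (B m - \<partial>\<^sub>t m - \<Delta>(A \<nabla>\<phi>))\<close> satisfy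
  \<open>div n = 0\<close> and \<open>\<partial>\<^sub>t n + div V = B n\<close> identically (\<open>vdiv_wave_velocity\<close>, \<open>wave_balance\<close>). The
  cone conditions \<open>a \<bullet> \<xi> = 0\<close> and \<open>A \<xi> = - \<tau> a\<close> say exactly that the symbol of order six at
  \<open>(\<xi>, \<tau>)\<close> is \<open>z\<close>; the matrix \<open>B\<close> only enters at order five. Hence for a cutoff \<open>\<eta>\<close> and
  \<open>\<phi> = r\<^sup>-\<^sup>6 \<eta> G (r \<cdot>)\<close> with \<open>G\<close> bounded together with its derivatives and sixth derivative \<open>h\<close>,
  the field \<open>P \<phi>\<close> differs from \<open>\<eta> h z\<close> by \<open>O(1/r)\<close> (\<open>wave_field_leading_term\<close>). Every term of
  \<open>P \<phi>\<close> is a space derivative of a compactly supported function, so its space integrals vanish.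

  The regions are the parts of the set \<open>\<eta> = 1\<close> where \<open>h\<close> is close to one of its two values. Their
  Lebesgue proportions come from translation invariance: a shift by a fraction of the short
  wavelength permutes the phases and moves a compact set only slightly
  (\<open>phase_intervals_equidistributed\<close>). On open sets, Hausdorff measure is a constant multiple
  of Lebesgue measure: scaling shows that the ratio is the same for all balls, and the Vitali
  covering theorem transports it to open sets (\<open>hausdorff_measure_open\<close>). If the given set has
  Hausdorff measure \<open>0\<close> or \<open>\<infinity>\<close>, the zero perturbation and empty regions suffice.

  A trace-free \<open>E\<close> exists from dimension two on. In dimension one \<open>\<Lambda> = {0}\<close>, so the segment is a
  point and the zero perturbation can be used with the same regions.
\<close>

section \<open>Calculus of smooth maps\<close>

definition dir_deriv ::
    "'a::euclidean_space \<Rightarrow> ('a \<Rightarrow> 'b::real_normed_vector) \<Rightarrow> 'a \<Rightarrow> 'b" where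
  "dir_deriv v f = (\<lambda>x. frechet_derivative f (at x) v)"

lemma C_k_Suc: "C_k (Suc k) f \<longleftrightarrow> (\<forall>x. f differentiable (at x)) \<and> (\<forall>v. C_k k (dir_deriv v f))"
  by (simp add: dir_deriv_def)

declare C_k.simps(2) [simp del]

lemma C_k_mono: "C_k (Suc k) f \<Longrightarrow> C_k k f"
proof (induction k arbitrary: f)
  case 0
  then show ?case
    by (auto simp: C_k_Suc continuous_on_eq_continuous_at intro: differentiable_imp_continuous_within)
next
  case (Suc k)
  then show ?case by (metis C_k_Suc)
qed

lemma dir_deriv_eqI:
  assumes "(f has_derivative f') (at x)"
  shows "dir_deriv v f x = f' v"
  unfolding dir_deriv_def using frechet_derivative_at[OF assms] by simp

lemma has_derivative_dir_deriv:
  "f differentiable (at x) \<Longrightarrow> (f has_derivative (\<lambda>v. dir_deriv v f x)) (at x)"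
  unfolding dir_deriv_def by (simp add: frechet_derivative_works)

lemma C_k_const: "C_k k (\<lambda>x::'a::euclidean_space. c::'b::real_normed_vector)"
proof (induction k arbitrary: c)
  case (Suc k)
  have "dir_deriv v (\<lambda>x. c) = (\<lambda>x. 0)" for v :: 'a and c :: 'b
    by (rule ext, rule dir_deriv_eqI) auto
  with Suc show ?case by (simp add: C_k_Suc)
qed simp

lemma C_k_linear: "bounded_linear L \<Longrightarrow> C_k k L"
proof (cases k)
  case 0
  assume "bounded_linear L"
  with 0 show ?thesis by (simp add: linear_continuous_on)
next
  case (Suc m)
  assume L: "bounded_linear L"
  have "dir_deriv v L = (\<lambda>x. L v)" for v
    by (rule ext, rule dir_deriv_eqI) (rule bounded_linear_imp_has_derivative[OF L])
  with Suc L show ?thesis by (simp add: C_k_Suc C_k_const bounded_linear_imp_differentiable)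
qed

lemma dir_deriv_add_at:
  assumes "f differentiable (at x)" "g differentiable (at x)"
  shows "dir_deriv v (\<lambda>x. f x + g x) x = dir_deriv v f x + dir_deriv v g x"
  by (rule dir_deriv_eqI) (intro has_derivative_add has_derivative_dir_deriv assms)

lemma C_k_add: "C_k k f \<Longrightarrow> C_k k g \<Longrightarrow> C_k k (\<lambda>x. f x + g x)"
proof (induction k arbitrary: f g)
  case 0
  then show ?case by (simp add: continuous_on_add)
next
  case (Suc k)
  then have "dir_deriv v (\<lambda>x. f x + g x) = (\<lambda>x. dir_deriv v f x + dir_deriv v g x)" for v
    by (intro ext dir_deriv_add_at) (auto simp: C_k_Suc)
  with Suc show ?case by (simp add: C_k_Suc)
qed

lemma dir_deriv_scaleR_at:
  assumes "f differentiable (at x)" "g differentiable (at x)"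
  shows "dir_deriv v (\<lambda>x. f x *\<^sub>R g x) x = f x *\<^sub>R dir_deriv v g x + dir_deriv v f x *\<^sub>R g x"
  by (rule dir_deriv_eqI) (intro has_derivative_scaleR has_derivative_dir_deriv assms)

lemma C_k_scaleR: "C_k k f \<Longrightarrow> C_k k g \<Longrightarrow> C_k k (\<lambda>x. f x *\<^sub>R g x)"
proof (induction k arbitrary: f g)
  case 0
  then show ?case by (simp add: continuous_on_scaleR)
next
  case (Suc k)
  then have "dir_deriv v (\<lambda>x. f x *\<^sub>R g x) = (\<lambda>x. f x *\<^sub>R dir_deriv v g x + dir_deriv v f x *\<^sub>R g x)" for v
    by (intro ext dir_deriv_scaleR_at) (auto simp: C_k_Suc)
  moreover have "C_k k f" "C_k k g" using Suc.prems[THEN C_k_mono] by simp_all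
  moreover have "(\<lambda>x. f x *\<^sub>R g x) differentiable (at x)" for x
    using Suc.prems by (simp add: C_k_Suc)
  ultimately show ?case using Suc.prems by (simp add: C_k_Suc C_k_add Suc.IH)
qed

lemma C_k_mult:
  fixes f g :: "'a::euclidean_space \<Rightarrow> real"
  shows "C_k k f \<Longrightarrow> C_k k g \<Longrightarrow> C_k k (\<lambda>x. f x * g x)"
  using C_k_scaleR[of k f g] by simp

lemma dir_deriv_compose_at:
  fixes h :: "real \<Rightarrow> real" and f :: "'a::euclidean_space \<Rightarrow> real"
  assumes "f differentiable (at x)" "h differentiable (at (f x))"
  shows "dir_deriv v (\<lambda>x. h (f x)) x = dir_deriv v f x * dir_deriv 1 h (f x)"
proof -
  have h: "(h has_derivative (\<lambda>v. dir_deriv v h (f x))) (at (f x))"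
    using has_derivative_dir_deriv[OF assms(2)] .
  have "linear (\<lambda>v. dir_deriv v h (f x))"
    by (rule has_derivative_linear[OF h])
  then have lin: "dir_deriv s h (f x) = s * dir_deriv 1 h (f x)" for s
    using linear_cmul[of "\<lambda>v. dir_deriv v h (f x)" s 1] by simp
  have "dir_deriv v (\<lambda>x. h (f x)) x = dir_deriv (dir_deriv v f x) h (f x)"
    by (rule dir_deriv_eqI)
       (rule has_derivative_compose[OF has_derivative_dir_deriv[OF assms(1)] h])
  also have "\<dots> = dir_deriv v f x * dir_deriv 1 h (f x)"
    by (rule lin)
  finally show ?thesis .
qed

lemma C_k_compose:
  fixes h :: "real \<Rightarrow> real" and f :: "'a::euclidean_space \<Rightarrow> real"
  shows "C_k k h \<Longrightarrow> C_k k f \<Longrightarrow> C_k k (\<lambda>x. h (f x))"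
proof (induction k arbitrary: h)
  case 0
  then show ?case
    using continuous_on_compose2[of UNIV h UNIV f] by simp
next
  case (Suc k)
  then have "dir_deriv v (\<lambda>x. h (f x)) = (\<lambda>x. dir_deriv v f x * dir_deriv 1 h (f x))" for v
    by (intro ext, subst dir_deriv_compose_at) (auto simp: C_k_Suc)
  moreover have "(\<lambda>x. h (f x)) differentiable (at x)" for x
    using Suc.prems differentiable_chain_at[of f x h] by (simp add: C_k_Suc o_def)
  moreover have "C_k k f" using C_k_mono[OF Suc.prems(2)] .
  ultimately show ?case using Suc by (simp add: C_k_Suc C_k_mult)
qed

lemma smooth_C_k: "smooth f \<Longrightarrow> C_k k f"
  by (simp add: smooth_def)

lemma smooth_differentiable: "smooth f \<Longrightarrow> f differentiable (at x)"
  using smooth_C_k[of f "Suc 0"] by (simp add: C_k_Suc)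

lemma smooth_dir_deriv [intro, simp]: "smooth f \<Longrightarrow> smooth (dir_deriv v f)"
  by (metis smooth_def C_k_Suc)

lemma smooth_continuous_on: "smooth f \<Longrightarrow> continuous_on S f"
  using smooth_C_k[of f 0] by (simp add: continuous_on_subset[OF _ subset_UNIV])

lemma smooth_const [intro, simp]: "smooth (\<lambda>x. c)"
  by (simp add: smooth_def C_k_const)

lemma smooth_linear: "bounded_linear L \<Longrightarrow> smooth L"
  by (simp add: smooth_def C_k_linear)

lemma smooth_add [intro, simp]: "smooth f \<Longrightarrow> smooth g \<Longrightarrow> smooth (\<lambda>x. f x + g x)"
  by (simp add: smooth_def C_k_add)

lemma smooth_scaleR [intro]: "smooth f \<Longrightarrow> smooth g \<Longrightarrow> smooth (\<lambda>x. f x *\<^sub>R g x)"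
  by (simp add: smooth_def C_k_scaleR)

lemma smooth_mult [intro, simp]:
  fixes f g :: "'a::euclidean_space \<Rightarrow> real"
  shows "smooth f \<Longrightarrow> smooth g \<Longrightarrow> smooth (\<lambda>x. f x * g x)"
  using smooth_scaleR[of f g] by simp

lemma smooth_compose:
  fixes h :: "real \<Rightarrow> real" and f :: "'a::euclidean_space \<Rightarrow> real"
  shows "smooth h \<Longrightarrow> smooth f \<Longrightarrow> smooth (\<lambda>x. h (f x))"
  by (simp add: smooth_def C_k_compose)

lemma smooth_minus [intro, simp]:
  fixes f :: "'a::euclidean_space \<Rightarrow> real"
  shows "smooth f \<Longrightarrow> smooth (\<lambda>x. - f x)"
  using smooth_mult[of "\<lambda>_. -1" f] by simp

lemma smooth_diff [intro, simp]:
  fixes f g :: "'a::euclidean_space \<Rightarrow> real"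
  shows "smooth f \<Longrightarrow> smooth g \<Longrightarrow> smooth (\<lambda>x. f x - g x)"
  using smooth_add[of f "\<lambda>x. - g x"] by simp

lemma smooth_divide_const [intro, simp]:
  fixes f :: "'a::euclidean_space \<Rightarrow> real"
  shows "smooth f \<Longrightarrow> smooth (\<lambda>x. f x / c)"
  using smooth_mult[of f "\<lambda>_. inverse c"] by (simp add: field_simps)

lemma smooth_sum [intro, simp]:
  "(\<And>i. i \<in> I \<Longrightarrow> smooth (f i)) \<Longrightarrow> smooth (\<lambda>x. \<Sum>i\<in>I. f i x)"
  by (induction I rule: infinite_finite_induct) auto

lemma smooth_prod [intro]:
  fixes f :: "'i \<Rightarrow> 'a::euclidean_space \<Rightarrow> real"
  shows "(\<And>i. i \<in> I \<Longrightarrow> smooth (f i)) \<Longrightarrow> smooth (\<lambda>x. \<Prod>i\<in>I. f i x)"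
  by (induction I rule: infinite_finite_induct) auto

lemma smooth_componentwise:
  fixes f :: "'a::euclidean_space \<Rightarrow> 'b::euclidean_space"
  assumes "\<And>b. b \<in> Basis \<Longrightarrow> smooth (\<lambda>x. f x \<bullet> b)"
  shows "smooth f"
proof -
  have "smooth (\<lambda>x. \<Sum>b\<in>Basis. (f x \<bullet> b) *\<^sub>R b)"
    by (intro smooth_sum smooth_scaleR assms smooth_const)
  then show ?thesis by (simp add: euclidean_representation)
qed

text \<open>A sequence of functions, each the derivative of the one before, consists of smooth functions. This is
  how smoothness of the cosine, of \<open>exp (- 1 / x)\<close> and of iterated primitives is obtained.\<close>

lemma smooth_derivative_sequence:
  fixes g :: "nat \<Rightarrow> real \<Rightarrow> real"
  assumes "\<And>j x. (g j has_real_derivative g (Suc j) x) (at x)"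
  shows "smooth (g j)"
proof -
  have "C_k k (g j)" for k
  proof (induction k arbitrary: j)
    case 0
    show ?case
      using assms by (auto simp: continuous_on_eq_continuous_at intro: DERIV_isCont)
  next
    case (Suc k)
    have "dir_deriv v (g j) = (\<lambda>x. g (Suc j) x * v)" for v
      by (rule ext, rule dir_deriv_eqI)
         (use assms[of j] in \<open>simp add: has_field_derivative_def\<close>)
    moreover have "g j differentiable (at x)" for x
      using assms real_differentiable_def by blast
    ultimately show ?case using Suc by (auto simp: C_k_Suc intro: C_k_mult C_k_const)
  qed
  then show ?thesis by (simp add: smooth_def)
qed

lemma dir_deriv_add:
  "smooth f \<Longrightarrow> smooth g \<Longrightarrow> dir_deriv v (\<lambda>x. f x + g x) = (\<lambda>x. dir_deriv v f x + dir_deriv v g x)"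
  by (intro ext dir_deriv_add_at smooth_differentiable)

lemma dir_deriv_mult:
  fixes f g :: "'a::euclidean_space \<Rightarrow> real"
  shows "smooth f \<Longrightarrow> smooth g \<Longrightarrow>
    dir_deriv v (\<lambda>x. f x * g x) = (\<lambda>x. f x * dir_deriv v g x + dir_deriv v f x * g x)"
  using dir_deriv_scaleR_at[of f _ g v] by (auto simp: smooth_differentiable)

lemma dir_deriv_const: "dir_deriv v (\<lambda>x. c) = (\<lambda>x. 0)"
  by (rule ext, rule dir_deriv_eqI) auto

lemma dir_deriv_cmult:
  fixes f :: "'a::euclidean_space \<Rightarrow> real"
  shows "smooth f \<Longrightarrow> dir_deriv v (\<lambda>x. c * f x) = (\<lambda>x. c * dir_deriv v f x)"
  by (subst dir_deriv_mult) (auto simp: dir_deriv_const)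

lemma dir_deriv_minus:
  fixes f :: "'a::euclidean_space \<Rightarrow> real"
  shows "smooth f \<Longrightarrow> dir_deriv v (\<lambda>x. - f x) = (\<lambda>x. - dir_deriv v f x)"
  using dir_deriv_cmult[of f v "-1"] by simp

lemma dir_deriv_diff:
  fixes f :: "'a::euclidean_space \<Rightarrow> real"
  shows "smooth f \<Longrightarrow> smooth g \<Longrightarrow> dir_deriv v (\<lambda>x. f x - g x) = (\<lambda>x. dir_deriv v f x - dir_deriv v g x)"
  using dir_deriv_add[of f "\<lambda>x. - g x" v] by (simp add: dir_deriv_minus)

lemma dir_deriv_sum:
  "(\<And>i. i \<in> I \<Longrightarrow> smooth (f i)) \<Longrightarrow> dir_deriv v (\<lambda>x. \<Sum>i\<in>I. f i x) = (\<lambda>x. \<Sum>i\<in>I. dir_deriv v (f i) x)"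
  by (induction I rule: infinite_finite_induct) (auto simp: dir_deriv_const dir_deriv_add smooth_sum)

lemma has_real_derivative_along_line:
  fixes f :: "'a::euclidean_space \<Rightarrow> real"
  assumes "smooth f"
  shows "((\<lambda>s. f (x + s *\<^sub>R v)) has_real_derivative dir_deriv v f (x + s *\<^sub>R v)) (at s)"
proof -
  let ?D = "\<lambda>w. dir_deriv w f (x + s *\<^sub>R v)"
  have D: "(f has_derivative ?D) (at (x + s *\<^sub>R v))"
    by (intro has_derivative_dir_deriv smooth_differentiable assms)
  have "((\<lambda>s. x + s *\<^sub>R v) has_derivative (\<lambda>h. h *\<^sub>R v)) (at s)"
    by (auto intro!: derivative_eq_intros)
  from has_derivative_compose[OF this D]
  have "((\<lambda>s. f (x + s *\<^sub>R v)) has_derivative (\<lambda>h. ?D (h *\<^sub>R v))) (at s)" .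
  moreover have "?D (h *\<^sub>R v) = ?D v * h" for h
    using linear_cmul[OF has_derivative_linear[OF D]] by simp
  ultimately show ?thesis by (simp add: has_field_derivative_def)
qed

text \<open>The left side is symmetric in \<open>u\<close> and \<open>v\<close>. Applying the mean value theorem first to the
  increment in direction \<open>v\<close> as a function of the \<open>u\<close> variable, and then along \<open>v\<close>, turns it into a
  mixed derivative at a nearby point.\<close>

lemma second_difference_mean_value:
  fixes f :: "'a::euclidean_space \<Rightarrow> real"
  assumes f: "smooth f" and "h > 0"
  obtains a b where "0 < a" "a < h" "0 < b" "b < h"
    "f (x + h *\<^sub>R u + h *\<^sub>R v) - f (x + h *\<^sub>R u) - f (x + h *\<^sub>R v) + f x
       = h * h * dir_deriv v (dir_deriv u f) (x + a *\<^sub>R u + b *\<^sub>R v)"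
proof -
  define g where "g s = f (x + h *\<^sub>R v + s *\<^sub>R u) - f (x + s *\<^sub>R u)" for s
  have "(g has_real_derivative dir_deriv u f (x + h *\<^sub>R v + s *\<^sub>R u) - dir_deriv u f (x + s *\<^sub>R u)) (at s)" for s
    unfolding g_def by (intro DERIV_diff has_real_derivative_along_line f)
  from MVT2[OF \<open>h > 0\<close> this] obtain a where a: "0 < a" "a < h"
    "g h - g 0 = h * (dir_deriv u f (x + h *\<^sub>R v + a *\<^sub>R u) - dir_deriv u f (x + a *\<^sub>R u))"
    by auto
  have "((\<lambda>s. dir_deriv u f (x + a *\<^sub>R u + s *\<^sub>R v)) has_real_derivative
          dir_deriv v (dir_deriv u f) (x + a *\<^sub>R u + s *\<^sub>R v)) (at s)" for s
    by (intro has_real_derivative_along_line smooth_dir_deriv f)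
  from MVT2[OF \<open>h > 0\<close> this] obtain b where b: "0 < b" "b < h"
    "dir_deriv u f (x + a *\<^sub>R u + h *\<^sub>R v) - dir_deriv u f (x + a *\<^sub>R u)
       = h * dir_deriv v (dir_deriv u f) (x + a *\<^sub>R u + b *\<^sub>R v)"
    by auto
  show ?thesis
    by (rule that[OF a(1,2) b(1,2)]) (use a(3) b(3) in \<open>simp add: g_def algebra_simps\<close>)
qed

text \<open>Both mixed derivatives are represented by the same second difference, at points that tend to \<open>x\<close>
  with the step size.\<close>

lemma dir_deriv_commute:
  fixes f :: "'a::euclidean_space \<Rightarrow> real"
  assumes f: "smooth f"
  shows "dir_deriv u (dir_deriv v f) = dir_deriv v (dir_deriv u f)"
proof (rule ext, rule ccontr)
  fix x
  let ?F = "dir_deriv v (dir_deriv u f)" and ?G = "dir_deriv u (dir_deriv v f)"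
  assume ne: "?G x \<noteq> ?F x"
  define e where "e = \<bar>?G x - ?F x\<bar> / 2"
  have "e > 0" using ne by (simp add: e_def)
  have cont: "isCont ?F x" "isCont ?G x"
    using f smooth_continuous_on[of ?F UNIV] smooth_continuous_on[of ?G UNIV]
    by (auto simp: continuous_on_eq_continuous_at)
  obtain d1 where d1: "d1 > 0" "\<And>y. dist y x < d1 \<Longrightarrow> dist (?F y) (?F x) < e"
    using cont(1) \<open>e > 0\<close> unfolding continuous_at_eps_delta by metis
  obtain d2 where d2: "d2 > 0" "\<And>y. dist y x < d2 \<Longrightarrow> dist (?G y) (?G x) < e"
    using cont(2) \<open>e > 0\<close> unfolding continuous_at_eps_delta by metis
  define d where "d = min d1 d2"
  define h where "h = d / (norm u + norm v + 1)"
  have pos: "norm u + norm v + 1 > 0" by (simp add: add_nonneg_pos)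
  have "h > 0" using pos d1 d2 by (simp add: h_def d_def)
  have near: "dist (x + a *\<^sub>R u + b *\<^sub>R v) x < d" if "0 < a" "a < h" "0 < b" "b < h" for a b
  proof -
    have "dist (x + a *\<^sub>R u + b *\<^sub>R v) x \<le> a * norm u + b * norm v"
      using norm_triangle_ineq[of "a *\<^sub>R u" "b *\<^sub>R v"] that by (simp add: dist_norm add.assoc)
    also have "\<dots> \<le> h * norm u + h * norm v"
      using that by (intro add_mono mult_right_mono) auto
    also have "\<dots> < h * (norm u + norm v + 1)" using \<open>h > 0\<close> by (simp add: algebra_simps)
    also have "\<dots> = d" using pos by (simp add: h_def)
    finally show ?thesis .
  qed
  obtain a b where ab: "0 < a" "a < h" "0 < b" "b < h"
    "f (x + h *\<^sub>R u + h *\<^sub>R v) - f (x + h *\<^sub>R u) - f (x + h *\<^sub>R v) + f x = h * h * ?F (x + a *\<^sub>R u + b *\<^sub>R v)"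
    using second_difference_mean_value[OF f \<open>h > 0\<close>] .
  obtain a' b' where ab': "0 < a'" "a' < h" "0 < b'" "b' < h"
    "f (x + h *\<^sub>R v + h *\<^sub>R u) - f (x + h *\<^sub>R v) - f (x + h *\<^sub>R u) + f x = h * h * ?G (x + a' *\<^sub>R v + b' *\<^sub>R u)"
    using second_difference_mean_value[OF f \<open>h > 0\<close>] .
  have "h * h * ?F (x + a *\<^sub>R u + b *\<^sub>R v) = h * h * ?G (x + b' *\<^sub>R u + a' *\<^sub>R v)"
    using ab(5) ab'(5) by (simp add: algebra_simps)
  then have eq: "?F (x + a *\<^sub>R u + b *\<^sub>R v) = ?G (x + b' *\<^sub>R u + a' *\<^sub>R v)"
    using \<open>h > 0\<close> by simp
  have "dist (?F (x + a *\<^sub>R u + b *\<^sub>R v)) (?F x) < e" "dist (?G (x + b' *\<^sub>R u + a' *\<^sub>R v)) (?G x) < e"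
    using d1(2) d2(2) near[OF ab(1-4)] near[OF ab'(3,4,1,2)] by (auto simp: d_def)
  then show False unfolding eq e_def dist_real_def by (simp add: abs_if split: if_splits)
qed

section \<open>Smooth steps and cutoffs\<close>

lemma smooth_I:
  assumes "\<And>x. f differentiable (at x)" "\<And>v. smooth (dir_deriv v f)"
  shows "smooth f"
  unfolding smooth_def
proof
  fix k
  have "C_k (Suc k) f" using assms by (simp add: C_k_Suc smooth_C_k)
  then show "C_k k f" by (rule C_k_mono)
qed

lemma smooth_primitive:
  fixes F f :: "real \<Rightarrow> real"
  assumes "smooth f" "\<And>x. (F has_real_derivative f x) (at x)"
  shows "smooth F"
proof (rule smooth_I)
  show "F differentiable (at x)" for x
    using assms(2) real_differentiable_def by blast
  have "dir_deriv v F = (\<lambda>x. f x * v)" for v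
    by (rule ext, rule dir_deriv_eqI) (use assms(2) in \<open>simp add: has_field_derivative_def\<close>)
  then show "smooth (dir_deriv v F)" for v using assms(1) by simp
qed

lemma primitive_exists:
  fixes f :: "real \<Rightarrow> real"
  assumes "continuous_on UNIV f"
  obtains F where "\<And>x. (F has_real_derivative f x) (at x)"
proof -
  have "\<exists>F. \<forall>x::real. -\<infinity> < ereal x \<longrightarrow> ereal x < \<infinity> \<longrightarrow> (F has_vector_derivative f x) (at x)"
    by (rule einterval_antiderivative) (use assms in \<open>auto simp: continuous_on_eq_continuous_at\<close>)
  then show ?thesis
    using that by (auto simp: has_real_derivative_iff_has_vector_derivative)
qed

text \<open>The derivative of \<open>p (1 / x) exp (- 1 / x)\<close> is again of this form, with \<open>p\<close> replaced by
  \<open>X\<^sup>2 (p - p')\<close>; \<open>flat j\<close> is the derivative of order \<open>j\<close> of the flat function.\<close>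

primrec flat_poly :: "nat \<Rightarrow> real poly" where
  "flat_poly 0 = 1"
| "flat_poly (Suc j) = [:0, 0, 1:] * (flat_poly j - pderiv (flat_poly j))"

definition flat :: "nat \<Rightarrow> real \<Rightarrow> real" where
  "flat j x = (if x > 0 then poly (flat_poly j) (1 / x) * exp (- (1 / x)) else 0)"

lemma poly_exp_decay:
  fixes p :: "real poly"
  shows "((\<lambda>y. poly p y * exp (- y)) \<longlongrightarrow> 0) at_top"
proof -
  have "((\<lambda>y. \<Sum>i\<le>degree p. coeff p i * (y ^ i / exp y)) \<longlongrightarrow> (\<Sum>i\<le>degree p. coeff p i * 0)) at_top"
    by (intro tendsto_intros tendsto_power_div_exp_0)
  moreover have "(\<Sum>i\<le>degree p. coeff p i * (y ^ i / exp y)) = poly p y * exp (- y)" for y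
    by (simp add: poly_altdef exp_minus field_simps sum_divide_distrib)
  ultimately show ?thesis by simp
qed

text \<open>To the right of the origin the difference quotient is a polynomial in \<open>1 / x\<close> times
  \<open>exp (- 1 / x)\<close>, and exponential decay wins.\<close>

lemma flat_deriv_zero: "(flat j has_real_derivative 0) (at 0)"
proof -
  let ?q = "\<lambda>h. (flat j (0 + h) - flat j 0) / h"
  have "(?q \<longlongrightarrow> 0) (at_left 0)"
  proof (rule tendsto_eventually)
    show "\<forall>\<^sub>F h in at_left 0. ?q h = 0"
      by (auto simp: eventually_at_left_field flat_def intro: exI[of _ "-1"])
  qed
  moreover have "(?q \<longlongrightarrow> 0) (at_right 0)"
  proof (rule Lim_transform_eventually)
    show "((\<lambda>h. poly ([:0, 1:] * flat_poly j) (inverse h) * exp (- inverse h)) \<longlongrightarrow> 0) (at_right 0)"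
      by (rule filterlim_compose[OF poly_exp_decay filterlim_inverse_at_top_right])
    show "\<forall>\<^sub>F h in at_right 0. poly ([:0, 1:] * flat_poly j) (inverse h) * exp (- inverse h) = ?q h"
      by (auto simp: eventually_at_right_field flat_def field_simps intro: exI[of _ 1])
  qed
  ultimately show ?thesis
    unfolding DERIV_def by (rule filterlim_split_at)
qed

lemma flat_has_derivative: "(flat j has_real_derivative flat (Suc j) x) (at x)"
proof -
  consider "x < 0" | "x = 0" | "x > 0" by linarith
  then show ?thesis
  proof cases
    case 1
    have "((\<lambda>x. 0) has_real_derivative 0) (at x)" by simp
    then have "(flat j has_real_derivative 0) (at x)"
      by (rule has_field_derivative_transform_within_open[of _ _ _ "{..<0}"]) (use 1 in \<open>auto simp: flat_def\<close>)
    then show ?thesis using 1 by (simp add: flat_def)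
  next
    case 2
    then show ?thesis using flat_deriv_zero by (simp add: flat_def)
  next
    case 3
    have "((\<lambda>x. poly (flat_poly j) (1 / x) * exp (- (1 / x))) has_real_derivative flat (Suc j) x) (at x)"
      using 3 by (auto intro!: derivative_eq_intros poly_DERIV[THEN DERIV_chain2]
          simp: flat_def field_simps power2_eq_square)
    then show ?thesis
      by (rule has_field_derivative_transform_within_open[of _ _ _ "{0<..}"]) (use 3 in \<open>auto simp: flat_def\<close>)
  qed
qed

text \<open>The step is a normalised primitive of the bump \<open>flat 0 x * flat 0 (1 - x)\<close>, which is supported in
  the unit interval.\<close>

lemma smooth_step_exists:
  obtains \<sigma> :: "real \<Rightarrow> real" where "smooth \<sigma>" "\<And>x. x \<le> 0 \<Longrightarrow> \<sigma> x = 0" "\<And>x. x \<ge> 1 \<Longrightarrow> \<sigma> x = 1"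
    "\<And>x. 0 \<le> \<sigma> x" "\<And>x. \<sigma> x \<le> 1"
proof -
  define b where "b = (\<lambda>x. flat 0 x * flat 0 (1 - x))"
  have b_pos: "b x > 0" if "0 < x" "x < 1" for x using that by (simp add: b_def flat_def)
  have b_nonneg: "b x \<ge> 0" for x by (simp add: b_def flat_def)
  have b_zero: "b x = 0" if "x \<le> 0 \<or> x \<ge> 1" for x using that by (auto simp: b_def flat_def)
  have sf: "smooth (flat 0)" by (rule smooth_derivative_sequence) (rule flat_has_derivative)
  have "smooth (\<lambda>x::real. x)" by (rule smooth_linear) (rule bounded_linear_ident)
  then have "smooth (\<lambda>x::real. 1 - x)" by simp
  from smooth_compose[OF sf this] have sb: "smooth b" unfolding b_def using sf by simp
  obtain F where F: "\<And>x. (F has_real_derivative b x) (at x)"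
    using primitive_exists[OF smooth_continuous_on[OF sb]] by blast
  have mono: "F x \<le> F y" if "x \<le> y" for x y
    using that F b_nonneg by (meson DERIV_nonneg_imp_nondecreasing)
  have left: "F x = F 0" if "x \<le> 0" for x
  proof (cases "x = 0")
    case False
    with that have "x < 0" by simp
    from MVT2[OF this, of F b] F obtain z where "x < z" "z < 0" "F 0 - F x = (0 - x) * b z" by blast
    then show ?thesis using b_zero[of z] by simp
  qed simp
  have right: "F x = F 1" if "1 \<le> x" for x
  proof (cases "x = 1")
    case False
    with that have "1 < x" by simp
    from MVT2[OF this, of F b] F obtain z where "1 < z" "z < x" "F x - F 1 = (x - 1) * b z" by blast
    then show ?thesis using b_zero[of z] by simp
  qed simp
  have lt: "F 0 < F 1"
  proof -
    from MVT2[of 0 1 F b] F obtain z where "0 < z" "z < 1" "F 1 - F 0 = (1 - 0) * b z" by auto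
    then show ?thesis using b_pos[of z] by simp
  qed
  define \<sigma> where "\<sigma> x = 1 / (F 1 - F 0) * (F x - F 0)" for x
  have "smooth F" by (rule smooth_primitive[OF sb F])
  then have "smooth \<sigma>" unfolding \<sigma>_def by simp
  moreover have "\<sigma> x = 0" if "x \<le> 0" for x using left[OF that] by (simp add: \<sigma>_def)
  moreover have "\<sigma> x = 1" if "x \<ge> 1" for x using right[OF that] lt by (simp add: \<sigma>_def)
  moreover have "0 \<le> \<sigma> x" "\<sigma> x \<le> 1" for x
  proof -
    have "F 0 \<le> F x" using mono[of 0 x] left[of x] by linarith
    moreover have "F x \<le> F 1" using mono[of x 1] right[of x] by linarith
    ultimately show "0 \<le> \<sigma> x" "\<sigma> x \<le> 1" using lt by (auto simp: \<sigma>_def field_simps)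
  qed
  ultimately show ?thesis using that by blast
qed

lemma smooth_step_between:
  fixes a b :: real
  assumes "a < b"
  obtains \<sigma> :: "real \<Rightarrow> real" where "smooth \<sigma>" "\<And>x. x \<le> a \<Longrightarrow> \<sigma> x = 0" "\<And>x. x \<ge> b \<Longrightarrow> \<sigma> x = 1"
    "\<And>x. 0 \<le> \<sigma> x" "\<And>x. \<sigma> x \<le> 1"
proof -
  obtain \<sigma> :: "real \<Rightarrow> real" where s: "smooth \<sigma>" "\<And>x. x \<le> 0 \<Longrightarrow> \<sigma> x = 0" "\<And>x. x \<ge> 1 \<Longrightarrow> \<sigma> x = 1"
    "\<And>x. 0 \<le> \<sigma> x" "\<And>x. \<sigma> x \<le> 1"
    by (rule smooth_step_exists) blast
  have id: "smooth (\<lambda>x::real. x)" by (rule smooth_linear) (rule bounded_linear_ident)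
  have "smooth (\<lambda>x. \<sigma> (1 / (b - a) * (x - a)))"
    by (rule smooth_compose[OF s(1)]) (simp add: id)
  then show ?thesis
    by (rule that) (use s(2-5) assms in \<open>auto simp: field_simps\<close>)
qed

lemma smooth_ball_bump:
  fixes a :: "'a::euclidean_space"
  assumes "r > 0"
  obtains b :: "'a \<Rightarrow> real" where "smooth b" "\<And>x. x \<in> ball a r \<Longrightarrow> b x = 1"
    "\<And>x. x \<notin> cball a (2 * r) \<Longrightarrow> b x = 0" "\<And>x. 0 \<le> b x" "\<And>x. b x \<le> 1"
proof -
  have "r\<^sup>2 < (2 * r)\<^sup>2" using assms by (simp add: power_mult_distrib)
  then obtain \<sigma> :: "real \<Rightarrow> real" where s: "smooth \<sigma>" "\<And>x. x \<le> r\<^sup>2 \<Longrightarrow> \<sigma> x = 0"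
    "\<And>x. x \<ge> (2 * r)\<^sup>2 \<Longrightarrow> \<sigma> x = 1" "\<And>x. 0 \<le> \<sigma> x" "\<And>x. \<sigma> x \<le> 1"
    by (rule smooth_step_between) blast
  have lin: "smooth (\<lambda>x::'a. x \<bullet> e)" for e
    by (rule smooth_linear) (rule bounded_linear_inner_left)
  have "smooth (\<lambda>x. \<Sum>e\<in>Basis. (x \<bullet> e - a \<bullet> e) * (x \<bullet> e - a \<bullet> e))"
    by (intro smooth_sum smooth_mult smooth_diff lin smooth_const)
  moreover have "(\<Sum>e\<in>Basis. (x \<bullet> e - a \<bullet> e) * (x \<bullet> e - a \<bullet> e)) = (dist a x)\<^sup>2" for x
    unfolding dist_norm power2_norm_eq_inner
    by (subst euclidean_inner) (simp add: inner_diff_left algebra_simps)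
  ultimately have "smooth (\<lambda>x. (dist a x)\<^sup>2)" by simp
  from smooth_compose[OF s(1) this] have "smooth (\<lambda>x. 1 - \<sigma> ((dist a x)\<^sup>2))" by simp
  then show ?thesis
  proof (rule that)
    show "1 - \<sigma> ((dist a x)\<^sup>2) = 1" if "x \<in> ball a r" for x
    proof -
      have "(dist a x)\<^sup>2 \<le> r\<^sup>2" using that by (intro power_mono) auto
      from s(2)[OF this] show ?thesis by simp
    qed
    show "1 - \<sigma> ((dist a x)\<^sup>2) = 0" if "x \<notin> cball a (2 * r)" for x
    proof -
      have "(2 * r)\<^sup>2 \<le> (dist a x)\<^sup>2" using that assms by (intro power_mono) auto
      from s(3)[OF this] show ?thesis by simp
    qed
  qed (use s(4,5) in auto)
qed

text \<open>Each point of \<open>K\<close> has a bump that is \<open>1\<close> near it; for a finite subcover with bumps \<open>b a\<close> the function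
  \<open>1 - \<Prod> (1 - b a)\<close> equals \<open>1\<close> wherever one of the bumps does.\<close>

lemma smooth_cutoff:
  fixes K W :: "'a::euclidean_space set"
  assumes "compact K" "open W" "K \<subseteq> W"
  obtains \<eta> :: "'a \<Rightarrow> real" and U S where "smooth \<eta>" "open U" "K \<subseteq> U" "U \<subseteq> W"
    "\<And>x. x \<in> U \<Longrightarrow> \<eta> x = 1" "compact S" "S \<subseteq> W" "\<And>x. x \<notin> S \<Longrightarrow> \<eta> x = 0"
    "\<And>x. 0 \<le> \<eta> x" "\<And>x. \<eta> x \<le> 1"
proof -
  have "\<exists>r>0. cball a (2 * r) \<subseteq> W" if a: "a \<in> K" for a
  proof -
    obtain e where "e > 0" "cball a e \<subseteq> W"
      using assms(2,3) a open_contains_cball[of W] by blast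
    then show ?thesis by (intro exI[of _ "e / 2"]) auto
  qed
  then have "\<forall>a\<in>K. \<exists>r>0. cball a (2 * r) \<subseteq> W" by blast
  then obtain r where r: "\<And>a. a \<in> K \<Longrightarrow> r a > 0 \<and> cball a (2 * r a) \<subseteq> W"
    unfolding bchoice_iff by blast
  have cover: "K \<subseteq> (\<Union>a\<in>K. ball a (r a))"
    using r by (intro subsetI UN_I) auto
  obtain F where F: "F \<subseteq> K" "finite F" "K \<subseteq> (\<Union>a\<in>F. ball a (r a))"
    by (rule compactE_image[OF assms(1) _ cover]) (simp, blast)
  have "\<exists>b :: 'a \<Rightarrow> real. smooth b \<and> (\<forall>x \<in> ball a (r a). b x = 1) \<and>
      (\<forall>x. x \<notin> cball a (2 * r a) \<longrightarrow> b x = 0) \<and> (\<forall>x. 0 \<le> b x \<and> b x \<le> 1)" if "a \<in> F" for a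
  proof -
    have "r a > 0" using r F that by auto
    then obtain b :: "'a \<Rightarrow> real" where "smooth b" "\<And>x. x \<in> ball a (r a) \<Longrightarrow> b x = 1"
      "\<And>x. x \<notin> cball a (2 * r a) \<Longrightarrow> b x = 0" "\<And>x. 0 \<le> b x" "\<And>x. b x \<le> 1"
      by (rule smooth_ball_bump[of "r a" a]) blast
    then show ?thesis by (intro exI[of _ b]) simp
  qed
  then have "\<forall>a\<in>F. \<exists>b :: 'a \<Rightarrow> real. smooth b \<and> (\<forall>x \<in> ball a (r a). b x = 1) \<and>
      (\<forall>x. x \<notin> cball a (2 * r a) \<longrightarrow> b x = 0) \<and> (\<forall>x. 0 \<le> b x \<and> b x \<le> 1)" ..
  then obtain b :: "'a \<Rightarrow> 'a \<Rightarrow> real" where b: "\<And>a. a \<in> F \<Longrightarrow> smooth (b a)"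
    "\<And>a x. a \<in> F \<Longrightarrow> x \<in> ball a (r a) \<Longrightarrow> b a x = 1"
    "\<And>a x. a \<in> F \<Longrightarrow> x \<notin> cball a (2 * r a) \<Longrightarrow> b a x = 0"
    "\<And>a x. a \<in> F \<Longrightarrow> 0 \<le> b a x \<and> b a x \<le> 1"
    unfolding bchoice_iff by blast
  define \<eta> where "\<eta> x = 1 - (\<Prod>a\<in>F. 1 - b a x)" for x
  have prod01: "0 \<le> (\<Prod>a\<in>F. 1 - b a x) \<and> (\<Prod>a\<in>F. 1 - b a x) \<le> 1" for x
    using b(4) by (auto intro!: prod_nonneg prod_le_1)
  show ?thesis
  proof (rule that)
    show "smooth \<eta>" unfolding \<eta>_def using b(1) by (intro smooth_diff smooth_prod smooth_const) auto
    show "open (\<Union>a\<in>F. ball a (r a))" by auto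
    show "K \<subseteq> (\<Union>a\<in>F. ball a (r a))" by (rule F)
    have "ball a (r a) \<subseteq> W" if "a \<in> F" for a
    proof -
      have "r a > 0" "cball a (2 * r a) \<subseteq> W" using r F that by auto
      moreover have "ball a (r a) \<subseteq> cball a (2 * r a)"
        using \<open>r a > 0\<close> by (intro subsetI) simp
      ultimately show ?thesis by blast
    qed
    then show "(\<Union>a\<in>F. ball a (r a)) \<subseteq> W" by (rule UN_least)
    show "\<eta> x = 1" if "x \<in> (\<Union>a\<in>F. ball a (r a))" for x
    proof -
      from that obtain a where "a \<in> F" "x \<in> ball a (r a)" by blast
      then have "1 - b a x = 0" using b(2) by simp
      then have "(\<Prod>a\<in>F. 1 - b a x) = 0"
        by (intro prod_zero[OF F(2)] bexI[OF _ \<open>a \<in> F\<close>])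
      then show ?thesis by (simp add: \<eta>_def)
    qed
    show "compact (\<Union>a\<in>F. cball a (2 * r a))" using F by (intro compact_UN) auto
    show "(\<Union>a\<in>F. cball a (2 * r a)) \<subseteq> W"
      by (rule UN_least) (use r F(1) in auto)
    show "\<eta> x = 0" if "x \<notin> (\<Union>a\<in>F. cball a (2 * r a))" for x
    proof -
      have "(\<Prod>a\<in>F. 1 - b a x) = (\<Prod>a\<in>F. 1)"
        using that b(3) by (intro prod.cong) auto
      then show ?thesis by (simp add: \<eta>_def)
    qed
    show "0 \<le> \<eta> x" "\<eta> x \<le> 1" for x using prod01[of x] by (auto simp: \<eta>_def)
  qed
qed

section \<open>Oscillating profiles with bounded primitives\<close>

lemma periodic_of_int:
  fixes f :: "real \<Rightarrow> real"
  assumes "\<And>x. f (x + 1) = f x"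
  shows "f (x + of_int k) = f x"
proof -
  interpret periodic_fun_simple' f
    by unfold_locales (rule assms)
  show ?thesis by (rule plus_of_int)
qed

lemma periodic_frac:
  fixes f :: "real \<Rightarrow> real"
  assumes "\<And>x. f (x + 1) = f x"
  shows "f (frac x) = f x"
  using periodic_of_int[of f "frac x" "\<lfloor>x\<rfloor>", OF assms] by (simp add: frac_def)

lemma periodic_bounded:
  fixes f :: "real \<Rightarrow> real"
  assumes "continuous_on UNIV f" "\<And>x. f (x + 1) = f x"
  obtains C where "\<And>x. \<bar>f x\<bar> \<le> C"
proof -
  have "compact (f ` {0..1})"
    by (intro compact_continuous_image compact_Icc continuous_on_subset[OF assms(1)]) auto
  then obtain C where C: "\<And>y. y \<in> f ` {0..1} \<Longrightarrow> norm y \<le> C"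
    using compact_imp_bounded bounded_iff by metis
  have "\<bar>f x\<bar> \<le> C" for x
  proof -
    have "frac x \<in> {0..1}" using frac_lt_1[of x] by (simp add: less_imp_le)
    then have "norm (f (frac x)) \<le> C" by (intro C imageI)
    then show ?thesis using periodic_frac[of f x, OF assms(2)] by simp
  qed
  then show ?thesis by (rule that)
qed

text \<open>A primitive of a periodic function grows by the mean \<open>c\<close> in each period, so it becomes periodic
  after a linear function is subtracted.\<close>

lemma periodic_primitive:
  fixes f :: "real \<Rightarrow> real"
  assumes cont: "continuous_on UNIV f" and per: "\<And>x. f (x + 1) = f x"
  obtains c F where "\<And>x. F (x + 1) = F x" "\<And>x. (F has_real_derivative f x - c) (at x)"
proof -
  obtain A where A: "\<And>x. (A has_real_derivative f x) (at x)"
    using primitive_exists[OF cont] by blast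
  define c where "c = A 1 - A 0"
  have shift: "((\<lambda>x. A (x + 1)) has_real_derivative f x) (at x)" for x
    using DERIV_shift[of A "f x" x 1] A[of "x + 1"] per[of x] by (simp add: add.commute)
  have "((\<lambda>x. A (x + 1) - A x) has_real_derivative 0) (at x)" for x
    using DERIV_diff[OF shift[of x] A[of x]] by simp
  then have "\<forall>x. ((\<lambda>x. A (x + 1) - A x) has_real_derivative 0) (at x)" ..
  then have const: "A (x + 1) - A x = A (0 + 1) - A 0" for x
    by (rule DERIV_isconst_all)
  have k: "A (x + 1) = A x + c" for x using const[of x] by (simp add: c_def)
  show ?thesis
  proof (rule that)
    show "A (x + 1) - c * (x + 1) = A x - c * x" for x
      by (simp add: k distrib_left)
    show "((\<lambda>x. A x - c * x) has_real_derivative f x - c) (at x)" for x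
      using DERIV_diff[OF A[of x] DERIV_cmult_Id[of c x]] by simp
  qed
qed

definition primitive_chain ::
    "nat \<Rightarrow> (real \<Rightarrow> real) \<Rightarrow> (nat \<Rightarrow> real \<Rightarrow> real) \<Rightarrow> (real \<Rightarrow> real) \<Rightarrow> bool" where
  "primitive_chain N h G H' \<longleftrightarrow> G N = h \<and> (\<forall>j<N. \<forall>x. (G j has_real_derivative G (Suc j) x) (at x)) \<and>
    (\<forall>j\<le>N. continuous_on UNIV (G j) \<and> (\<forall>x. G j (x + 1) = G j x)) \<and>
    (\<forall>x. H' (x + 1) = H' x) \<and> (\<forall>x. (H' has_real_derivative G 0 x) (at x))"

text \<open>That \<open>h\<close> has mean zero is expressed by its periodic primitive \<open>H\<close>, and the existence of \<open>H'\<close>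
  carries the same information for \<open>G 0\<close>. This lets the induction go on: each primitive is shifted by
  its own mean before the next one is taken.\<close>

lemma iterated_periodic_primitives:
  fixes h H :: "real \<Rightarrow> real"
  assumes h: "continuous_on UNIV h" "\<And>x. h (x + 1) = h x"
    and H: "\<And>x. H (x + 1) = H x" "\<And>x. (H has_real_derivative h x) (at x)"
  shows "\<exists>G H'. primitive_chain N h G H'"
proof (induction N)
  case 0
  show ?case
    unfolding primitive_chain_def by (intro exI[of _ "\<lambda>_. h"] exI[of _ H] conjI allI impI h H) simp_all
next
  case (Suc N)
  from Suc.IH obtain G H' where GH: "primitive_chain N h G H'"
    by (elim exE) (rule that)
  from GH have G: "G N = h" "\<And>j x. j < N \<Longrightarrow> (G j has_real_derivative G (Suc j) x) (at x)"
    "\<And>j. j \<le> N \<Longrightarrow> continuous_on UNIV (G j)" "\<And>j x. j \<le> N \<Longrightarrow> G j (x + 1) = G j x"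
    and H': "\<And>x. H' (x + 1) = H' x" "\<And>x. (H' has_real_derivative G 0 x) (at x)"
    unfolding primitive_chain_def by (metis, metis, metis, metis, metis, metis)
  have contH': "continuous_on UNIV H'"
    by (intro continuous_at_imp_continuous_on ballI DERIV_isCont[OF H'(2)])
  obtain c F where F: "\<And>x. F (x + 1) = F x" "\<And>x. (F has_real_derivative H' x - c) (at x)"
    by (rule periodic_primitive[OF contH' H'(1)]) (rule that)
  define G' where "G' = case_nat (\<lambda>x. H' x - c) G"
  have G'0: "G' 0 = (\<lambda>x. H' x - c)" and G'S: "G' (Suc j) = G j" for j
    by (simp_all add: G'_def)
  have H'c: "((\<lambda>x. H' x - c) has_real_derivative G 0 x) (at x)" for x
    using DERIV_diff[OF H'(2)[of x] DERIV_const[of c]] by simp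
  show ?case
    unfolding primitive_chain_def
  proof (intro exI conjI allI impI)
    show "G' (Suc N) = h" by (simp only: G'S G(1))
    show "(G' j has_real_derivative G' (Suc j) x) (at x)" if "j < Suc N" for j x
    proof (cases j)
      case 0
      show ?thesis unfolding 0 G'0 G'S by (rule H'c)
    next
      case (Suc i)
      show ?thesis unfolding Suc G'S by (rule G(2)) (use that Suc in simp)
    qed
    show "continuous_on UNIV (G' j)" if "j \<le> Suc N" for j
    proof (cases j)
      case 0
      show ?thesis unfolding 0 G'0 by (intro continuous_on_diff contH' continuous_on_const)
    next
      case (Suc i)
      show ?thesis unfolding Suc G'S by (rule G(3)) (use that Suc in simp)
    qed
    show "G' j (x + 1) = G' j x" if "j \<le> Suc N" for j x
    proof (cases j)
      case 0
      show ?thesis unfolding 0 G'0 H'(1) ..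
    next
      case (Suc i)
      show ?thesis unfolding Suc G'S by (rule G(4)) (use that Suc in simp)
    qed
    show "F (x + 1) = F x" for x by (rule F)
    show "(F has_real_derivative G' 0 x) (at x)" for x unfolding G'0 by (rule F)
  qed
qed

lemma smooth_cos: "smooth (cos :: real \<Rightarrow> real)"
proof -
  have "smooth (\<lambda>x::real. cos (x + real 0 * (pi / 2)))"
    by (rule smooth_derivative_sequence[of "\<lambda>j x. cos (x + real j * (pi / 2))" 0])
       (auto intro!: derivative_eq_intros simp: algebra_simps cos_add sin_add add_divide_distrib)
  then show ?thesis by simp
qed

text \<open>The profile is a smooth step applied to a shifted cosine. It takes its two extreme values on
  intervals of length \<open>\<mu>\<^sub>2 - \<eta>\<close> and \<open>\<mu>\<^sub>1 - \<eta>\<close>, so its mean \<open>c\<close> is not exactly zero but is small.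
  The function with bounded primitives is \<open>h - c\<close>.\<close>

lemma oscillation_profile:
  fixes \<mu>\<^sub>1 \<mu>\<^sub>2 \<eta> :: real and N :: nat
  assumes mu: "\<mu>\<^sub>1 + \<mu>\<^sub>2 = 1" and eta: "0 < \<eta>" "\<eta> < \<mu>\<^sub>1" "\<eta> < \<mu>\<^sub>2"
  obtains h :: "real \<Rightarrow> real" and c and G :: "nat \<Rightarrow> real \<Rightarrow> real" where
    "continuous_on UNIV h" "\<And>x. h (x + 1) = h x"
    "\<And>x. -\<mu>\<^sub>2 \<le> h x" "\<And>x. h x \<le> \<mu>\<^sub>1" "\<bar>c\<bar> \<le> 3 * \<eta>"
    "\<And>x. \<eta> / 2 \<le> x \<Longrightarrow> x \<le> \<mu>\<^sub>2 - \<eta> / 2 \<Longrightarrow> h x = \<mu>\<^sub>1"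
    "\<And>x. \<mu>\<^sub>2 + \<eta> / 2 \<le> x \<Longrightarrow> x \<le> 1 - \<eta> / 2 \<Longrightarrow> h x = - \<mu>\<^sub>2"
    "\<And>j x. (G j has_real_derivative G (Suc j) x) (at x)"
    "G N = (\<lambda>x. h x - c)" "\<And>j. j \<le> N \<Longrightarrow> \<exists>C. \<forall>x. \<bar>G j x\<bar> \<le> C"
proof -
  have "pi * (\<mu>\<^sub>2 + \<eta>) \<le> pi * 1" using mu eta by (intro mult_left_mono) auto
  then have le_pi: "pi * (\<mu>\<^sub>2 + \<eta>) \<le> pi" by simp
  have ge_0: "0 \<le> pi * (\<mu>\<^sub>2 - \<eta>)" using eta by simp
  have "pi * (\<mu>\<^sub>2 - \<eta>) < pi * (\<mu>\<^sub>2 + \<eta>)" using eta by (intro mult_strict_left_mono) auto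
  then have "cos (pi * (\<mu>\<^sub>2 + \<eta>)) < cos (pi * (\<mu>\<^sub>2 - \<eta>))"
    by (intro cos_monotone_0_pi ge_0 le_pi)
  then obtain \<sigma> :: "real \<Rightarrow> real" where s: "smooth \<sigma>" "\<And>x. x \<le> cos (pi * (\<mu>\<^sub>2 + \<eta>)) \<Longrightarrow> \<sigma> x = 0"
    "\<And>x. x \<ge> cos (pi * (\<mu>\<^sub>2 - \<eta>)) \<Longrightarrow> \<sigma> x = 1" "\<And>x. 0 \<le> \<sigma> x" "\<And>x. \<sigma> x \<le> 1"
    by (rule smooth_step_between) blast
  \<comment> \<open>Over a period the cosine of \<open>\<theta>\<close> is large on the interval of length \<open>\<mu>\<^sub>2\<close> around \<open>\<mu>\<^sub>2 / 2\<close>.\<close>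
  define \<theta> where "\<theta> x = 2 * pi * (x - \<mu>\<^sub>2 / 2)" for x
  define h where "h x = - \<mu>\<^sub>2 + \<sigma> (cos (\<theta> x))" for x
  have id: "smooth (\<lambda>x::real. x)" by (rule smooth_linear) (rule bounded_linear_ident)
  have "smooth \<theta>" unfolding \<theta>_def by (intro smooth_mult smooth_diff smooth_const id)
  from smooth_compose[OF smooth_cos this] have "smooth (\<lambda>x. cos (\<theta> x))" .
  from smooth_compose[OF s(1) this] have sh: "smooth h" unfolding h_def by (intro smooth_add smooth_const)
  then have conth: "continuous_on UNIV h" by (rule smooth_continuous_on)
  have perh: "h (x + 1) = h x" for x
  proof -
    have "\<theta> (x + 1) = \<theta> x + 2 * pi" by (simp add: \<theta>_def algebra_simps)
    then show ?thesis by (simp add: h_def)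
  qed
  have lo: "-\<mu>\<^sub>2 \<le> h x" and hi: "h x \<le> \<mu>\<^sub>1" for x
    using s(4,5)[of "cos (\<theta> x)"] mu by (auto simp: h_def)
  have up: "h x = \<mu>\<^sub>1" if "\<eta> / 2 \<le> x" "x \<le> \<mu>\<^sub>2 - \<eta> / 2" for x
  proof -
    have "\<bar>x - \<mu>\<^sub>2 / 2\<bar> \<le> (\<mu>\<^sub>2 - \<eta>) / 2"
      using that by (simp add: abs_if field_simps)
    then have "2 * pi * \<bar>x - \<mu>\<^sub>2 / 2\<bar> \<le> 2 * pi * ((\<mu>\<^sub>2 - \<eta>) / 2)"
      by (intro mult_left_mono) auto
    then have "\<bar>\<theta> x\<bar> \<le> pi * (\<mu>\<^sub>2 - \<eta>)" by (simp add: \<theta>_def abs_mult)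
    moreover have "pi * (\<mu>\<^sub>2 - \<eta>) \<le> pi" using \<open>pi * (\<mu>\<^sub>2 - \<eta>) < pi * (\<mu>\<^sub>2 + \<eta>)\<close> le_pi by linarith
    ultimately have "cos (pi * (\<mu>\<^sub>2 - \<eta>)) \<le> cos \<bar>\<theta> x\<bar>"
      by (intro cos_monotone_0_pi_le) auto
    then show ?thesis using s(3) mu by (simp add: h_def)
  qed
  have down: "h x = - \<mu>\<^sub>2" if "\<mu>\<^sub>2 + \<eta> / 2 \<le> x" "x \<le> 1 - \<eta> / 2" for x
  proof -
    have "2 * pi * ((\<mu>\<^sub>2 + \<eta>) / 2) \<le> 2 * pi * (x - \<mu>\<^sub>2 / 2)"
      using that by (intro mult_left_mono) (auto simp: field_simps)
    then have l: "pi * (\<mu>\<^sub>2 + \<eta>) \<le> \<theta> x" by (simp add: \<theta>_def)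
    have "2 * pi * (x - \<mu>\<^sub>2 / 2) \<le> 2 * pi * (1 - (\<mu>\<^sub>2 + \<eta>) / 2)"
      using that by (intro mult_left_mono) (auto simp: field_simps)
    moreover have "2 * pi * (1 - (\<mu>\<^sub>2 + \<eta>) / 2) = 2 * pi - pi * (\<mu>\<^sub>2 + \<eta>)"
      by (simp add: field_simps)
    ultimately have u: "\<theta> x \<le> 2 * pi - pi * (\<mu>\<^sub>2 + \<eta>)" by (simp add: \<theta>_def)
    have p0: "0 \<le> pi * (\<mu>\<^sub>2 + \<eta>)" using eta by simp
    have "cos (\<theta> x) \<le> cos (pi * (\<mu>\<^sub>2 + \<eta>))"
    proof (cases "\<theta> x \<le> pi")
      case True
      then show ?thesis using l p0 by (intro cos_monotone_0_pi_le) auto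
    next
      case False
      then have "cos (2 * pi - \<theta> x) \<le> cos (pi * (\<mu>\<^sub>2 + \<eta>))"
        using u p0 by (intro cos_monotone_0_pi_le) auto
      then show ?thesis by (simp add: cos_diff)
    qed
    then show ?thesis using s(2) by (simp add: h_def)
  qed
  obtain c F where F: "\<And>x. F (x + 1) = F x" "\<And>x. (F has_real_derivative h x - c) (at x)"
    by (rule periodic_primitive[OF conth perh]) (rule that)
  have c: "\<bar>c\<bar> \<le> 3 * \<eta>"
  proof -
    \<comment> \<open>A primitive of \<open>h\<close>: its increment over a period is the mean \<open>c\<close>, and it is computed piecewise.\<close>
    define P where "P = (\<lambda>x. F x + c * x)"
    have P: "(P has_real_derivative h x) (at x)" for x
      unfolding P_def by (rule DERIV_cong[OF DERIV_add[OF F(2) DERIV_cmult_Id]]) simp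
    have mvt: "\<exists>z. a < z \<and> z < b \<and> P b - P a = (b - a) * h z" if "a < b" for a b
      by (rule MVT2[OF that]) (rule P)
    have bd: "-1 \<le> h z \<and> h z \<le> 1" for z using lo[of z] hi[of z] mu eta by linarith
    have small: "\<bar>P b - P a\<bar> \<le> b - a" if ab: "a < b" for a b
    proof -
      obtain z where z: "P b - P a = (b - a) * h z" using mvt[OF ab] by blast
      have "\<bar>P b - P a\<bar> = (b - a) * \<bar>h z\<bar>" unfolding z abs_mult using ab by simp
      moreover have "(b - a) * \<bar>h z\<bar> \<le> (b - a) * 1"
        using ab bd[of z] by (intro mult_left_mono) (simp_all add: abs_le_iff)
      ultimately show ?thesis by simp
    qed
    have m1: "P (\<mu>\<^sub>2 - \<eta> / 2) - P (\<eta> / 2) = (\<mu>\<^sub>2 - \<eta>) * \<mu>\<^sub>1"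
    proof -
      have "\<eta> / 2 < \<mu>\<^sub>2 - \<eta> / 2" using eta by simp
      from mvt[OF this] obtain z where z: "\<eta> / 2 < z" "z < \<mu>\<^sub>2 - \<eta> / 2"
        "P (\<mu>\<^sub>2 - \<eta> / 2) - P (\<eta> / 2) = (\<mu>\<^sub>2 - \<eta> / 2 - \<eta> / 2) * h z" by blast
      have "h z = \<mu>\<^sub>1" by (rule up) (use z(1,2) in simp_all)
      moreover have "\<mu>\<^sub>2 - \<eta> / 2 - \<eta> / 2 = \<mu>\<^sub>2 - \<eta>" by simp
      ultimately show ?thesis using z(3) by (simp only:)
    qed
    have m2: "P (1 - \<eta> / 2) - P (\<mu>\<^sub>2 + \<eta> / 2) = (\<mu>\<^sub>1 - \<eta>) * (- \<mu>\<^sub>2)"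
    proof -
      have "\<mu>\<^sub>2 + \<eta> / 2 < 1 - \<eta> / 2" using eta mu by simp
      from mvt[OF this] obtain z where z: "\<mu>\<^sub>2 + \<eta> / 2 < z" "z < 1 - \<eta> / 2"
        "P (1 - \<eta> / 2) - P (\<mu>\<^sub>2 + \<eta> / 2) = (1 - \<eta> / 2 - (\<mu>\<^sub>2 + \<eta> / 2)) * h z" by blast
      have "h z = - \<mu>\<^sub>2" by (rule down) (use z(1,2) in simp_all)
      moreover have "1 - \<eta> / 2 - (\<mu>\<^sub>2 + \<eta> / 2) = \<mu>\<^sub>1 - \<eta>" using mu by simp
      ultimately show ?thesis using z(3) by (simp only:)
    qed
    have "F 1 = F 0" using F(1)[of 0] by simp
    then have total: "P 1 - P 0 = c" by (simp add: P_def)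
    have e1: "\<bar>P (\<eta> / 2) - P 0\<bar> \<le> \<eta> / 2" using small[of 0 "\<eta> / 2"] eta by simp
    have e2: "\<bar>P (\<mu>\<^sub>2 + \<eta> / 2) - P (\<mu>\<^sub>2 - \<eta> / 2)\<bar> \<le> \<eta>"
      using small[of "\<mu>\<^sub>2 - \<eta> / 2" "\<mu>\<^sub>2 + \<eta> / 2"] eta by simp
    have e3: "\<bar>P 1 - P (1 - \<eta> / 2)\<bar> \<le> \<eta> / 2" using small[of "1 - \<eta> / 2" 1] eta by simp
    have "(\<mu>\<^sub>2 - \<eta>) * \<mu>\<^sub>1 + (\<mu>\<^sub>1 - \<eta>) * (- \<mu>\<^sub>2) = \<eta> * (\<mu>\<^sub>2 - \<mu>\<^sub>1)" by (simp add: algebra_simps)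
    moreover have "\<bar>\<eta> * (\<mu>\<^sub>2 - \<mu>\<^sub>1)\<bar> \<le> \<eta> * 1"
      unfolding abs_mult using eta mu by (intro mult_mono) auto
    ultimately show ?thesis using total e1 e2 e3 m1 m2 by linarith
  qed
  have "continuous_on UNIV (\<lambda>x. h x - c)" by (intro continuous_on_diff conth continuous_on_const)
  then have "\<exists>G H'. primitive_chain N (\<lambda>x. h x - c) G H'"
    by (rule iterated_periodic_primitives[of _ F]) (simp_all add: perh F)
  then obtain G H' where "primitive_chain N (\<lambda>x. h x - c) G H'"
    by (elim exE) (rule that)
  then have G: "G N = (\<lambda>x. h x - c)" "\<And>j x. j < N \<Longrightarrow> (G j has_real_derivative G (Suc j) x) (at x)"
    "\<And>j. j \<le> N \<Longrightarrow> continuous_on UNIV (G j)" "\<And>j x. j \<le> N \<Longrightarrow> G j (x + 1) = G j x"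
    unfolding primitive_chain_def by (metis, metis, metis, metis)
  define D where "D k = (dir_deriv 1 ^^ k) (\<lambda>x. h x - c)" for k
  have sD: "smooth (D k)" for k by (induction k) (auto simp: D_def sh)
  have D: "(D k has_real_derivative D (Suc k) x) (at x)" for k x
    using has_real_derivative_along_line[OF sD[of k], of 0 1 x] by (simp add: D_def)
  \<comment> \<open>The sequence is continued beyond \<open>N\<close> by the derivatives of \<open>h - c\<close>.\<close>
  define G' where "G' j = (if j \<le> N then G j else D (j - N))" for j
  show ?thesis
  proof (rule that)
    show "(G' j has_real_derivative G' (Suc j) x) (at x)" for j x
    proof -
      consider "j < N" | "j = N" | "j > N" by linarith
      then show ?thesis
      proof cases
        case 1
        then show ?thesis using G(2) by (simp add: G'_def)
      next
        case 2
        then show ?thesis using D[of 0 x] G(1) by (simp add: G'_def D_def)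
      next
        case 3
        then show ?thesis using D[of "j - N" x] by (simp add: G'_def Suc_diff_le)
      qed
    qed
    show "G' N = (\<lambda>x. h x - c)" by (simp add: G'_def G(1))
    show "\<exists>C. \<forall>x. \<bar>G' j x\<bar> \<le> C" if j: "j \<le> N" for j
    proof -
      obtain C where "\<And>x. \<bar>G j x\<bar> \<le> C"
        using periodic_bounded[OF G(3)[OF j] G(4)[OF j]] by blast
      then show ?thesis using j by (auto simp: G'_def)
    qed
  qed (fact conth perh lo hi c up down)+
qed

section \<open>Equidistribution of the phase\<close>

text \<open>The set where the phase \<open>r (\<zeta> \<bullet> p)\<close>, taken modulo one, lies in cell number \<open>i\<close> of the \<open>m\<close> equal cells
  of a period.\<close>

definition phase_cell :: "'a::euclidean_space \<Rightarrow> int \<Rightarrow> real \<Rightarrow> int \<Rightarrow> 'a set" where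
  "phase_cell \<zeta> m r i = {p. \<lfloor>of_int m * (r * (\<zeta> \<bullet> p))\<rfloor> mod m = i}"

lemma phase_cell_borel: "phase_cell \<zeta> m r i \<in> sets borel"
proof -
  have *: "(\<lambda>p. of_int m * (r * (\<zeta> \<bullet> p))) \<in> borel_measurable borel"
    by simp
  have "(\<lambda>p. \<lfloor>of_int m * (r * (\<zeta> \<bullet> p))\<rfloor>) \<in> measurable borel (count_space UNIV)"
    by (rule measurable_compose[OF * measurable_real_floor])
  from measurable_sets[OF this, of "{k. k mod m = i}"]
  show ?thesis by (simp add: phase_cell_def vimage_def)
qed

lemma phase_cell_translate:
  assumes p: "p \<in> phase_cell \<zeta> m r l" and "0 \<le> i" "i < m" "\<zeta> \<noteq> 0" "r > 0"
  shows "p + (of_int (i - l) / (of_int m * r * (\<zeta> \<bullet> \<zeta>))) *\<^sub>R \<zeta> \<in> phase_cell \<zeta> m r i"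
proof -
  have "of_int m * (r * (\<zeta> \<bullet> (p + (of_int (i - l) / (of_int m * r * (\<zeta> \<bullet> \<zeta>))) *\<^sub>R \<zeta>)))
      = of_int m * (r * (\<zeta> \<bullet> p)) + of_int (i - l)"
    using assms by (simp add: inner_add_right field_simps)
  then have "\<lfloor>of_int m * (r * (\<zeta> \<bullet> (p + (of_int (i - l) / (of_int m * r * (\<zeta> \<bullet> \<zeta>))) *\<^sub>R \<zeta>)))\<rfloor>
      = \<lfloor>of_int m * (r * (\<zeta> \<bullet> p))\<rfloor> + (i - l)"
    by (metis floor_add_int)
  moreover have "(\<lfloor>of_int m * (r * (\<zeta> \<bullet> p))\<rfloor> + (i - l)) mod m = (l + (i - l)) mod m"
    using p by (metis (mono_tags, lifting) phase_cell_def mem_Collect_eq mod_add_left_eq)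
  ultimately show ?thesis using assms by (simp add: phase_cell_def)
qed

text \<open>A translation along \<open>\<zeta>\<close> by a multiple of \<open>1 / (m r)\<close> carries any cell to any other, and for large
  \<open>r\<close> it keeps \<open>K\<close> inside \<open>U\<close>. So each of the \<open>m\<close> pieces of \<open>K\<close> has at most the measure of a single
  cell of \<open>U\<close>.\<close>

lemma phase_cells_equidistributed:
  fixes K U :: "'a::euclidean_space set"
  assumes K: "compact K" and U: "open U" "U \<in> lmeasurable" and "K \<subseteq> U" and "\<zeta> \<noteq> 0" and "m > 0"
  obtains R where "R > 0"
    "\<And>r i. \<lbrakk>R \<le> r; 0 \<le> i; i < m\<rbrakk> \<Longrightarrow>
       measure lebesgue K \<le> of_int m * measure lebesgue (U \<inter> phase_cell \<zeta> m r i)"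
proof -
  obtain e where e: "e > 0" "(\<Union>x\<in>K. ball x e) \<subseteq> U"
    by (rule compact_subset_open_imp_ball_epsilon_subset[OF K U(1) \<open>K \<subseteq> U\<close>]) (rule that)
  \<comment> \<open>For \<open>r\<close> beyond this bound the translation vector \<open>v\<close> below is shorter than \<open>e\<close>.\<close>
  define R where "R = 2 / (e * norm \<zeta>)"
  have nz: "norm \<zeta> > 0" using \<open>\<zeta> \<noteq> 0\<close> by simp
  have "R > 0" using e nz by (simp add: R_def)
  moreover have "measure lebesgue K \<le> of_int m * measure lebesgue (U \<inter> phase_cell \<zeta> m r i)"
    if "R \<le> r" "0 \<le> i" "i < m" for r i
  proof -
    have lam: "r > 0" using that \<open>R > 0\<close> by linarith
    have cell: "phase_cell \<zeta> m r j \<in> sets lebesgue" for j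
      by (intro sets_completionI_sets) (simp add: phase_cell_borel)
    have Kc: "K \<inter> phase_cell \<zeta> m r j \<in> lmeasurable" for j
      by (intro fmeasurable_Int_fmeasurable lmeasurable_compact K cell)
    have Uc: "U \<inter> phase_cell \<zeta> m r j \<in> lmeasurable" for j
      by (intro fmeasurable_Int_fmeasurable U cell)
    have le: "measure lebesgue (K \<inter> phase_cell \<zeta> m r l) \<le> measure lebesgue (U \<inter> phase_cell \<zeta> m r i)"
      if l: "0 \<le> l" "l < m" for l
    proof -
      define v where "v = (of_int (i - l) / (of_int m * r * (\<zeta> \<bullet> \<zeta>))) *\<^sub>R \<zeta>"
      have "\<bar>of_int (i - l)\<bar> \<le> (of_int m :: real)" using l that \<open>0 \<le> i\<close> \<open>i < m\<close> by linarith
      then have "norm v \<le> of_int m / (of_int m * r * (\<zeta> \<bullet> \<zeta>)) * norm \<zeta>"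
        using lam \<open>m > 0\<close> nz unfolding v_def norm_scaleR abs_divide
        by (intro mult_right_mono frac_le) (simp_all add: abs_mult)
      also have "\<dots> = 1 / (r * norm \<zeta>)"
        using lam \<open>m > 0\<close> nz by (simp add: dot_square_norm power2_eq_square field_simps)
      also have "\<dots> \<le> 1 / (R * norm \<zeta>)"
        using \<open>R \<le> r\<close> \<open>R > 0\<close> nz by (intro divide_left_mono mult_right_mono mult_pos_pos) auto
      also have "\<dots> = e / 2" using e nz by (simp add: R_def)
      also have "\<dots> < e" using e by simp
      finally have v: "norm v < e" .
      have "(+) v ` (K \<inter> phase_cell \<zeta> m r l) \<subseteq> U \<inter> phase_cell \<zeta> m r i"
      proof
        fix q assume "q \<in> (+) v ` (K \<inter> phase_cell \<zeta> m r l)"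
        then obtain p where p: "p \<in> K" "p \<in> phase_cell \<zeta> m r l" "q = p + v"
          by (auto simp: add.commute)
        have "q \<in> ball p e" using v p(3) by (simp add: dist_norm)
        then have "q \<in> U" using e(2) p(1) by blast
        moreover have "q \<in> phase_cell \<zeta> m r i"
          using phase_cell_translate[OF p(2) \<open>0 \<le> i\<close> \<open>i < m\<close> \<open>\<zeta> \<noteq> 0\<close> lam] p(3) by (simp add: v_def)
        ultimately show "q \<in> U \<inter> phase_cell \<zeta> m r i" by blast
      qed
      then have "measure lebesgue ((+) v ` (K \<inter> phase_cell \<zeta> m r l)) \<le> measure lebesgue (U \<inter> phase_cell \<zeta> m r i)"
        by (intro measure_mono_fmeasurable Uc fmeasurableD measurable_translation Kc)
      then show ?thesis by (simp add: measure_translation)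
    qed
    have "K = (\<Union>l\<in>{0..<m}. K \<inter> phase_cell \<zeta> m r l)"
      using \<open>m > 0\<close> by (auto simp: phase_cell_def)
    then have "measure lebesgue K \<le> (\<Sum>l\<in>{0..<m}. measure lebesgue (K \<inter> phase_cell \<zeta> m r l))"
      using measure_UNION_le[of "{0..<m}" "\<lambda>l. K \<inter> phase_cell \<zeta> m r l" lebesgue] Kc
      by (metis finite_atLeastLessThan_int fmeasurableD)
    also have "\<dots> \<le> (\<Sum>l\<in>{0..<m}. measure lebesgue (U \<inter> phase_cell \<zeta> m r i))"
      by (intro sum_mono le) auto
    also have "\<dots> = of_int m * measure lebesgue (U \<inter> phase_cell \<zeta> m r i)"
      using \<open>m > 0\<close> by simp
    finally show ?thesis .
  qed
  ultimately show ?thesis by (rule that)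
qed

lemma phase_cell_frac:
  assumes "p \<in> phase_cell \<zeta> m r i" "m > 0"
  shows "of_int i \<le> of_int m * frac (r * (\<zeta> \<bullet> p))" "of_int m * frac (r * (\<zeta> \<bullet> p)) \<le> of_int i + 1"
proof -
  define y where "y = r * (\<zeta> \<bullet> p)"
  have "of_int m * y = of_int m * frac y + of_int (m * \<lfloor>y\<rfloor>)"
    by (simp add: frac_def algebra_simps)
  then have "\<lfloor>of_int m * y\<rfloor> = \<lfloor>of_int m * frac y\<rfloor> + m * \<lfloor>y\<rfloor>"
    by (metis floor_add_int)
  then have "\<lfloor>of_int m * y\<rfloor> mod m = \<lfloor>of_int m * frac y\<rfloor> mod m" by simp
  moreover have "0 \<le> \<lfloor>of_int m * frac y\<rfloor>" using assms by simp
  moreover have "\<lfloor>of_int m * frac y\<rfloor> < m"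
    using assms(2) frac_lt_1[of y] by (simp add: floor_less_iff)
  ultimately have "\<lfloor>of_int m * frac y\<rfloor> = i"
    using assms(1) by (simp add: phase_cell_def y_def)
  then show "of_int i \<le> of_int m * frac (r * (\<zeta> \<bullet> p))" "of_int m * frac (r * (\<zeta> \<bullet> p)) \<le> of_int i + 1"
    unfolding y_def[symmetric] by linarith+
qed

definition phase_band :: "'a::euclidean_space \<Rightarrow> real \<Rightarrow> real \<Rightarrow> real \<Rightarrow> 'a set" where
  "phase_band \<zeta> r \<alpha> \<beta> = {p. \<alpha> \<le> frac (r * (\<zeta> \<bullet> p)) \<and> frac (r * (\<zeta> \<bullet> p)) \<le> \<beta>}"

text \<open>An interval of phases of length \<open>\<beta> - \<alpha>\<close> contains all but at most two of the \<open>(\<beta> - \<alpha>) m\<close> cells it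
  should contain, and the loss is small for a fine subdivision. Lower bounds suffice,
  because they will be applied to disjoint sets whose proportions add up to one. The set \<open>T\<close> is
  arbitrary so that open sets can be used for it.\<close>

lemma phase_intervals_equidistributed:
  fixes K U :: "'a::euclidean_space set"
  assumes K: "compact K" and U: "open U" "U \<in> lmeasurable" and "K \<subseteq> U" and "\<zeta> \<noteq> 0"
    and ab: "0 \<le> \<alpha>" "\<beta> \<le> 1" and "e > 0"
  obtains R where "R > 0"
    "\<And>r T. \<lbrakk>R \<le> r; T \<in> lmeasurable; U \<inter> phase_band \<zeta> r \<alpha> \<beta> \<subseteq> T\<rbrakk> \<Longrightarrow>
       (\<beta> - \<alpha>) * measure lebesgue K - e \<le> measure lebesgue T"
proof -
  define k where "k = measure lebesgue K"
  have "k \<ge> 0" by (simp add: k_def)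
  define m where "m = \<lceil>2 * k / e\<rceil> + 1"
  have "2 * k / e \<le> of_int m" unfolding m_def by linarith
  then have m: "2 * k \<le> of_int m * e" using \<open>e > 0\<close> by (simp add: field_simps)
  have "0 \<le> 2 * k / e" using \<open>k \<ge> 0\<close> \<open>e > 0\<close> by simp
  then have "m > 0" unfolding m_def by linarith
  obtain R where L: "R > 0" "\<And>r i. \<lbrakk>R \<le> r; 0 \<le> i; i < m\<rbrakk> \<Longrightarrow>
       measure lebesgue K \<le> of_int m * measure lebesgue (U \<inter> phase_cell \<zeta> m r i)"
    by (rule phase_cells_equidistributed[OF K U \<open>K \<subseteq> U\<close> \<open>\<zeta> \<noteq> 0\<close> \<open>m > 0\<close>]) (rule that)
  define I where "I = {\<lceil>\<alpha> * of_int m\<rceil>..<\<lfloor>\<beta> * of_int m\<rfloor>}"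
  have I: "0 \<le> i" "i < m" "\<alpha> * of_int m \<le> of_int i" "of_int i + 1 \<le> \<beta> * of_int m" if "i \<in> I" for i
  proof -
    have 1: "\<lceil>\<alpha> * of_int m\<rceil> \<le> i" and 2: "i + 1 \<le> \<lfloor>\<beta> * of_int m\<rfloor>" using that by (auto simp: I_def)
    show a: "\<alpha> * of_int m \<le> of_int i" using 1 by (simp add: ceiling_le_iff)
    show b: "of_int i + 1 \<le> \<beta> * of_int m" using 2 by (simp add: le_floor_iff)
    have "0 \<le> \<alpha> * of_int m" using ab \<open>m > 0\<close> by simp
    then show "0 \<le> i" using a by linarith
    have "\<beta> * of_int m \<le> 1 * of_int m" using ab \<open>m > 0\<close> by (intro mult_right_mono) auto
    then show "i < m" using b by linarith
  qed
  have cardI: "(\<beta> - \<alpha>) * of_int m - 2 \<le> real (card I)"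
  proof -
    have "real (card I) = real (nat (\<lfloor>\<beta> * of_int m\<rfloor> - \<lceil>\<alpha> * of_int m\<rceil>))" by (simp add: I_def)
    also have "\<dots> \<ge> of_int (\<lfloor>\<beta> * of_int m\<rfloor> - \<lceil>\<alpha> * of_int m\<rceil>)" by linarith
    finally have "of_int (\<lfloor>\<beta> * of_int m\<rfloor> - \<lceil>\<alpha> * of_int m\<rceil>) \<le> real (card I)" .
    moreover have "\<beta> * of_int m - 1 \<le> of_int \<lfloor>\<beta> * of_int m\<rfloor>" "of_int \<lceil>\<alpha> * of_int m\<rceil> \<le> \<alpha> * of_int m + 1"
      by linarith+
    moreover have "(\<beta> - \<alpha>) * of_int m = \<beta> * of_int m - \<alpha> * of_int m"
      by (rule left_diff_distrib)
    ultimately show ?thesis by linarith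
  qed
  have "(\<beta> - \<alpha>) * k - e \<le> measure lebesgue T"
    if "R \<le> r" and T: "T \<in> lmeasurable" and sub: "U \<inter> phase_band \<zeta> r \<alpha> \<beta> \<subseteq> T"
    for r T
  proof -
    have cell: "U \<inter> phase_cell \<zeta> m r j \<in> lmeasurable" for j
      by (intro fmeasurable_Int_fmeasurable U sets_completionI_sets) (simp add: phase_cell_borel)
    have "(\<Union>i\<in>I. U \<inter> phase_cell \<zeta> m r i) \<subseteq> T"
    proof (rule UN_least, rule subsetI)
      fix i p assume i: "i \<in> I" and p: "p \<in> U \<inter> phase_cell \<zeta> m r i"
      have "of_int i \<le> of_int m * frac (r * (\<zeta> \<bullet> p))" "of_int m * frac (r * (\<zeta> \<bullet> p)) \<le> of_int i + 1"
        using p by (auto intro: phase_cell_frac[OF _ \<open>m > 0\<close>])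
      then have "\<alpha> * of_int m \<le> frac (r * (\<zeta> \<bullet> p)) * of_int m" "frac (r * (\<zeta> \<bullet> p)) * of_int m \<le> \<beta> * of_int m"
        using I(3,4)[OF i] unfolding mult.commute[of _ "of_int m"] by linarith+
      then have "\<alpha> \<le> frac (r * (\<zeta> \<bullet> p))" "frac (r * (\<zeta> \<bullet> p)) \<le> \<beta>"
        using \<open>m > 0\<close> by (simp_all only: mult_le_cancel_right_pos of_int_0_less_iff)
      then show "p \<in> T" using sub p by (auto simp: phase_band_def)
    qed
    moreover have "(\<Union>i\<in>I. U \<inter> phase_cell \<zeta> m r i) \<in> sets lebesgue"
      using cell by (intro sets.finite_UN) (auto simp: I_def)
    ultimately have "measure lebesgue (\<Union>i\<in>I. U \<inter> phase_cell \<zeta> m r i) \<le> measure lebesgue T"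
      using T by (intro measure_mono_fmeasurable)
    moreover have "measure lebesgue (\<Union>i\<in>I. U \<inter> phase_cell \<zeta> m r i) = (\<Sum>i\<in>I. measure lebesgue (U \<inter> phase_cell \<zeta> m r i))"
    proof (rule measure_finite_Union)
      show "finite I" by (simp add: I_def)
      show "(\<lambda>i. U \<inter> phase_cell \<zeta> m r i) ` I \<subseteq> sets lebesgue"
        using cell by (auto simp: fmeasurableD)
      show "disjoint_family_on (\<lambda>i. U \<inter> phase_cell \<zeta> m r i) I"
        by (auto simp: disjoint_family_on_def phase_cell_def)
      show "emeasure lebesgue (U \<inter> phase_cell \<zeta> m r i) \<noteq> \<infinity>" for i
        using fmeasurableD2[OF cell] by simp
    qed
    moreover have "real (card I) * (k / of_int m) \<le> (\<Sum>i\<in>I. measure lebesgue (U \<inter> phase_cell \<zeta> m r i))"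
    proof -
      have "(\<Sum>i\<in>I. k / of_int m) \<le> (\<Sum>i\<in>I. measure lebesgue (U \<inter> phase_cell \<zeta> m r i))"
        using L(2)[OF \<open>R \<le> r\<close>] I(1,2) \<open>m > 0\<close>
        by (intro sum_mono) (simp add: k_def divide_le_eq mult.commute)
      then show ?thesis by simp
    qed
    moreover have "((\<beta> - \<alpha>) * of_int m - 2) * (k / of_int m) \<le> real (card I) * (k / of_int m)"
      using cardI \<open>k \<ge> 0\<close> \<open>m > 0\<close> by (intro mult_right_mono) auto
    moreover have "((\<beta> - \<alpha>) * of_int m - 2) * (k / of_int m) = (\<beta> - \<alpha>) * k - 2 * k / of_int m"
      using \<open>m > 0\<close> by (simp add: field_simps)
    moreover have "2 * k / of_int m \<le> e"
      using m \<open>m > 0\<close> by (simp add: divide_le_eq mult.commute)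
    ultimately show ?thesis by linarith
  qed
  with L(1) show ?thesis unfolding k_def by (rule that)
qed

section \<open>A potential for the linear system\<close>

abbreviation dx :: "'n \<Rightarrow> ((real^'n) \<times> real \<Rightarrow> real) \<Rightarrow> (real^'n) \<times> real \<Rightarrow> real" where
  "dx j \<equiv> dir_deriv (axis j 1, 0)"

abbreviation dt :: "((real^'n) \<times> real \<Rightarrow> real) \<Rightarrow> (real^'n) \<times> real \<Rightarrow> real" where
  "dt \<equiv> dir_deriv (0, 1)"

text \<open>The Laplacian in the space variables only.\<close>

definition lap :: "((real^'n) \<times> real \<Rightarrow> real) \<Rightarrow> (real^'n) \<times> real \<Rightarrow> real" where
  "lap f = (\<lambda>p. \<Sum>j\<in>UNIV. dx j (dx j f) p)"

definition vdiv :: "('n \<Rightarrow> (real^'n) \<times> real \<Rightarrow> real) \<Rightarrow> (real^'n) \<times> real \<Rightarrow> real" where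
  "vdiv u = (\<lambda>p. \<Sum>j\<in>UNIV. dx j (u j) p)"

lemma smooth_lap [simp, intro]: "smooth f \<Longrightarrow> smooth (lap f)"
  by (simp add: lap_def)

lemma smooth_vdiv [simp]: "(\<And>j. smooth (u j)) \<Longrightarrow> smooth (vdiv u)"
  by (simp add: vdiv_def)

lemma lap_cmult: "smooth f \<Longrightarrow> lap (\<lambda>p. c * f p) = (\<lambda>p. c * lap f p)"
  by (simp add: lap_def dir_deriv_cmult sum_distrib_left)

lemma lap_diff: "smooth f \<Longrightarrow> smooth g \<Longrightarrow> lap (\<lambda>p. f p - g p) = (\<lambda>p. lap f p - lap g p)"
  by (simp add: lap_def dir_deriv_diff sum_subtractf)

lemma lap_sum:
  "(\<And>i. i \<in> I \<Longrightarrow> smooth (f i)) \<Longrightarrow> lap (\<lambda>p. \<Sum>i\<in>I. f i p) = (\<lambda>p. \<Sum>i\<in>I. lap (f i) p)"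
proof -
  assume f: "\<And>i. i \<in> I \<Longrightarrow> smooth (f i)"
  have "lap (\<lambda>p. \<Sum>i\<in>I. f i p) = (\<lambda>p. \<Sum>j\<in>UNIV. \<Sum>i\<in>I. dx j (dx j (f i)) p)"
    by (simp add: lap_def dir_deriv_sum f)
  also have "\<dots> = (\<lambda>p. \<Sum>i\<in>I. lap (f i) p)"
    unfolding lap_def by (rule ext, rule sum.swap)
  finally show ?thesis .
qed

lemma dir_deriv_lap: "smooth f \<Longrightarrow> dir_deriv v (lap f) = lap (dir_deriv v f)"
proof -
  assume f: "smooth f"
  have "dir_deriv v (dx j (dx j f)) = dx j (dx j (dir_deriv v f))" for j
    using dir_deriv_commute[of "dx j f" v "(axis j 1, 0)"] dir_deriv_commute[of f v "(axis j 1, 0)"] f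
    by simp
  then show ?thesis using f by (simp add: lap_def dir_deriv_sum)
qed

text \<open>The field \<open>\<Delta>\<phi> a - \<nabla>(a \<bullet> \<nabla>\<phi>)\<close>. Its symbol is the projection of \<open>a\<close> onto the complement of \<open>\<xi>\<close>, for
  \<open>\<xi>\<close> of length one and up to sign.\<close>

definition divfree_potential ::
    "real^'n \<Rightarrow> ((real^'n) \<times> real \<Rightarrow> real) \<Rightarrow> 'n \<Rightarrow> (real^'n) \<times> real \<Rightarrow> real" where
  "divfree_potential a \<phi> i = (\<lambda>p. a $ i * lap \<phi> p - dx i (\<lambda>p. \<Sum>j\<in>UNIV. a $ j * dx j \<phi> p) p)"

text \<open>The field \<open>B m - \<partial>\<^sub>t m - \<Delta>(A \<nabla>\<phi>)\<close>, where \<open>m\<close> is the divergence-free potential. Its image under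
  \<open>bilap_inverse_div\<close> corrects the stress \<open>\<Delta>\<^sup>3\<phi> A\<close> so that the balance law holds exactly.\<close>

definition residual_flux ::
    "real^'n^'n \<Rightarrow> real^'n \<Rightarrow> real^'n^'n \<Rightarrow> ((real^'n) \<times> real \<Rightarrow> real) \<Rightarrow> 'n \<Rightarrow> (real^'n) \<times> real \<Rightarrow> real" where
  "residual_flux B a A \<phi> i = (\<lambda>p. (\<Sum>j\<in>UNIV. B $ i $ j * divfree_potential a \<phi> j p)
     - dt (divfree_potential a \<phi> i) p - lap (\<lambda>p. \<Sum>j\<in>UNIV. A $ i $ j * dx j \<phi> p) p)"

text \<open>The coefficient \<open>c\<close> in \<open>bilap_inverse_div\<close>: the trace there is \<open>1 + (n - 1) c\<close> times
  \<open>\<Delta> (div u)\<close>. In dimension one, where no such \<open>c\<close> exists, division by zero gives the value \<open>0\<close>.\<close>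

definition trace_coeff :: "'n itself \<Rightarrow> real" where
  "trace_coeff _ = - 1 / (real CARD('n) - 1)"

text \<open>The matrix field \<open>\<Delta>(\<nabla>u + \<nabla>u\<^sup>T) + b \<nabla>\<^sup>2(div u) + c \<Delta>(div u) Id\<close>, a local right inverse of the
  divergence up to \<open>\<Delta>\<^sup>2\<close>. The divergence forces \<open>1 + b + c = 0\<close>, and the trace then determines \<open>c\<close>.\<close>

definition bilap_inverse_div ::
    "('n \<Rightarrow> (real^'n) \<times> real \<Rightarrow> real) \<Rightarrow> 'n \<Rightarrow> 'n \<Rightarrow> (real^'n) \<times> real \<Rightarrow> real" where
  "bilap_inverse_div u i j = (\<lambda>p. lap (dx j (u i)) p + lap (dx i (u j)) p
     - (1 + trace_coeff TYPE('n)) * dx i (dx j (vdiv u)) p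
     + (if i = j then trace_coeff TYPE('n) else 0) * lap (vdiv u) p)"

definition wave_velocity ::
    "real^'n \<Rightarrow> ((real^'n) \<times> real \<Rightarrow> real) \<Rightarrow> 'n \<Rightarrow> (real^'n) \<times> real \<Rightarrow> real" where
  "wave_velocity a \<phi> i = lap (lap (divfree_potential a \<phi> i))"

text \<open>Together with \<open>wave_velocity\<close> this is the operator \<open>P\<close> of order six that is explained above.\<close>

definition wave_stress ::
    "real^'n^'n \<Rightarrow> real^'n \<Rightarrow> real^'n^'n \<Rightarrow> ((real^'n) \<times> real \<Rightarrow> real) \<Rightarrow> 'n \<Rightarrow> 'n \<Rightarrow> (real^'n) \<times> real \<Rightarrow> real" where
  "wave_stress B a A \<phi> i j =
     (\<lambda>p. A $ i $ j * lap (lap (lap \<phi>)) p + bilap_inverse_div (residual_flux B a A \<phi>) i j p)"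

lemma smooth_divfree_potential [simp]: "smooth \<phi> \<Longrightarrow> smooth (divfree_potential a \<phi> i)"
  by (simp add: divfree_potential_def)

lemma smooth_residual_flux [simp]: "smooth \<phi> \<Longrightarrow> smooth (residual_flux B a A \<phi> i)"
  by (simp add: residual_flux_def)

lemma smooth_bilap_inverse_div [simp]: "(\<And>i. smooth (u i)) \<Longrightarrow> smooth (bilap_inverse_div u i j)"
  by (simp add: bilap_inverse_div_def)

lemma smooth_wave_velocity [simp]: "smooth \<phi> \<Longrightarrow> smooth (wave_velocity a \<phi> i)"
  by (simp add: wave_velocity_def)

lemma smooth_wave_stress [simp]: "smooth \<phi> \<Longrightarrow> smooth (wave_stress B a A \<phi> i j)"
  by (simp add: wave_stress_def)

lemma vdiv_divfree_potential:
  assumes "smooth \<phi>"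
  shows "vdiv (divfree_potential a \<phi>) = (\<lambda>p. 0)"
proof
  fix p
  define g where "g = (\<lambda>p. \<Sum>j\<in>UNIV. a $ j * dx j \<phi> p)"
  have g: "smooth g" using assms by (simp add: g_def)
  have "vdiv (divfree_potential a \<phi>) p = (\<Sum>i\<in>UNIV. a $ i * lap (dx i \<phi>) p) - lap g p"
    using assms g
    by (simp add: vdiv_def divfree_potential_def g_def[symmetric] dir_deriv_diff dir_deriv_cmult
        sum_subtractf dir_deriv_lap lap_def[of g])
  also have "lap g p = (\<Sum>i\<in>UNIV. a $ i * lap (dx i \<phi>) p)"
    using assms by (simp add: g_def lap_sum lap_cmult)
  finally show "vdiv (divfree_potential a \<phi>) p = 0" by simp
qed

lemma vdiv_lap:
  "(\<And>i. smooth (u i)) \<Longrightarrow> vdiv (\<lambda>i. lap (u i)) = lap (vdiv u)"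
  by (simp add: vdiv_def dir_deriv_lap lap_sum)

lemma vdiv_wave_velocity:
  assumes "smooth \<phi>"
  shows "vdiv (wave_velocity a \<phi>) = (\<lambda>p. 0)"
proof -
  have "vdiv (wave_velocity a \<phi>) = lap (lap (vdiv (divfree_potential a \<phi>)))"
    using assms by (simp add: wave_velocity_def[abs_def] vdiv_lap)
  also have "\<dots> = (\<lambda>p. 0)"
    using assms by (simp add: vdiv_divfree_potential lap_def dir_deriv_const)
  finally show ?thesis .
qed

text \<open>Besides \<open>\<Delta>\<^sup>2 u\<close> the divergence produces multiples of \<open>\<Delta> \<nabla>(div u)\<close> with coefficients \<open>1\<close>,
  \<open>- (1 + c)\<close> and \<open>c\<close>, which cancel.\<close>

lemma vdiv_bilap_inverse_div:
  fixes u :: "'n::finite \<Rightarrow> (real^'n) \<times> real \<Rightarrow> real"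
  assumes u: "\<And>i. smooth (u i)"
  shows "vdiv (bilap_inverse_div u i) = lap (lap (u i))"
proof
  fix p
  let ?d = "vdiv u" and ?c = "trace_coeff TYPE('n)"
  have d: "smooth ?d" using u by simp
  have "vdiv (bilap_inverse_div u i) p =
     (\<Sum>j\<in>UNIV. dx j (lap (dx j (u i))) p) + (\<Sum>j\<in>UNIV. dx j (lap (dx i (u j))) p)
     - (1 + ?c) * (\<Sum>j\<in>UNIV. dx j (dx i (dx j ?d)) p)
     + (\<Sum>j\<in>UNIV. (if i = j then ?c else 0) * dx j (lap ?d) p)"
    unfolding vdiv_def[of "bilap_inverse_div u i"] bilap_inverse_div_def using u d
    by (simp add: dir_deriv_add dir_deriv_diff dir_deriv_cmult sum.distrib sum_subtractf sum_distrib_left)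
  also have "(\<Sum>j\<in>UNIV. dx j (lap (dx j (u i))) p) = lap (lap (u i)) p"
    using u by (subst (2) lap_def) (simp add: lap_sum dir_deriv_lap)
  also have "(\<Sum>j\<in>UNIV. dx j (lap (dx i (u j))) p) = lap (dx i ?d) p"
  proof -
    have "dx i ?d = (\<lambda>p. \<Sum>j\<in>UNIV. dx j (dx i (u j)) p)"
      using u by (simp add: vdiv_def dir_deriv_sum dir_deriv_commute[of "u _" "(axis i 1, 0)"])
    then show ?thesis using u by (simp add: lap_sum dir_deriv_lap)
  qed
  also have "(\<Sum>j\<in>UNIV. dx j (dx i (dx j ?d)) p) = lap (dx i ?d) p"
    using d by (simp add: lap_def dir_deriv_commute[of ?d "(axis i 1, 0)"])
  also have "(\<Sum>j\<in>UNIV. (if i = j then ?c else 0) * dx j (lap ?d) p) = ?c * lap (dx i ?d) p"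
    using d by (simp add: dir_deriv_lap if_distrib[of "\<lambda>x. x * _"] cong: if_cong)
  finally show "vdiv (bilap_inverse_div u i) p = lap (lap (u i)) p"
    by (simp add: algebra_simps)
qed

lemma bilap_inverse_div_sym:
  assumes u: "\<And>i. smooth (u i)"
  shows "bilap_inverse_div u i j = bilap_inverse_div u j i"
  using u by (simp add: bilap_inverse_div_def dir_deriv_commute[of "vdiv u" "(axis i 1, 0)"] add.commute eq_commute)

lemma bilap_inverse_div_trace:
  fixes u :: "'n::finite \<Rightarrow> (real^'n) \<times> real \<Rightarrow> real"
  assumes u: "\<And>i. smooth (u i)" and n: "CARD('n) \<ge> 2"
  shows "(\<Sum>i\<in>UNIV. bilap_inverse_div u i i p) = 0"
proof -
  let ?c = "trace_coeff TYPE('n)" and ?L = "lap (vdiv u) p"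
  have "(\<Sum>i\<in>UNIV. lap (dx i (u i)) p) = ?L"
    using u by (simp add: vdiv_def lap_sum)
  moreover have "(\<Sum>i\<in>UNIV. dx i (dx i (vdiv u)) p) = ?L" by (simp add: lap_def)
  ultimately have "(\<Sum>i\<in>UNIV. bilap_inverse_div u i i p) = ?L + ?L - (1 + ?c) * ?L + real CARD('n) * (?c * ?L)"
    by (simp add: bilap_inverse_div_def sum.distrib sum_subtractf flip: sum_distrib_left)
  also have "\<dots> = (1 + (real CARD('n) - 1) * ?c) * ?L" by (simp add: algebra_simps)
  also have "(real CARD('n) - 1) * ?c = -1" using n by (simp add: trace_coeff_def)
  finally show ?thesis by simp
qed

text \<open>The term \<open>\<Delta>\<^sup>3 (A \<nabla>\<phi>)\<close> coming from \<open>\<Delta>\<^sup>3\<phi> A\<close> is removed by the last part of the residual flux;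
  its first two parts yield \<open>\<Delta>\<^sup>2 (B m) = B n\<close> and \<open>- \<Delta>\<^sup>2 \<partial>\<^sub>t m = - \<partial>\<^sub>t n\<close>.\<close>

lemma wave_balance:
  assumes "smooth \<phi>"
  shows "dt (wave_velocity a \<phi> i) p + vdiv (wave_stress B a A \<phi> i) p
    = (\<Sum>j\<in>UNIV. B $ i $ j * wave_velocity a \<phi> j p)"
proof -
  let ?u = "residual_flux B a A \<phi>" and ?m = "divfree_potential a \<phi>"
  let ?g = "\<lambda>p. \<Sum>j\<in>UNIV. A $ i $ j * dx j \<phi> p"
  have g: "smooth ?g" using assms by simp
  have "vdiv (wave_stress B a A \<phi> i) p
      = (\<Sum>j\<in>UNIV. A $ i $ j * dx j (lap (lap (lap \<phi>))) p) + vdiv (bilap_inverse_div ?u i) p"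
    using assms by (simp add: vdiv_def wave_stress_def dir_deriv_add dir_deriv_cmult sum.distrib)
  also have "vdiv (bilap_inverse_div ?u i) p = lap (lap (?u i)) p"
    using assms by (simp add: vdiv_bilap_inverse_div)
  also have "lap (lap (?u i)) p = (\<Sum>j\<in>UNIV. B $ i $ j * lap (lap (?m j)) p)
      - lap (lap (dt (?m i))) p - lap (lap (lap ?g)) p"
    using assms g by (simp only: residual_flux_def lap_diff lap_sum lap_cmult smooth_lap smooth_dir_deriv
        smooth_sum smooth_mult smooth_const smooth_diff smooth_divfree_potential)
  also have "lap (lap (lap ?g)) p = (\<Sum>j\<in>UNIV. A $ i $ j * dx j (lap (lap (lap \<phi>))) p)"
    using assms by (simp add: lap_sum lap_cmult dir_deriv_lap)
  also have "lap (lap (dt (?m i))) p = dt (wave_velocity a \<phi> i) p"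
    using assms by (simp add: wave_velocity_def dir_deriv_lap)
  finally show ?thesis by (simp add: wave_velocity_def)
qed

section \<open>Fields generated by a scalar potential\<close>

text \<open>Coordinates of a state are entries of its vector or of its matrix, so estimates and integrals can be
  treated entry by entry.\<close>

lemma state_Basis_cases:
  fixes b :: "(real^'n) \<times> (real^'n^'n)"
  assumes "b \<in> Basis"
  obtains i where "\<And>z. z \<bullet> b = fst z $ i" | i j where "\<And>z. z \<bullet> b = snd z $ i $ j"
proof -
  from assms consider u where "u \<in> Basis" "b = (u, 0)" | v where "v \<in> Basis" "b = (0, v)"
    unfolding Basis_prod_def by blast
  then show ?thesis
  proof cases
    case 1
    then obtain i where "b = (axis i 1, 0)" by (auto simp: Basis_vec_def)
    then have "z \<bullet> b = fst z $ i" for z by (cases z) (simp add: inner_axis)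
    then show ?thesis by (rule that(1))
  next
    case 2
    then obtain i j where "b = (0, axis i (axis j 1))" by (auto simp: Basis_vec_def)
    then have "z \<bullet> b = snd z $ i $ j" for z by (cases z) (simp add: inner_axis)
    then show ?thesis by (rule that(2))
  qed
qed

lemma space_partial_eq_dx:
  assumes "smooth f"
  shows "space_partial j f p = dx j f p"
proof -
  obtain x t where p: "p = (x, t)" by (cases p)
  have "((\<lambda>s. f ((x, t) + s *\<^sub>R (axis j 1, 0))) has_real_derivative dx j f ((x, t) + 0 *\<^sub>R (axis j 1, 0))) (at 0)"
    by (rule has_real_derivative_along_line[OF assms])
  then have "((\<lambda>s. f (x + s *\<^sub>R axis j 1, t)) has_real_derivative dx j f (x, t)) (at 0)"
    by simp
  then show ?thesis by (simp add: p space_partial_def DERIV_imp_deriv)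
qed

lemma time_derivative_eq_dt:
  assumes v: "\<And>i. smooth (v i)"
  shows "time_derivative (\<lambda>p. \<chi> i. v i p) p = (\<chi> i. dt (v i) p)"
proof -
  obtain x t where p: "p = (x, t)" by (cases p)
  have comp: "((\<lambda>s. v i (x, s)) has_real_derivative dt (v i) (x, t)) (at t)" for i
  proof -
    have "((\<lambda>s. v i ((x, 0) + s *\<^sub>R (0, 1))) has_real_derivative dt (v i) ((x, 0) + t *\<^sub>R (0, 1))) (at t)"
      by (rule has_real_derivative_along_line[OF v])
    then show ?thesis by simp
  qed
  have "((\<lambda>s. \<chi> i. v i (x, s)) has_vector_derivative (\<chi> i. dt (v i) (x, t))) (at t)"
    unfolding has_vector_derivative_def has_derivative_componentwise_within[of "\<lambda>s. \<chi> i. v i (x, s)"]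
  proof
    fix b :: "real^'a" assume "b \<in> Basis"
    then obtain i where "b = axis i 1" by (auto simp: Basis_vec_def)
    then show "((\<lambda>s. (\<chi> i. v i (x, s)) \<bullet> b) has_derivative
        (\<lambda>h. (h *\<^sub>R (\<chi> i. dt (v i) (x, t))) \<bullet> b)) (at t)"
      using comp[of i] by (simp add: inner_axis has_field_derivative_def mult_commute_abs)
  qed
  then show ?thesis by (simp add: p time_derivative_def vector_derivative_at)
qed

definition slice_mean_zero :: "((real^'n) \<times> real \<Rightarrow> real) \<Rightarrow> bool" where
  "slice_mean_zero f \<longleftrightarrow>
     (\<forall>t. integrable lborel (\<lambda>x. f (x, t)) \<and> (LINT x|lborel. f (x, t)) = 0)"

lemma slice_mean_zero_add [simp]:
  "slice_mean_zero f \<Longrightarrow> slice_mean_zero g \<Longrightarrow> slice_mean_zero (\<lambda>p. f p + g p)"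
  by (simp add: slice_mean_zero_def)

lemma slice_mean_zero_diff [simp]:
  "slice_mean_zero f \<Longrightarrow> slice_mean_zero g \<Longrightarrow> slice_mean_zero (\<lambda>p. f p - g p)"
  by (simp add: slice_mean_zero_def)

lemma slice_mean_zero_cmult [simp]:
  "slice_mean_zero f \<Longrightarrow> slice_mean_zero (\<lambda>p. c * f p)"
  by (simp add: slice_mean_zero_def)

lemma slice_mean_zero_sum [simp]:
  "(\<And>i. i \<in> I \<Longrightarrow> slice_mean_zero (f i)) \<Longrightarrow> slice_mean_zero (\<lambda>p. \<Sum>i\<in>I. f i p)"
  by (simp add: slice_mean_zero_def)

definition vanishes_outside :: "'a set \<Rightarrow> ('a \<Rightarrow> real) \<Rightarrow> bool" where
  "vanishes_outside S f \<longleftrightarrow> (\<forall>p. p \<notin> S \<longrightarrow> f p = 0)"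

lemma vanishes_outside_dir_deriv [simp]:
  assumes "closed S" "vanishes_outside S f"
  shows "vanishes_outside S (dir_deriv v f)"
  unfolding vanishes_outside_def
proof (intro allI impI)
  fix p assume "p \<notin> S"
  have "((\<lambda>x. 0::real) has_derivative (\<lambda>x. 0)) (at p)" by simp
  then have "(f has_derivative (\<lambda>x. 0)) (at p)"
    by (rule has_derivative_transform_within_open[of _ _ _ _ "- S"])
       (use assms \<open>p \<notin> S\<close> in \<open>auto simp: vanishes_outside_def\<close>)
  then show "dir_deriv v f p = 0" by (rule dir_deriv_eqI)
qed

lemma vanishes_outside_ops [simp]:
  "vanishes_outside S f \<Longrightarrow> vanishes_outside S g \<Longrightarrow> vanishes_outside S (\<lambda>p. f p + g p)"
  "vanishes_outside S f \<Longrightarrow> vanishes_outside S g \<Longrightarrow> vanishes_outside S (\<lambda>p. f p - g p)"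
  "vanishes_outside S f \<Longrightarrow> vanishes_outside S (\<lambda>p. c * f p)"
  "(\<And>i. i \<in> I \<Longrightarrow> vanishes_outside S (h i)) \<Longrightarrow> vanishes_outside S (\<lambda>p. \<Sum>i\<in>I. h i p)"
  by (auto simp: vanishes_outside_def intro!: sum.neutral)

lemma smooth_vanishes_outside_bounded:
  fixes a :: "'a::euclidean_space \<Rightarrow> real"
  assumes "smooth a" "compact S" "vanishes_outside S a"
  obtains C where "\<And>p. \<bar>a p\<bar> \<le> C" "0 \<le> C"
proof -
  have "compact (a ` S)"
    by (rule compact_continuous_image[OF smooth_continuous_on[OF assms(1)] assms(2)])
  from compact_imp_bounded[OF this] obtain C where C: "\<And>y. y \<in> a ` S \<Longrightarrow> norm y \<le> C"
    unfolding bounded_iff by blast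
  have "\<bar>a p\<bar> \<le> \<bar>C\<bar>" for p
  proof (cases "p \<in> S")
    case True
    then show ?thesis using C[of "a p"] by auto
  next
    case False
    then have "a p = 0" using assms(3) unfolding vanishes_outside_def by blast
    then show ?thesis by simp
  qed
  then show ?thesis by (rule that) simp
qed

lemma continuous_slice:
  fixes f :: "(real^'n) \<times> real \<Rightarrow> real"
  shows "smooth f \<Longrightarrow> continuous_on A (\<lambda>x. f (x, t))"
  by (rule continuous_on_compose2[OF smooth_continuous_on[of f UNIV]]) (auto intro!: continuous_intros)

lemma integrable_slice:
  fixes f :: "(real^'n) \<times> real \<Rightarrow> real"
  assumes "smooth f" "compact S" "vanishes_outside S f"
  shows "integrable lborel (\<lambda>x. f (x, t))"
proof -
  have "compact (fst ` S)" using assms(2) by (intro compact_continuous_image continuous_intros)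
  from borel_integrable_compact[OF this continuous_slice[OF assms(1)]]
  have "integrable lborel (\<lambda>x. indicator (fst ` S) x *\<^sub>R f (x, t))" .
  moreover have "(\<lambda>x. indicator (fst ` S) x *\<^sub>R f (x, t)) = (\<lambda>x. f (x, t))"
    using assms(3) by (force simp: vanishes_outside_def indicator_def)
  ultimately show ?thesis by simp
qed

text \<open>By translation invariance the difference quotients of \<open>g\<close> in a space direction have integral zero.
  They converge to the derivative and are dominated, by the mean value theorem, by a constant on a
  fixed ball.\<close>

lemma slice_mean_zero_dx:
  fixes g :: "(real^'n) \<times> real \<Rightarrow> real"
  assumes g: "smooth g" and S: "compact S" "vanishes_outside S g"
  shows "slice_mean_zero (dx j g)"
  unfolding slice_mean_zero_def
proof (intro allI conjI)
  fix t
  let ?e = "axis j (1::real) :: real^'n"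
  have vd: "vanishes_outside S (dx j g)"
    using S by (simp add: compact_imp_closed)
  show int: "integrable lborel (\<lambda>x. dx j g (x, t))"
    using g S(1) vd by (intro integrable_slice) auto
  obtain R where R: "\<And>p. p \<in> S \<Longrightarrow> norm p \<le> R"
    using compact_imp_bounded[OF S(1)] unfolding bounded_iff by blast
  obtain C where bound: "\<And>p. \<bar>dx j g p\<bar> \<le> C" and "0 \<le> C"
    by (rule smooth_vanishes_outside_bounded[OF smooth_dir_deriv[OF g] S(1) vd]) (rule that)
  define h where "h k = 1 / real (Suc k)" for k
  have h: "0 < h k" "h k \<le> 1" for k by (auto simp: h_def)
  define q where "q k x = (g (x + h k *\<^sub>R ?e, t) - g (x, t)) / h k" for k x
  have line: "((\<lambda>s. g (x + s *\<^sub>R ?e, t)) has_real_derivative dx j g (x + s *\<^sub>R ?e, t)) (at s)" for x s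
    using has_real_derivative_along_line[OF g, of "(x, t)" "(?e, 0)" s] by simp
  have gint: "integrable lborel (\<lambda>x. g (x, t))" by (rule integrable_slice[OF g S])
  have shift: "integrable lborel (\<lambda>x. g (x + c, t))" "(LINT x|lborel. g (x + c, t)) = (LINT x|lborel. g (x, t))" for c
  proof -
    have meas: "(\<lambda>x. g (x, t)) \<in> borel_measurable borel"
      using borel_measurable_integrable[OF gint] by simp
    show "integrable lborel (\<lambda>x. g (x + c, t))"
      using integrable_distr_eq[of "(+) c" lborel borel "\<lambda>x. g (x, t)"] meas gint
      by (simp add: lborel_distr_plus add.commute)
    show "(LINT x|lborel. g (x + c, t)) = (LINT x|lborel. g (x, t))"
      using integral_distr[of "(+) c" lborel borel "\<lambda>x. g (x, t)"] meas
      by (simp add: lborel_distr_plus add.commute)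
  qed
  have q0: "(LINT x|lborel. q k x) = 0" for k
    unfolding q_def integral_divide_zero Bochner_Integration.integral_diff[OF shift(1) gint] shift(2)
    by simp
  have "(\<lambda>k. LINT x|lborel. q k x) \<longlonglongrightarrow> (LINT x|lborel. dx j g (x, t))"
  proof (rule integral_dominated_convergence)
    show "(\<lambda>x. dx j g (x, t)) \<in> borel_measurable lborel" using int by (rule borel_measurable_integrable)
    show "q k \<in> borel_measurable lborel" for k
    proof -
      have "(\<lambda>x. g (x + h k *\<^sub>R ?e, t)) \<in> borel_measurable lborel" "(\<lambda>x. g (x, t)) \<in> borel_measurable lborel"
        by (rule borel_measurable_integrable, rule shift gint)+
      then show ?thesis
        unfolding q_def[abs_def] by (intro borel_measurable_divide borel_measurable_diff borel_measurable_const)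
    qed
    show "integrable lborel (\<lambda>x. indicator (cball 0 (R + 1) :: (real^'n) set) x *\<^sub>R C)"
      by (rule borel_integrable_compact) auto
    show "AE x in lborel. (\<lambda>k. q k x) \<longlonglongrightarrow> dx j g (x, t)"
    proof (rule AE_I2)
      fix x
      have "((\<lambda>s. (g (x + s *\<^sub>R ?e, t) - g (x, t)) / s) \<longlongrightarrow> dx j g (x, t)) (at 0)"
        using line[of x 0] by (simp add: DERIV_def)
      moreover have "filterlim h (at 0) sequentially"
        unfolding filterlim_at
      proof
        show "\<forall>\<^sub>F k in sequentially. h k \<in> UNIV \<and> h k \<noteq> 0"
          by (rule always_eventually) (simp add: h_def)
        show "h \<longlonglongrightarrow> 0"
          unfolding h_def[abs_def] by (rule LIMSEQ_Suc[OF lim_1_over_n])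
      qed
      ultimately show "(\<lambda>k. q k x) \<longlonglongrightarrow> dx j g (x, t)"
        unfolding q_def by (rule filterlim_compose)
    qed
    show "AE x in lborel. norm (q k x) \<le> indicator (cball 0 (R + 1) :: (real^'n) set) x *\<^sub>R C" for k
    proof (rule AE_I2)
      fix x
      show "norm (q k x) \<le> indicator (cball 0 (R + 1) :: (real^'n) set) x *\<^sub>R C"
      proof (cases "x \<in> cball 0 (R + 1)")
        case True
        have "\<exists>z>0. z < h k \<and> g (x + h k *\<^sub>R ?e, t) - g (x + 0 *\<^sub>R ?e, t) = (h k - 0) * dx j g (x + z *\<^sub>R ?e, t)"
          by (rule MVT2[OF h(1)]) (rule line)
        then obtain z where "g (x + h k *\<^sub>R ?e, t) - g (x + 0 *\<^sub>R ?e, t) = (h k - 0) * dx j g (x + z *\<^sub>R ?e, t)"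
          by blast
        then have "q k x = dx j g (x + z *\<^sub>R ?e, t)" using h(1)[of k] by (simp add: q_def)
        then show ?thesis using True bound by simp
      next
        case False
        then have x: "norm x > R + 1" by simp
        have "R < norm (x + c *\<^sub>R ?e)" if "0 \<le> c" "c \<le> 1" for c
        proof -
          have "norm x \<le> norm (x + c *\<^sub>R ?e) + norm (c *\<^sub>R ?e)"
            using norm_triangle_ineq4[of "x + c *\<^sub>R ?e" "c *\<^sub>R ?e"] by simp
          also have "norm (c *\<^sub>R ?e) \<le> 1" using that by (simp add: norm_axis_1)
          finally show ?thesis using x by simp
        qed
        then have "R < norm (x + c *\<^sub>R ?e, t)" if "0 \<le> c" "c \<le> 1" for c
          using norm_fst_le[of "x + c *\<^sub>R ?e" t] that by (meson less_le_trans)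
        then have "(x + c *\<^sub>R ?e, t) \<notin> S" if "0 \<le> c" "c \<le> 1" for c
          using R[of "(x + c *\<^sub>R ?e, t)"] that by (meson not_less)
        from this[of 0] this[of "h k"] h[of k] have "q k x = 0"
          using S(2) by (simp add: q_def vanishes_outside_def less_imp_le)
        then show ?thesis using False by simp
      qed
    qed
  qed
  then show "(LINT x|lborel. dx j g (x, t)) = 0"
    unfolding q0 by (rule LIMSEQ_unique[OF _ tendsto_const])
qed

lemma vanishes_outside_lap [simp]:
  "closed S \<Longrightarrow> vanishes_outside S f \<Longrightarrow> vanishes_outside S (lap f)"
  by (simp add: lap_def)

lemma slice_mean_zero_lap:
  assumes "smooth f" "compact S" "vanishes_outside S f"
  shows "slice_mean_zero (lap f)"
  unfolding lap_def using assms
  by (intro slice_mean_zero_sum slice_mean_zero_dx[OF _ assms(2)]) (auto simp: compact_imp_closed)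

lemma vanishes_outside_wave:
  assumes "closed S" "vanishes_outside S \<phi>"
  shows "vanishes_outside S (divfree_potential a \<phi> i)" "vanishes_outside S (residual_flux B a A \<phi> i)"
    "vanishes_outside S (wave_velocity a \<phi> i)" "vanishes_outside S (wave_stress B a A \<phi> i j)"
proof -
  show m: "vanishes_outside S (divfree_potential a \<phi> i)" for i
    using assms by (simp add: divfree_potential_def)
  show u: "vanishes_outside S (residual_flux B a A \<phi> i)" for i
    using assms m by (simp add: residual_flux_def)
  show "vanishes_outside S (wave_velocity a \<phi> i)"
    using assms m by (simp add: wave_velocity_def)
  have "vanishes_outside S (vdiv (residual_flux B a A \<phi>))"
    using assms u by (simp add: vdiv_def)
  then show "vanishes_outside S (wave_stress B a A \<phi> i j)"
    using assms u by (simp add: wave_stress_def bilap_inverse_div_def)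
qed

text \<open>Every term contains a space derivative as its outermost operator, since the time derivative occurs
  only inside \<open>bilap_inverse_div\<close>.\<close>

lemma slice_mean_zero_wave:
  assumes \<phi>: "smooth \<phi>" and S: "compact S" "vanishes_outside S \<phi>"
  shows "slice_mean_zero (wave_velocity a \<phi> i)" "slice_mean_zero (wave_stress B a A \<phi> i j)"
proof -
  have cl: "closed S" using S by (simp add: compact_imp_closed)
  note van = vanishes_outside_wave[OF cl S(2)]
  have d: "vanishes_outside S (vdiv (residual_flux B a A \<phi>))"
    using cl van by (simp add: vdiv_def)
  show "slice_mean_zero (wave_velocity a \<phi> i)"
    unfolding wave_velocity_def using \<phi> van cl by (intro slice_mean_zero_lap[OF _ S(1)]) auto
  have "slice_mean_zero (lap (lap (lap \<phi>)))"
    using \<phi> S(2) cl by (intro slice_mean_zero_lap[OF _ S(1)]) auto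
  moreover have "slice_mean_zero (lap (dx j (residual_flux B a A \<phi> i)))" for i j
    using \<phi> van cl by (intro slice_mean_zero_lap[OF _ S(1)]) auto
  moreover have "slice_mean_zero (dx i (dx j (vdiv (residual_flux B a A \<phi>))))"
    using \<phi> d cl by (intro slice_mean_zero_dx[OF _ S(1)]) auto
  moreover have "slice_mean_zero (lap (vdiv (residual_flux B a A \<phi>)))"
    using \<phi> d cl by (intro slice_mean_zero_lap[OF _ S(1)]) auto
  ultimately show "slice_mean_zero (wave_stress B a A \<phi> i j)"
    unfolding wave_stress_def bilap_inverse_div_def by simp
qed

definition wave_field ::
    "real^'n^'n \<Rightarrow> (real^'n) \<times> (real^'n^'n) \<Rightarrow> ((real^'n) \<times> real \<Rightarrow> real) \<Rightarrow>
     (real^'n) \<times> real \<Rightarrow> (real^'n) \<times> (real^'n^'n)" where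
  "wave_field B z \<phi> p = ((\<chi> i. wave_velocity (fst z) \<phi> i p), (\<chi> i j. wave_stress B (fst z) (snd z) \<phi> i j p))"

lemma wave_field_components:
  fixes B :: "real^'n^'n"
  assumes "b \<in> Basis"
  shows "(\<exists>i. (\<lambda>p. wave_field B z \<phi> p \<bullet> b) = wave_velocity (fst z) \<phi> i) \<or>
    (\<exists>i j. (\<lambda>p. wave_field B z \<phi> p \<bullet> b) = wave_stress B (fst z) (snd z) \<phi> i j)"
  using assms
proof (cases rule: state_Basis_cases)
  case (1 i)
  then show ?thesis by (auto simp: wave_field_def)
next
  case (2 i j)
  then show ?thesis by (auto simp: wave_field_def)
qed

lemma wave_field_smooth:
  assumes "smooth \<phi>"
  shows "smooth (wave_field B z \<phi>)"
proof (rule smooth_componentwise)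
  fix b :: "(real^'a) \<times> (real^'a^'a)" assume "b \<in> Basis"
  from wave_field_components[OF this, of B z \<phi>] assms
  show "smooth (\<lambda>p. wave_field B z \<phi> p \<bullet> b)" by auto
qed

lemma wave_field_support:
  assumes "closed S" "vanishes_outside S \<phi>" "p \<notin> S"
  shows "wave_field B z \<phi> p = 0"
proof -
  have "wave_velocity a \<phi> i p = 0" "wave_stress B a A \<phi> i j p = 0" for a A i j
    using vanishes_outside_wave(3,4)[OF assms(1,2)] assms(3) unfolding vanishes_outside_def by blast+
  then show ?thesis by (simp add: wave_field_def vec_eq_iff zero_prod_def)
qed

lemma wave_field_state_space:
  fixes z :: "(real^'n) \<times> (real^'n^'n)"
  assumes \<phi>: "smooth \<phi>" and z: "z \<in> state_space" and n: "CARD('n) \<ge> 2"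
  shows "wave_field B z \<phi> p \<in> state_space"
proof -
  let ?A = "snd z" and ?V = "wave_stress B (fst z) (snd z) \<phi>"
  have A: "transpose ?A = ?A" "trace ?A = 0"
    using z by (auto simp: state_space_def sym_tracefree_def)
  have Aij: "?A $ i $ j = ?A $ j $ i" for i j
    using arg_cong[OF A(1), of "\<lambda>M. M $ i $ j"] by (simp add: transpose_def)
  have "?V i j = ?V j i" for i j
    using bilap_inverse_div_sym[of "residual_flux B (fst z) ?A \<phi>" i j] \<phi>
    by (simp add: wave_stress_def Aij[of i j])
  moreover have "(\<Sum>i\<in>UNIV. ?V i i p) = 0"
  proof -
    have "(\<Sum>i\<in>UNIV. ?A $ i $ i) = 0" using A(2) by (simp add: trace_def)
    then show ?thesis
      using bilap_inverse_div_trace[of "residual_flux B (fst z) ?A \<phi>" p] \<phi> n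
      by (simp add: wave_stress_def sum.distrib flip: sum_distrib_right)
  qed
  ultimately show ?thesis
    by (simp add: wave_field_def state_space_def sym_tracefree_def transpose_def trace_def vec_eq_iff)
qed

lemma has_bochner_integral_zero_componentwise:
  fixes F :: "'a \<Rightarrow> 'b::euclidean_space"
  assumes "\<And>b. b \<in> Basis \<Longrightarrow> has_bochner_integral M (\<lambda>x. F x \<bullet> b) 0"
  shows "has_bochner_integral M F 0"
proof -
  have "has_bochner_integral M (\<lambda>x. \<Sum>b\<in>Basis. (F x \<bullet> b) *\<^sub>R b) (\<Sum>b\<in>(Basis::'b set). 0 *\<^sub>R b)"
    by (intro has_bochner_integral_sum has_bochner_integral_scaleR_left assms)
  then show ?thesis by (simp only: euclidean_representation scaleR_zero_left sum.neutral_const)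
qed

lemma wave_field_slices:
  assumes \<phi>: "smooth \<phi>" and S: "compact S" "vanishes_outside S \<phi>"
  shows "has_bochner_integral lborel (\<lambda>x. wave_field B z \<phi> (x, t)) 0"
proof (rule has_bochner_integral_zero_componentwise)
  fix b :: "(real^'a) \<times> (real^'a^'a)" assume "b \<in> Basis"
  from wave_field_components[OF this, of B z \<phi>] slice_mean_zero_wave[OF \<phi> S]
  have "slice_mean_zero (\<lambda>p. wave_field B z \<phi> p \<bullet> b)" by auto
  then show "has_bochner_integral lborel (\<lambda>x. wave_field B z \<phi> (x, t) \<bullet> b) 0"
    by (simp add: slice_mean_zero_def has_bochner_integral_iff)
qed

lemma wave_field_solves:
  fixes z :: "(real^'n) \<times> (real^'n^'n)"
  assumes \<phi>: "smooth \<phi>"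
  shows "lin_op B (wave_field B z \<phi>) p = 0"
proof -
  let ?v = "wave_velocity (fst z) \<phi>" and ?V = "wave_stress B (fst z) (snd z) \<phi>"
  have v: "fst \<circ> wave_field B z \<phi> = (\<lambda>p. \<chi> i. ?v i p)" and V: "snd \<circ> wave_field B z \<phi> = (\<lambda>p. \<chi> i j. ?V i j p)"
    by (simp_all add: fun_eq_iff wave_field_def)
  have "div_vec (\<lambda>p. \<chi> i. ?v i p) p = vdiv ?v p"
    using \<phi> by (simp add: div_vec_def vdiv_def space_partial_eq_dx)
  then have 1: "div_vec (fst \<circ> wave_field B z \<phi>) p = 0"
    using vdiv_wave_velocity[OF \<phi>, of "fst z"] by (simp add: v)
  have "div_mat (\<lambda>p. \<chi> i j. ?V i j p) p = (\<chi> i. vdiv (?V i) p)"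
    using \<phi> by (simp add: div_mat_def vdiv_def space_partial_eq_dx)
  then have "time_derivative (fst \<circ> wave_field B z \<phi>) p + div_mat (snd \<circ> wave_field B z \<phi>) p
      = (\<chi> i. dt (?v i) p + vdiv (?V i) p)"
    using \<phi> unfolding v V by (simp add: time_derivative_eq_dt vec_eq_iff)
  also have "\<dots> = B *v fst (wave_field B z \<phi> p)"
    by (simp add: wave_balance[OF \<phi>] wave_field_def matrix_vector_mult_def vec_eq_iff)
  finally show ?thesis using 1 by (simp add: lin_op_def zero_prod_def)
qed

section \<open>High-frequency expansion\<close>

text \<open>The data of a localized wave: the direction, a profile \<open>G 0\<close> with its successive derivatives, and a
  cutoff. The power \<open>N\<close> is the order of the operator to be applied, by which the amplitude is
  normalised.\<close>

locale plane_wave =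
  fixes \<xi> :: "real^'n" and \<tau> :: real and G :: "nat \<Rightarrow> real \<Rightarrow> real"
    and \<eta> :: "(real^'n) \<times> real \<Rightarrow> real" and S :: "((real^'n) \<times> real) set" and N :: nat
  assumes G: "\<And>j x. (G j has_real_derivative G (Suc j) x) (at x)"
    and cutoff_smooth: "smooth \<eta>" and cutoff_support: "vanishes_outside S \<eta>" and S: "compact S"
begin

definition ripple :: "nat \<Rightarrow> real \<Rightarrow> (real^'n) \<times> real \<Rightarrow> real" where
  "ripple j r p = G j (r * ((\<xi>, \<tau>) \<bullet> p))"

text \<open>\<open>F r\<close> is a combination of the derivatives of the profile at frequency \<open>r\<close>, with powers of \<open>r\<close> up to
  \<open>k\<close> and smooth amplitudes that do not depend on \<open>r\<close>, and the amplitude of the top power is \<open>s\<close> times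
  the cutoff. Applying a differential operator of order \<open>k\<close> to the wave gives such a family, with \<open>s\<close>
  the value of its symbol of order \<open>k\<close> at \<open>(\<xi>, \<tau>)\<close>.\<close>

definition expands ::
    "(nat \<Rightarrow> (real^'n) \<times> real \<Rightarrow> real) \<Rightarrow> nat \<Rightarrow> real \<Rightarrow> (real \<Rightarrow> (real^'n) \<times> real \<Rightarrow> real) \<Rightarrow> bool" where
  "expands a k s F \<longleftrightarrow> (\<forall>j. smooth (a j) \<and> vanishes_outside S (a j)) \<and> a k = (\<lambda>p. s * \<eta> p) \<and>
     (\<forall>r. F r = (\<lambda>p. \<Sum>j\<le>k. r ^ j / r ^ N * (a j p * ripple j r p)))"

definition osc :: "nat \<Rightarrow> real \<Rightarrow> (real \<Rightarrow> (real^'n) \<times> real \<Rightarrow> real) \<Rightarrow> bool" where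
  "osc k s F \<longleftrightarrow> (\<exists>a. expands a k s F)"

lemma smooth_ripple: "smooth (ripple j r)"
proof -
  have "smooth (\<lambda>p. (\<xi>, \<tau>) \<bullet> p)" by (rule smooth_linear) (rule bounded_linear_inner_right)
  then have "smooth (\<lambda>p. r * ((\<xi>, \<tau>) \<bullet> p))" by simp
  from smooth_compose[OF smooth_derivative_sequence[of G j, OF G] this]
  show ?thesis by (simp add: ripple_def[abs_def])
qed

lemma dir_deriv_ripple: "dir_deriv v (ripple j r) = (\<lambda>p. r * ((\<xi>, \<tau>) \<bullet> v) * ripple (Suc j) r p)"
proof
  fix p
  have "((\<lambda>p. r * ((\<xi>, \<tau>) \<bullet> p)) has_derivative (\<lambda>v. r * ((\<xi>, \<tau>) \<bullet> v))) (at p)"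
    by (intro bounded_linear_imp_has_derivative bounded_linear_const_mult bounded_linear_inner_right)
  from has_derivative_compose[OF this, of "G j"] G[of j "r * ((\<xi>, \<tau>) \<bullet> p)"]
  have "(ripple j r has_derivative (\<lambda>v. ripple (Suc j) r p * (r * ((\<xi>, \<tau>) \<bullet> v)))) (at p)"
    by (simp add: ripple_def[abs_def] has_field_derivative_def)
  from dir_deriv_eqI[OF this] show "dir_deriv v (ripple j r) p = r * ((\<xi>, \<tau>) \<bullet> v) * ripple (Suc j) r p"
    by (simp add: mult.commute)
qed

lemma osc_I:
  assumes "\<And>j. smooth (a j)" "\<And>j. vanishes_outside S (a j)" "a k = (\<lambda>p. s * \<eta> p)"
    "\<And>r. F r = (\<lambda>p. \<Sum>j\<le>k. r ^ j / r ^ N * (a j p * ripple j r p))"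
  shows "osc k s F"
  unfolding osc_def expands_def using assms by (intro exI[of _ a]) simp

lemma expands_D:
  assumes "expands a k s F"
  shows "smooth (a j)" "vanishes_outside S (a j)" "a k = (\<lambda>p. s * \<eta> p)"
    "F r = (\<lambda>p. \<Sum>j\<le>k. r ^ j / r ^ N * (a j p * ripple j r p))"
  using assms by (simp_all add: expands_def)

lemma osc_wave: "osc 0 1 (\<lambda>r p. \<eta> p * ripple 0 r p / r ^ N)"
  by (rule osc_I[of "\<lambda>_. \<eta>"]) (simp_all add: cutoff_smooth cutoff_support)

lemma osc_add:
  assumes "osc k s F" "osc k s' F'"
  shows "osc k (s + s') (\<lambda>r p. F r p + F' r p)"
proof -
  obtain a where "expands a k s F" using assms(1) unfolding osc_def ..
  note a = expands_D[OF this]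
  obtain a' where "expands a' k s' F'" using assms(2) unfolding osc_def ..
  note a' = expands_D[OF this]
  show ?thesis
    by (rule osc_I[of "\<lambda>j p. a j p + a' j p"])
       (simp_all add: a a' distrib_left distrib_right sum.distrib)
qed

lemma osc_cmult:
  assumes "osc k s F"
  shows "osc k (c * s) (\<lambda>r p. c * F r p)"
proof -
  obtain a where "expands a k s F" using assms(1) unfolding osc_def ..
  note a = expands_D[OF this]
  show ?thesis
    by (rule osc_I[of "\<lambda>j p. c * a j p"]) (simp_all add: a sum_distrib_left mult_ac)
qed

lemma osc_diff:
  assumes "osc k s F" "osc k s' F'"
  shows "osc k (s - s') (\<lambda>r p. F r p - F' r p)"
  using osc_add[OF assms(1) osc_cmult[OF assms(2), of "-1"]] by simp

lemma osc_zero: "osc k 0 (\<lambda>r p. 0)"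
  by (rule osc_I[of "\<lambda>j p. 0"]) (simp_all add: vanishes_outside_def)

lemma osc_sum:
  "(\<And>i. i \<in> I \<Longrightarrow> osc k (s i) (F i)) \<Longrightarrow> osc k (\<Sum>i\<in>I. s i) (\<lambda>r p. \<Sum>i\<in>I. F i r p)"
proof (induction I rule: infinite_finite_induct)
  case (insert i I)
  then have "osc k (s i + (\<Sum>i\<in>I. s i)) (\<lambda>r p. F i r p + (\<Sum>i\<in>I. F i r p))"
    by (intro osc_add) auto
  with insert.hyps show ?case by simp
qed (simp_all add: osc_zero)

text \<open>A term of lower order does not contribute to the symbol.\<close>

lemma osc_weaken:
  assumes "osc k s F"
  shows "osc (Suc k) 0 F"
proof -
  obtain a where "expands a k s F" using assms(1) unfolding osc_def ..
  note a = expands_D[OF this]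
  show ?thesis
  proof (rule osc_I[of "\<lambda>j. if j \<le> k then a j else (\<lambda>p. 0)"])
    show "F r = (\<lambda>p. \<Sum>j\<le>Suc k. r ^ j / r ^ N * ((if j \<le> k then a j else (\<lambda>p. 0)) p * ripple j r p))" for r
      unfolding a(4) by simp
  qed (simp_all add: a vanishes_outside_def[of S "\<lambda>p. 0"])
qed

text \<open>A derivative falls either on the amplitude, keeping the power of \<open>r\<close>, or on the profile, which
  raises the power by one and produces the factor \<open>(\<xi>, \<tau>) \<bullet> v\<close>.\<close>

lemma osc_dir_deriv:
  assumes "osc k s F"
  shows "osc (Suc k) (((\<xi>, \<tau>) \<bullet> v) * s) (\<lambda>r. dir_deriv v (F r))"
proof -
  let ?z = "(\<xi>, \<tau>) \<bullet> v"
  obtain a where "expands a k s F" using assms(1) unfolding osc_def ..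
  note a = expands_D[OF this]
  have cl: "closed S" using S by (rule compact_imp_closed)
  define b where "b j = (if j \<le> k then dir_deriv v (a j) else (\<lambda>p. 0))" for j
  define c where "c j = (case j of 0 \<Rightarrow> (\<lambda>p. 0) | Suc i \<Rightarrow> (\<lambda>p. ?z * a i p))" for j
  have b: "smooth (b j)" "vanishes_outside S (b j)" for j
    using a cl by (simp_all add: b_def vanishes_outside_def[of S "\<lambda>p. 0"])
  have c: "smooth (c j)" "vanishes_outside S (c j)" for j
    using a cl by (cases j; simp add: c_def vanishes_outside_def[of S "\<lambda>p. 0"])+
  show ?thesis
  proof (rule osc_I[of "\<lambda>j p. b j p + c j p"])
    show "(\<lambda>p. b (Suc k) p + c (Suc k) p) = (\<lambda>p. ?z * s * \<eta> p)"
      by (simp add: b_def c_def a(3) mult.assoc)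
    fix r
    have "dir_deriv v (F r) = (\<lambda>p. \<Sum>j\<le>k. r ^ j / r ^ N * (b j p * ripple j r p)
        + r ^ Suc j / r ^ N * (c (Suc j) p * ripple (Suc j) r p))"
    proof -
      have "dir_deriv v (F r) = (\<lambda>p. \<Sum>j\<le>k. r ^ j / r ^ N *
          (a j p * (r * ?z * ripple (Suc j) r p) + dir_deriv v (a j) p * ripple j r p))"
        unfolding a(4)
        by (simp only: dir_deriv_sum dir_deriv_cmult dir_deriv_mult dir_deriv_ripple
            smooth_mult smooth_const smooth_ripple a(1))
      also have "\<dots> = (\<lambda>p. \<Sum>j\<le>k. r ^ j / r ^ N * (b j p * ripple j r p)
        + r ^ Suc j / r ^ N * (c (Suc j) p * ripple (Suc j) r p))"
        by (intro ext sum.cong refl) (simp add: b_def c_def algebra_simps)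
      finally show ?thesis .
    qed
    also have "\<dots> = (\<lambda>p. \<Sum>j\<le>Suc k. r ^ j / r ^ N * ((b j p + c j p) * ripple j r p))"
    proof
      fix p
      have "(\<Sum>j\<le>Suc k. r ^ j / r ^ N * (b j p * ripple j r p)) = (\<Sum>j\<le>k. r ^ j / r ^ N * (b j p * ripple j r p))"
        by (simp add: b_def)
      moreover have "(\<Sum>j\<le>Suc k. r ^ j / r ^ N * (c j p * ripple j r p))
          = (\<Sum>j\<le>k. r ^ Suc j / r ^ N * (c (Suc j) p * ripple (Suc j) r p))"
        unfolding sum.atMost_Suc_shift by (simp add: c_def)
      ultimately show "(\<Sum>j\<le>k. r ^ j / r ^ N * (b j p * ripple j r p)
          + r ^ Suc j / r ^ N * (c (Suc j) p * ripple (Suc j) r p))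
        = (\<Sum>j\<le>Suc k. r ^ j / r ^ N * ((b j p + c j p) * ripple j r p))"
        by (simp only: distrib_left distrib_right sum.distrib)
    qed
    finally show "dir_deriv v (F r) = (\<lambda>p. \<Sum>j\<le>Suc k. r ^ j / r ^ N * ((b j p + c j p) * ripple j r p))" .
  qed (simp_all add: b c)
qed

text \<open>After the normalisation by \<open>r ^ N\<close> all terms but the top one carry a negative power of \<open>r\<close>; compact
  support bounds their amplitudes.\<close>

lemma osc_leading_term:
  assumes "osc N s F" "N > 0" and G_bounded: "\<And>j. j < N \<Longrightarrow> \<exists>C. \<forall>x. \<bar>G j x\<bar> \<le> C"
  obtains C where "0 \<le> C" "\<And>r p. r \<ge> 1 \<Longrightarrow> \<bar>F r p - s * \<eta> p * ripple N r p\<bar> \<le> C / r"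
proof -
  obtain M where M: "N = Suc M" using \<open>N > 0\<close> by (cases N) auto
  obtain a where "expands a N s F" using assms(1) unfolding osc_def ..
  note a = expands_D[OF this]
  have "\<exists>C\<ge>0. \<forall>r p. \<bar>a j p * ripple j r p\<bar> \<le> C" if "j < N" for j
  proof -
    obtain A where A: "\<And>p. \<bar>a j p\<bar> \<le> A" "0 \<le> A"
      by (rule smooth_vanishes_outside_bounded[OF a(1) S a(2)]) (rule that)
    obtain C where C: "\<And>x. \<bar>G j x\<bar> \<le> C" using G_bounded[OF \<open>j < N\<close>] by blast
    have "\<bar>a j p * ripple j r p\<bar> \<le> A * C" for r p
      unfolding abs_mult ripple_def using A C by (intro mult_mono) auto
    moreover have "0 \<le> C" using C[of 0] by linarith
    ultimately show ?thesis using A(2) by (intro exI[of _ "A * C"]) simp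
  qed
  then have "\<forall>j\<in>{..<N}. \<exists>C\<ge>0. \<forall>r p. \<bar>a j p * ripple j r p\<bar> \<le> C" by simp
  then obtain C where C: "\<forall>j\<in>{..<N}. C j \<ge> 0 \<and> (\<forall>r p. \<bar>a j p * ripple j r p\<bar> \<le> C j)"
    unfolding bchoice_iff by blast
  show ?thesis
  proof (rule that)
    show "0 \<le> (\<Sum>j<N. C j)" using C by (intro sum_nonneg) simp
    fix r :: real and p assume r: "r \<ge> 1"
    have "F r p = (\<Sum>j<N. r ^ j / r ^ N * (a j p * ripple j r p)) + s * \<eta> p * ripple N r p"
      using r unfolding a(4) by (simp add: M lessThan_Suc_atMost a(3)[unfolded M])
    then have "\<bar>F r p - s * \<eta> p * ripple N r p\<bar> = \<bar>\<Sum>j<N. r ^ j / r ^ N * (a j p * ripple j r p)\<bar>"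
      by simp
    also have "\<dots> \<le> (\<Sum>j<N. \<bar>r ^ j / r ^ N * (a j p * ripple j r p)\<bar>)"
      by (rule sum_abs)
    also have "\<dots> \<le> (\<Sum>j<N. C j / r)"
    proof (rule sum_mono)
      fix j assume j: "j \<in> {..<N}"
      then have jM: "j \<le> M" by (simp add: M)
      have "r ^ j \<le> r ^ M" using r jM by (intro power_increasing) auto
      then have "r ^ j / r ^ N \<le> 1 / r" using r by (simp add: M field_simps)
      moreover have "\<bar>a j p * ripple j r p\<bar> \<le> C j" using C j by blast
      ultimately have "\<bar>r ^ j / r ^ N\<bar> * \<bar>a j p * ripple j r p\<bar> \<le> 1 / r * C j"
        using r by (intro mult_mono) auto
      then show "\<bar>r ^ j / r ^ N * (a j p * ripple j r p)\<bar> \<le> C j / r"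
        by (simp add: abs_mult)
    qed
    also have "\<dots> = (\<Sum>j<N. C j) / r" by (simp add: sum_divide_distrib)
    finally show "\<bar>F r p - s * \<eta> p * ripple N r p\<bar> \<le> (\<Sum>j<N. C j) / r" .
  qed
qed

definition wave :: "real \<Rightarrow> (real^'n) \<times> real \<Rightarrow> real" where
  "wave r p = \<eta> p * ripple 0 r p / r ^ N"

lemma osc_dx: "osc k s F \<Longrightarrow> osc (Suc k) (\<xi> $ j * s) (\<lambda>r. dx j (F r))"
  using osc_dir_deriv[of k s F "(axis j 1, 0)"] by (simp add: inner_axis)

lemma osc_dt: "osc k s F \<Longrightarrow> osc (Suc k) (\<tau> * s) (\<lambda>r. dt (F r))"
  using osc_dir_deriv[of k s F "(0, 1)"] by simp

lemma osc_lap: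
  assumes "norm \<xi> = 1" "osc k s F"
  shows "osc (Suc (Suc k)) s (\<lambda>r. lap (F r))"
proof -
  have "osc (Suc (Suc k)) (\<Sum>j\<in>UNIV. \<xi> $ j * (\<xi> $ j * s)) (\<lambda>r p. \<Sum>j\<in>UNIV. dx j (dx j (F r)) p)"
    by (intro osc_sum osc_dx assms(2))
  moreover have "(\<Sum>j\<in>UNIV. \<xi> $ j * (\<xi> $ j * s)) = (\<xi> \<bullet> \<xi>) * s"
    by (simp add: inner_vec_def sum_distrib_right mult.assoc)
  moreover have "\<xi> \<bullet> \<xi> = 1" using assms(1) by (simp add: dot_square_norm)
  ultimately show ?thesis by (simp add: lap_def[abs_def])
qed

lemma osc_divfree_potential:
  assumes "norm \<xi> = 1" "a \<bullet> \<xi> = 0"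
  shows "osc 2 (a $ i) (\<lambda>r. divfree_potential a (wave r) i)"
proof -
  have w: "osc 0 1 wave" using osc_wave by (simp add: wave_def[abs_def])
  have "osc (Suc (Suc 0)) (a $ i * 1 - \<xi> $ i * (\<Sum>j\<in>UNIV. a $ j * (\<xi> $ j * 1)))
     (\<lambda>r p. a $ i * lap (wave r) p - dx i (\<lambda>p. \<Sum>j\<in>UNIV. a $ j * dx j (wave r) p) p)"
    by (intro osc_diff osc_cmult osc_lap osc_dx osc_sum w assms(1))
  moreover have "(\<Sum>j\<in>UNIV. a $ j * (\<xi> $ j * 1)) = 0" using assms(2) by (simp add: inner_vec_def)
  ultimately show ?thesis by (simp add: divfree_potential_def[abs_def] numeral_2_eq_2)
qed

lemma osc_wave_velocity:
  assumes "norm \<xi> = 1" "a \<bullet> \<xi> = 0"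
  shows "osc 6 (a $ i) (\<lambda>r. wave_velocity a (wave r) i)"
  using osc_lap[OF assms(1) osc_lap[OF assms(1) osc_divfree_potential[OF assms, of i]]]
  by (simp add: wave_velocity_def eval_nat_numeral)

text \<open>The symbol is \<open>- \<tau> a - A \<xi>\<close>, which is zero by the cone condition. The matrix \<open>B\<close> multiplies a term
  of order two only.\<close>

lemma osc_residual_flux:
  assumes "norm \<xi> = 1" "a \<bullet> \<xi> = 0" "A *v \<xi> = - \<tau> *\<^sub>R a"
  shows "osc 3 0 (\<lambda>r. residual_flux B a A (wave r) i)"
proof -
  have w: "osc 0 1 wave" using osc_wave by (simp add: wave_def[abs_def])
  have m: "osc (Suc (Suc 0)) (a $ j) (\<lambda>r. divfree_potential a (wave r) j)" for j
    using osc_divfree_potential[OF assms(1,2), of j] by (simp add: numeral_2_eq_2)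
  have "osc (Suc (Suc (Suc 0))) ((\<Sum>j\<in>UNIV. B $ i $ j * 0) - \<tau> * a $ i - (\<Sum>j\<in>UNIV. A $ i $ j * (\<xi> $ j * 1)))
     (\<lambda>r p. (\<Sum>j\<in>UNIV. B $ i $ j * divfree_potential a (wave r) j p)
       - dt (divfree_potential a (wave r) i) p - lap (\<lambda>p. \<Sum>j\<in>UNIV. A $ i $ j * dx j (wave r) p) p)"
    by (intro osc_diff osc_sum osc_cmult osc_dt osc_lap[OF assms(1)] osc_dx w m osc_weaken[OF m])
  moreover have "(\<Sum>j\<in>UNIV. A $ i $ j * (\<xi> $ j * 1)) = - \<tau> * a $ i"
    using arg_cong[OF assms(3), of "\<lambda>v. v $ i"] by (simp add: matrix_vector_mult_def)
  ultimately show ?thesis by (simp add: residual_flux_def[abs_def] eval_nat_numeral)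
qed

lemma osc_wave_stress:
  assumes "norm \<xi> = 1" "a \<bullet> \<xi> = 0" "A *v \<xi> = - \<tau> *\<^sub>R a"
  shows "osc 6 (A $ i $ j) (\<lambda>r. wave_stress B a A (wave r) i j)"
proof -
  let ?u = "\<lambda>r. residual_flux B a A (wave r)" and ?c = "trace_coeff TYPE('n)"
  have w: "osc 0 1 wave" using osc_wave by (simp add: wave_def[abs_def])
  have u: "osc (Suc (Suc (Suc 0))) 0 (\<lambda>r. ?u r i)" for i
    using osc_residual_flux[OF assms] by (simp add: eval_nat_numeral)
  have d: "osc (Suc (Suc (Suc (Suc 0)))) (\<Sum>j\<in>UNIV. \<xi> $ j * 0) (\<lambda>r. vdiv (?u r))"
    unfolding vdiv_def by (intro osc_sum osc_dx u)
  note L = osc_lap[OF assms(1)]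
  have "osc (Suc (Suc (Suc (Suc (Suc (Suc 0))))))
     (A $ i $ j * 1 + (\<xi> $ j * 0 + \<xi> $ i * 0 - (1 + ?c) * (\<xi> $ i * (\<xi> $ j * (\<Sum>j\<in>UNIV. \<xi> $ j * 0)))
       + (if i = j then ?c else 0) * (\<Sum>j\<in>UNIV. \<xi> $ j * 0)))
     (\<lambda>r p. A $ i $ j * lap (lap (lap (wave r))) p + (lap (dx j (?u r i)) p + lap (dx i (?u r j)) p
       - (1 + ?c) * dx i (dx j (vdiv (?u r))) p + (if i = j then ?c else 0) * lap (vdiv (?u r)) p))"
    by (intro osc_add osc_diff osc_cmult L osc_dx u d w)
  then show ?thesis by (simp add: wave_stress_def[abs_def] bilap_inverse_div_def eval_nat_numeral)
qed

lemma smooth_wave: "smooth (wave r)" and wave_support: "vanishes_outside S (wave r)"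
proof -
  show "smooth (wave r)"
    using cutoff_smooth smooth_ripple[of 0 r] by (simp add: wave_def[abs_def])
  show "vanishes_outside S (wave r)"
    using cutoff_support by (simp add: wave_def vanishes_outside_def)
qed

text \<open>The symbol of order six of the velocity is \<open>a\<close>. That of the stress is \<open>A\<close>, because the residual flux
  has no symbol of order three.\<close>

lemma wave_field_leading_term:
  fixes z :: "(real^'n) \<times> (real^'n^'n)"
  assumes "norm \<xi> = 1" "fst z \<bullet> \<xi> = 0" "snd z *v \<xi> = - \<tau> *\<^sub>R fst z" and N: "N = 6"
    and G_bounded: "\<And>j. j < N \<Longrightarrow> \<exists>C. \<forall>x. \<bar>G j x\<bar> \<le> C"
  obtains C where "0 \<le> C"
    "\<And>r p. r \<ge> 1 \<Longrightarrow> norm (wave_field B z (wave r) p - (\<eta> p * ripple 6 r p) *\<^sub>R z) \<le> C / r"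
proof -
  have "\<exists>C\<ge>0. \<forall>r\<ge>1. \<forall>p. \<bar>(wave_field B z (wave r) p - (\<eta> p * ripple 6 r p) *\<^sub>R z) \<bullet> b\<bar> \<le> C / r"
    if b: "b \<in> Basis" for b
  proof -
    have "osc 6 (z \<bullet> b) (\<lambda>r p. wave_field B z (wave r) p \<bullet> b)"
      using b
    proof (cases rule: state_Basis_cases)
      case (1 i)
      then show ?thesis using osc_wave_velocity[OF assms(1,2)] by (simp add: wave_field_def)
    next
      case (2 i j)
      then show ?thesis using osc_wave_stress[OF assms(1-3)] by (simp add: wave_field_def)
    qed
    then have "osc N (z \<bullet> b) (\<lambda>r p. wave_field B z (wave r) p \<bullet> b)" by (simp only: N)
    then obtain C where "0 \<le> C"
      "\<And>r p. r \<ge> 1 \<Longrightarrow> \<bar>wave_field B z (wave r) p \<bullet> b - z \<bullet> b * \<eta> p * ripple N r p\<bar> \<le> C / r"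
      by (rule osc_leading_term) (simp_all add: N G_bounded[unfolded N])
    then show ?thesis
      by (intro exI[of _ C]) (simp add: N inner_diff_left mult_ac)
  qed
  then have "\<forall>b\<in>Basis. \<exists>C\<ge>0. \<forall>r\<ge>1. \<forall>p. \<bar>(wave_field B z (wave r) p - (\<eta> p * ripple 6 r p) *\<^sub>R z) \<bullet> b\<bar> \<le> C / r"
    by simp
  then obtain C where C: "\<forall>b\<in>Basis. C b \<ge> 0 \<and>
      (\<forall>r\<ge>1. \<forall>p. \<bar>(wave_field B z (wave r) p - (\<eta> p * ripple 6 r p) *\<^sub>R z) \<bullet> b\<bar> \<le> C b / r)"
    unfolding bchoice_iff by blast
  show ?thesis
  proof (rule that)
    show "0 \<le> (\<Sum>b\<in>Basis. C b)" using C by (intro sum_nonneg) simp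
    fix r :: real and p assume r: "r \<ge> 1"
    have "norm (wave_field B z (wave r) p - (\<eta> p * ripple 6 r p) *\<^sub>R z)
      \<le> (\<Sum>b\<in>Basis. \<bar>(wave_field B z (wave r) p - (\<eta> p * ripple 6 r p) *\<^sub>R z) \<bullet> b\<bar>)"
      by (rule norm_le_l1)
    also have "\<dots> \<le> (\<Sum>b\<in>Basis. C b / r)" using C r by (intro sum_mono) blast
    finally show "norm (wave_field B z (wave r) p - (\<eta> p * ripple 6 r p) *\<^sub>R z) \<le> (\<Sum>b\<in>Basis. C b) / r"
      by (simp add: sum_divide_distrib)
  qed
qed

end

section \<open>Hausdorff measure of open sets\<close>

definition hausdorff_term :: "nat \<Rightarrow> 'a::metric_space set \<Rightarrow> ennreal" where
  "hausdorff_term d C = (if C = {} then 0 else ennreal (unit_ball_vol (real d) * (diameter C / 2) ^ d))"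

definition fine_cover :: "real \<Rightarrow> 'a::metric_space set \<Rightarrow> (nat \<Rightarrow> 'a set) \<Rightarrow> bool" where
  "fine_cover \<delta> A C \<longleftrightarrow> A \<subseteq> (\<Union>i. C i) \<and> (\<forall>i. bounded (C i) \<and> diameter (C i) \<le> \<delta>)"

lemma hausdorff_content_alt:
  "hausdorff_content d \<delta> A = (INF C \<in> {C. fine_cover \<delta> A C}. \<Sum>i. hausdorff_term d (C i))"
  by (simp add: hausdorff_content_def hausdorff_term_def fine_cover_def)

lemma hausdorff_content_le:
  "fine_cover \<delta> A C \<Longrightarrow> hausdorff_content d \<delta> A \<le> (\<Sum>i. hausdorff_term d (C i))"
  unfolding hausdorff_content_alt by (rule INF_lower) simp

lemma hausdorff_content_greatest:
  "(\<And>C. fine_cover \<delta> A C \<Longrightarrow> x \<le> (\<Sum>i. hausdorff_term d (C i))) \<Longrightarrow> x \<le> hausdorff_content d \<delta> A"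
  unfolding hausdorff_content_alt by (rule INF_greatest) simp

lemma hausdorff_content_le_measure: "\<delta> > 0 \<Longrightarrow> hausdorff_content d \<delta> A \<le> hausdorff_measure d A"
  unfolding hausdorff_measure_def by (rule SUP_upper) simp

lemma hausdorff_measure_least:
  "(\<And>\<delta>. \<delta> > 0 \<Longrightarrow> hausdorff_content d \<delta> A \<le> x) \<Longrightarrow> hausdorff_measure d A \<le> x"
  unfolding hausdorff_measure_def by (rule SUP_least) simp

lemma hausdorff_measure_mono:
  assumes "A \<subseteq> B"
  shows "hausdorff_measure d A \<le> hausdorff_measure d B"
proof (rule hausdorff_measure_least)
  fix \<delta> :: real assume "\<delta> > 0"
  have "hausdorff_content d \<delta> A \<le> hausdorff_content d \<delta> B"
  proof (rule hausdorff_content_greatest)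
    fix C assume "fine_cover \<delta> B C"
    then have "fine_cover \<delta> A C" using assms by (auto simp: fine_cover_def)
    then show "hausdorff_content d \<delta> A \<le> (\<Sum>i. hausdorff_term d (C i))" by (rule hausdorff_content_le)
  qed
  also have "\<dots> \<le> hausdorff_measure d B" using \<open>\<delta> > 0\<close> by (rule hausdorff_content_le_measure)
  finally show "hausdorff_content d \<delta> A \<le> hausdorff_measure d B" .
qed

lemma hausdorff_measure_empty: "hausdorff_measure d {} = 0"
proof -
  have "hausdorff_measure d {} \<le> 0"
  proof (rule hausdorff_measure_least)
    fix \<delta> :: real assume "\<delta> > 0"
    then have "fine_cover \<delta> {} (\<lambda>i. {})" by (simp add: fine_cover_def)
    from hausdorff_content_le[OF this, of d] show "hausdorff_content d \<delta> {} \<le> 0"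
      by (simp add: hausdorff_term_def)
  qed
  then show ?thesis by simp
qed

text \<open>The covers of the sets \<open>A n\<close> that are optimal up to \<open>e / 2 ^ (n + 1)\<close> are merged into one sequence.\<close>

lemma hausdorff_content_countable_subadditive:
  "hausdorff_content d \<delta> (\<Union>n::nat. A n) \<le> (\<Sum>n. hausdorff_content d \<delta> (A n))"
proof (rule ennreal_le_epsilon)
  fix e :: real assume fin: "(\<Sum>n. hausdorff_content d \<delta> (A n)) < top" and "e > 0"
  define b where "b n = ennreal e * ennreal ((1 / 2) ^ Suc n)" for n
  have ex: "\<exists>C. fine_cover \<delta> (A n) C \<and> (\<Sum>i. hausdorff_term d (C i)) \<le> hausdorff_content d \<delta> (A n) + b n" for n
  proof -
    have "hausdorff_content d \<delta> (A n) \<noteq> top"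
      using fin ennreal_suminf_lessD[OF fin, of n] by simp
    moreover have "b n > 0" using \<open>e > 0\<close> by (simp add: b_def flip: ennreal_mult)
    ultimately have "hausdorff_content d \<delta> (A n) < hausdorff_content d \<delta> (A n) + b n"
      by (metis add.right_neutral ennreal_add_left_cancel_less infinity_ennreal_def)
    then obtain C where "fine_cover \<delta> (A n) C" "(\<Sum>i. hausdorff_term d (C i)) < hausdorff_content d \<delta> (A n) + b n"
      unfolding hausdorff_content_alt[of d \<delta> "A n"] INF_less_iff by auto
    then show ?thesis by (intro exI[of _ C]) (simp add: less_imp_le)
  qed
  have "\<forall>n. \<exists>C. fine_cover \<delta> (A n) C \<and> (\<Sum>i. hausdorff_term d (C i)) \<le> hausdorff_content d \<delta> (A n) + b n"
    using ex ..
  from choice[OF this] obtain C where CC: "\<forall>n. fine_cover \<delta> (A n) (C n) \<and>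
      (\<Sum>i. hausdorff_term d (C n i)) \<le> hausdorff_content d \<delta> (A n) + b n" ..
  have C: "fine_cover \<delta> (A n) (C n)"
    "(\<Sum>i. hausdorff_term d (C n i)) \<le> hausdorff_content d \<delta> (A n) + b n" for n
    using CC by simp_all
  define D where "D k = (case prod_decode k of (n, i) \<Rightarrow> C n i)" for k
  have "fine_cover \<delta> (\<Union>n. A n) D"
    unfolding fine_cover_def
  proof (intro conjI allI subsetI)
    fix x assume "x \<in> (\<Union>n. A n)"
    then obtain n where "x \<in> A n" by blast
    then obtain i where "x \<in> C n i" using C(1)[of n] by (auto simp: fine_cover_def)
    then have "x \<in> D (prod_encode (n, i))" by (simp add: D_def)
    then show "x \<in> (\<Union>k. D k)" by blast
  next
    show "bounded (D k)" "diameter (D k) \<le> \<delta>" for k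
      using C(1) by (auto simp: D_def fine_cover_def split: prod.split)
  qed
  then have "hausdorff_content d \<delta> (\<Union>n. A n) \<le> (\<Sum>k. hausdorff_term d (D k))"
    by (rule hausdorff_content_le)
  also have "\<dots> = (\<Sum>n. \<Sum>i. hausdorff_term d (C n i))"
    unfolding D_def using suminf_ennreal_2dimen[of "\<lambda>n. \<Sum>i. hausdorff_term d (C n i)" "\<lambda>(n, i). hausdorff_term d (C n i)"]
    by (simp add: case_prod_unfold)
  also have "\<dots> \<le> (\<Sum>n. hausdorff_content d \<delta> (A n) + b n)"
    by (intro suminf_le C(2)) auto
  also have "\<dots> = (\<Sum>n. hausdorff_content d \<delta> (A n)) + (\<Sum>n. b n)"
    by (rule suminf_add[symmetric]) auto
  also have "(\<Sum>n. b n) = ennreal e"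
    unfolding b_def ennreal_suminf_cmult
    by (subst suminf_ennreal_eq[OF zero_le_power power_half_series]) auto
  finally show "hausdorff_content d \<delta> (\<Union>n. A n) \<le> (\<Sum>n. hausdorff_content d \<delta> (A n)) + ennreal e" .
qed

lemma hausdorff_measure_countable_subadditive:
  "hausdorff_measure d (\<Union>n::nat. A n) \<le> (\<Sum>n. hausdorff_measure d (A n))"
proof (rule hausdorff_measure_least)
  fix \<delta> :: real assume "\<delta> > 0"
  have "hausdorff_content d \<delta> (\<Union>n. A n) \<le> (\<Sum>n. hausdorff_content d \<delta> (A n))"
    by (rule hausdorff_content_countable_subadditive)
  also have "\<dots> \<le> (\<Sum>n. hausdorff_measure d (A n))"
    by (intro suminf_le hausdorff_content_le_measure \<open>\<delta> > 0\<close>) auto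
  finally show "hausdorff_content d \<delta> (\<Union>n. A n) \<le> (\<Sum>n. hausdorff_measure d (A n))" .
qed

lemma hausdorff_measure_Un: "hausdorff_measure d (A \<union> B) \<le> hausdorff_measure d A + hausdorff_measure d B"
  using hausdorff_measure_countable_subadditive[of d "binaryset A B"]
  by (simp add: UN_binaryset_eq suminf_binaryset_eq[of "hausdorff_measure d"] hausdorff_measure_empty)

lemma similarity_diameter:
  fixes C :: "'a::euclidean_space set"
  assumes "r > 0" "bounded C"
  shows "bounded ((\<lambda>x. a + r *\<^sub>R x) ` C)" "diameter ((\<lambda>x. a + r *\<^sub>R x) ` C) \<le> r * diameter C"
proof -
  let ?f = "\<lambda>x. a + r *\<^sub>R x"
  show "bounded (?f ` C)"
    using bounded_translation[OF bounded_scaling[OF assms(2), of r], of a] by (simp add: image_image)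
  show "diameter (?f ` C) \<le> r * diameter C"
  proof (rule diameter_le)
    show "?f ` C \<noteq> {} \<or> 0 \<le> r * diameter C" using assms by (simp add: diameter_ge_0)
    fix x y assume "x \<in> ?f ` C" "y \<in> ?f ` C"
    then obtain u v where uv: "u \<in> C" "v \<in> C" "x = ?f u" "y = ?f v" by blast
    have "norm (x - y) = r * dist u v"
      using assms by (simp add: uv dist_norm flip: scaleR_diff_right)
    also have "\<dots> \<le> r * diameter C"
      using assms diameter_bounded_bound[OF assms(2) uv(1,2)] by (intro mult_left_mono) auto
    finally show "norm (x - y) \<le> r * diameter C" .
  qed
qed

lemma hausdorff_measure_similarity_le:
  fixes A :: "'a::euclidean_space set"
  assumes "r > 0"
  shows "hausdorff_measure d ((\<lambda>x. a + r *\<^sub>R x) ` A) \<le> ennreal (r ^ d) * hausdorff_measure d A"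
proof (rule hausdorff_measure_least)
  fix \<delta> :: real assume "\<delta> > 0"
  let ?f = "\<lambda>x. a + r *\<^sub>R x"
  have rd: "ennreal (1 / r ^ d) * ennreal (r ^ d) = 1"
    using assms by (simp flip: ennreal_mult)
  have term_le: "hausdorff_term d (?f ` C) \<le> ennreal (r ^ d) * hausdorff_term d C" if "bounded C" for C
  proof (cases "C = {}")
    case False
    note sim = similarity_diameter[OF assms that, of a]
    have nn: "0 \<le> diameter (?f ` C)" using sim(1) by (rule diameter_ge_0)
    have "unit_ball_vol (real d) * (diameter (?f ` C) / 2) ^ d \<le> unit_ball_vol (real d) * (r * diameter C / 2) ^ d"
      using sim(2) nn by (intro mult_left_mono power_mono divide_right_mono) auto
    also have "\<dots> = r ^ d * (unit_ball_vol (real d) * (diameter C / 2) ^ d)"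
      by (simp add: power_mult_distrib power_divide)
    finally show ?thesis
      using False assms by (simp add: hausdorff_term_def ennreal_leI flip: ennreal_mult')
  qed (simp add: hausdorff_term_def)
  have "ennreal (1 / r ^ d) * hausdorff_content d \<delta> (?f ` A) \<le> hausdorff_content d (\<delta> / r) A"
  proof (rule hausdorff_content_greatest)
    fix C assume C: "fine_cover (\<delta> / r) A C"
    have "fine_cover \<delta> (?f ` A) (\<lambda>i. ?f ` C i)"
      unfolding fine_cover_def
    proof (intro conjI allI)
      have "?f ` A \<subseteq> ?f ` (\<Union>i. C i)" using C by (intro image_mono) (simp add: fine_cover_def)
      then show "?f ` A \<subseteq> (\<Union>i. ?f ` C i)" by (simp only: image_UN)
      fix i
      have b: "bounded (C i)" "diameter (C i) \<le> \<delta> / r" using C by (auto simp: fine_cover_def)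
      show "bounded (?f ` C i)" by (rule similarity_diameter(1)[OF assms b(1)])
      have "diameter (?f ` C i) \<le> r * diameter (C i)" by (rule similarity_diameter(2)[OF assms b(1)])
      also have "\<dots> \<le> r * (\<delta> / r)" using assms b(2) by (intro mult_left_mono) auto
      finally show "diameter (?f ` C i) \<le> \<delta>" using assms by simp
    qed
    then have "hausdorff_content d \<delta> (?f ` A) \<le> (\<Sum>i. hausdorff_term d (?f ` C i))"
      by (rule hausdorff_content_le)
    also have "\<dots> \<le> (\<Sum>i. ennreal (r ^ d) * hausdorff_term d (C i))"
      using C by (intro suminf_le term_le) (auto simp: fine_cover_def)
    also have "\<dots> = ennreal (r ^ d) * (\<Sum>i. hausdorff_term d (C i))" by simp
    finally have "ennreal (1 / r ^ d) * hausdorff_content d \<delta> (?f ` A)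
        \<le> ennreal (1 / r ^ d) * (ennreal (r ^ d) * (\<Sum>i. hausdorff_term d (C i)))"
      by (rule mult_left_mono) simp
    then show "ennreal (1 / r ^ d) * hausdorff_content d \<delta> (?f ` A) \<le> (\<Sum>i. hausdorff_term d (C i))"
      by (simp only: mult.assoc[symmetric] rd mult_1)
  qed
  also have "\<dots> \<le> hausdorff_measure d A"
    using \<open>\<delta> > 0\<close> assms by (intro hausdorff_content_le_measure) simp
  finally have "ennreal (r ^ d) * (ennreal (1 / r ^ d) * hausdorff_content d \<delta> (?f ` A)) \<le> ennreal (r ^ d) * hausdorff_measure d A"
    by (rule mult_left_mono) simp
  moreover have "ennreal (r ^ d) * ennreal (1 / r ^ d) = 1" using rd by (simp add: mult.commute)
  ultimately show "hausdorff_content d \<delta> (?f ` A) \<le> ennreal (r ^ d) * hausdorff_measure d A"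
    by (simp only: mult.assoc[symmetric] mult_1)
qed

lemma ball_similarity:
  fixes a :: "'a::euclidean_space"
  assumes "r > 0"
  shows "(\<lambda>x. a + r *\<^sub>R x) ` ball 0 1 = ball a r"
proof -
  have "ball a r = (+) a ` ((*\<^sub>R) r ` ball 0 1)"
    using ball_scale[of r "0::'a" 1] ball_translation[of a 0 r] assms by simp
  then show ?thesis by (simp add: image_image)
qed

text \<open>A similarity multiplies the measure by at most \<open>r ^ d\<close>, and so does its inverse with \<open>1 / r\<close>.\<close>

lemma hausdorff_measure_ball:
  fixes a :: "'a::euclidean_space"
  assumes "r > 0"
  shows "hausdorff_measure d (ball a r) = ennreal (r ^ d) * hausdorff_measure d (ball (0::'a) 1)"
proof (rule antisym)
  show "hausdorff_measure d (ball a r) \<le> ennreal (r ^ d) * hausdorff_measure d (ball (0::'a) 1)"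
    using hausdorff_measure_similarity_le[OF assms, of d a "ball 0 1"] by (simp add: ball_similarity assms)
  have "1 / r > 0" using assms by simp
  have "(\<lambda>x. - (1 / r) *\<^sub>R a + (1 / r) *\<^sub>R x) ` ball a r = ball 0 1"
  proof -
    have "(\<lambda>x. - (1 / r) *\<^sub>R a + (1 / r) *\<^sub>R x) ` (\<lambda>x. a + r *\<^sub>R x) ` ball 0 1 = ball 0 1"
      unfolding image_image using assms by (simp add: scaleR_add_right)
    then show ?thesis by (simp only: ball_similarity[OF assms])
  qed
  then have "hausdorff_measure d (ball (0::'a) 1) \<le> ennreal ((1 / r) ^ d) * hausdorff_measure d (ball a r)"
    using hausdorff_measure_similarity_le[OF \<open>1 / r > 0\<close>, of d "- (1 / r) *\<^sub>R a" "ball a r"] by simp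
  then have "ennreal (r ^ d) * hausdorff_measure d (ball (0::'a) 1)
      \<le> ennreal (r ^ d) * (ennreal ((1 / r) ^ d) * hausdorff_measure d (ball a r))"
    by (rule mult_left_mono) simp
  moreover have "ennreal (r ^ d) * ennreal ((1 / r) ^ d) = 1"
    using assms by (simp add: power_divide flip: ennreal_mult)
  ultimately show "ennreal (r ^ d) * hausdorff_measure d (ball (0::'a) 1) \<le> hausdorff_measure d (ball a r)"
    by (simp only: mult.assoc[symmetric] mult_1)
qed

text \<open>A countable family as a sequence that is filled up with empty sets, which preserves disjointness.\<close>

definition enumerate_family :: "'i set \<Rightarrow> ('i \<Rightarrow> 'a set) \<Rightarrow> nat \<Rightarrow> 'a set" where
  "enumerate_family I f n = (if n \<in> to_nat_on I ` I then f (from_nat_into I n) else {})"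

lemma UN_enumerate_family:
  assumes "countable I"
  shows "(\<Union>n. enumerate_family I f n) = (\<Union>i\<in>I. f i)"
proof
  show "(\<Union>n. enumerate_family I f n) \<subseteq> (\<Union>i\<in>I. f i)"
    using assms by (auto simp: enumerate_family_def split: if_splits)
  show "(\<Union>i\<in>I. f i) \<subseteq> (\<Union>n. enumerate_family I f n)"
  proof (rule UN_least)
    fix i assume i: "i \<in> I"
    then have "f i = enumerate_family I f (to_nat_on I i)"
      using assms by (simp add: enumerate_family_def)
    then show "f i \<subseteq> (\<Union>n. enumerate_family I f n)" by blast
  qed
qed

lemma disjoint_enumerate_family:
  assumes "countable I" "pairwise (\<lambda>i j. disjnt (f i) (f j)) I"
  shows "disjoint_family (enumerate_family I f)"
  unfolding disjoint_family_on_def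
proof (intro ballI impI)
  fix m n :: nat assume "m \<noteq> n"
  show "enumerate_family I f m \<inter> enumerate_family I f n = {}"
  proof (cases "m \<in> to_nat_on I ` I \<and> n \<in> to_nat_on I ` I")
    case True
    then obtain i j where ij: "i \<in> I" "j \<in> I" "m = to_nat_on I i" "n = to_nat_on I j" by blast
    then have "i \<noteq> j" using \<open>m \<noteq> n\<close> by blast
    then have "disjnt (f i) (f j)" using assms(2) ij unfolding pairwise_def by blast
    then show ?thesis using ij assms(1) by (simp add: enumerate_family_def disjnt_def)
  qed (auto simp: enumerate_family_def)
qed

text \<open>The null set lies in an open set of small volume. The Vitali lemma selects disjoint small balls
  in it whose fivefold enlargements still cover, and the contribution of a ball to the content is its
  volume.\<close>

lemma hausdorff_measure_negligible:
  fixes N :: "'a::euclidean_space set"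
  assumes "negligible N"
  shows "hausdorff_measure DIM('a) N = 0"
proof -
  have "hausdorff_measure DIM('a) N \<le> 0"
  proof (rule hausdorff_measure_least)
    fix \<delta> :: real assume "\<delta> > 0"
    show "hausdorff_content DIM('a) \<delta> N \<le> 0"
    proof (rule ennreal_le_epsilon)
      fix e :: real assume "e > 0"
      have N: "N \<in> null_sets lebesgue" using assms by (simp add: negligible_iff_null_sets)
      have e1: "e / 5 ^ DIM('a) > 0" using \<open>e > 0\<close> by simp
      obtain U where U: "open U" "N \<subseteq> U" "emeasure lebesgue (U - N) < ennreal (e / 5 ^ DIM('a))"
        by (rule sets_lebesgue_outer_open[OF null_setsD2[OF N] e1]) (rule that)
      have "emeasure lebesgue (U - N) = emeasure lborel U"
        using emeasure_Diff_null_set[OF N, of U] U(1) by simp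
      with U(3) have emU: "emeasure lborel U < ennreal (e / 5 ^ DIM('a))" by simp
      have "\<exists>r>0. r \<le> \<delta> / 10 \<and> ball x r \<subseteq> U" if x: "x \<in> N" for x
      proof -
        obtain s where "s > 0" "ball x s \<subseteq> U" using U(1,2) x by (meson openE subsetD)
        then show ?thesis using \<open>\<delta> > 0\<close> by (intro exI[of _ "min s (\<delta> / 10)"]) auto
      qed
      then have "\<forall>x\<in>N. \<exists>r>0. r \<le> \<delta> / 10 \<and> ball x r \<subseteq> U" by blast
      then obtain r where r: "\<forall>x\<in>N. r x > 0 \<and> r x \<le> \<delta> / 10 \<and> ball x (r x) \<subseteq> U"
        unfolding bchoice_iff by blast
      have cov: "N \<subseteq> (\<Union>x\<in>N. ball x (r x))"
        by (rule subsetI, rule UN_I) (use r in auto)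
      obtain I where I: "countable I" "I \<subseteq> N" "pairwise (\<lambda>x y. disjnt (ball x (r x)) (ball y (r y))) I"
        "N \<subseteq> (\<Union>x\<in>I. ball x (5 * r x))"
        by (rule Vitali_covering_lemma_balls[OF cov, of "\<delta> / 10"]) (use r in auto)
      define C where "C = enumerate_family I (\<lambda>x. ball x (5 * r x))"
      define B where "B = enumerate_family I (\<lambda>x. ball x (r x))"
      have in_I: "from_nat_into I n \<in> N" if "n \<in> to_nat_on I ` I" for n
        using that I(1,2) by auto
      have "fine_cover \<delta> N C"
        unfolding fine_cover_def
      proof (intro conjI allI)
        show "N \<subseteq> (\<Union>n. C n)" using I(4) by (simp add: C_def UN_enumerate_family[OF I(1)])
        show "bounded (C n)" for n by (simp add: C_def enumerate_family_def)
        show "diameter (C n) \<le> \<delta>" for n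
        proof (cases "n \<in> to_nat_on I ` I")
          case True
          then have "0 < r (from_nat_into I n)" "r (from_nat_into I n) \<le> \<delta> / 10" using r in_I by blast+
          then show ?thesis using True by (simp add: C_def enumerate_family_def)
        next
          case False
          then show ?thesis using \<open>\<delta> > 0\<close> by (simp add: C_def enumerate_family_def)
        qed
      qed
      then have le: "hausdorff_content DIM('a) \<delta> N \<le> (\<Sum>n. hausdorff_term DIM('a) (C n))"
        by (rule hausdorff_content_le)
      have terms: "hausdorff_term DIM('a) (C n) = ennreal (5 ^ DIM('a)) * emeasure lborel (B n)" for n
      proof (cases "n \<in> to_nat_on I ` I")
        case True
        then have "r (from_nat_into I n) > 0" using r in_I by blast
        then show ?thesis using True
          by (simp add: C_def B_def enumerate_family_def hausdorff_term_def emeasure_ball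
              power_mult_distrib mult_ac flip: ennreal_mult)
      next
        case False
        then show ?thesis by (simp add: C_def B_def enumerate_family_def hausdorff_term_def)
      qed
      note le
      also have "(\<Sum>n. hausdorff_term DIM('a) (C n)) = (\<Sum>n. ennreal (5 ^ DIM('a)) * emeasure lborel (B n))"
        by (simp only: terms)
      also have "\<dots> = ennreal (5 ^ DIM('a)) * emeasure lborel (\<Union>n. B n)"
        unfolding ennreal_suminf_cmult
      proof (subst suminf_emeasure)
        show "range B \<subseteq> sets lborel" by (auto simp: B_def enumerate_family_def)
        show "disjoint_family B" unfolding B_def by (rule disjoint_enumerate_family[OF I(1,3)])
      qed simp
      also have "\<dots> \<le> ennreal (5 ^ DIM('a)) * emeasure lborel U"
      proof (intro mult_left_mono emeasure_mono)
        show "(\<Union>n. B n) \<subseteq> U"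
          unfolding B_def UN_enumerate_family[OF I(1)] by (rule UN_least) (use r I(2) in auto)
        show "U \<in> sets lborel" using U(1) by simp
      qed simp
      also have "\<dots> \<le> ennreal (5 ^ DIM('a)) * ennreal (e / 5 ^ DIM('a))"
        using emU by (intro mult_left_mono) (auto simp: less_imp_le)
      also have "\<dots> = ennreal e" using \<open>e > 0\<close> by (simp flip: ennreal_mult)
      finally show "hausdorff_content DIM('a) \<delta> N \<le> 0 + ennreal e" by simp
    qed
  qed
  then show ?thesis by simp
qed

definition hausdorff_ratio :: "'a::euclidean_space itself \<Rightarrow> ennreal" where
  "hausdorff_ratio _ = hausdorff_measure DIM('a) (ball (0::'a) 1) / emeasure lborel (ball (0::'a) 1)"

lemma hausdorff_measure_ball_ratio:
  fixes a :: "'a::euclidean_space"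
  assumes "r > 0"
  shows "hausdorff_measure DIM('a) (ball a r) = hausdorff_ratio TYPE('a) * emeasure lborel (ball a r)"
proof -
  let ?v = "ennreal (unit_ball_vol (real DIM('a)))" and ?H = "hausdorff_measure DIM('a) (ball (0::'a) 1)"
  have "unit_ball_vol (real DIM('a)) \<noteq> 0"
    using unit_ball_vol_pos[of "real DIM('a)"] by (metis less_irrefl of_nat_0_le_iff)
  then have v: "?v \<noteq> 0" "?v < top" by simp_all
  have 1: "emeasure lborel (ball a r) = ?v * ennreal (r ^ DIM('a))"
    using assms by (simp add: emeasure_ball ennreal_mult')
  have 2: "emeasure lborel (ball (0::'a) 1) = ?v" by (simp add: emeasure_ball)
  have "hausdorff_ratio TYPE('a) * ?v = ?H"
    unfolding hausdorff_ratio_def 2 ennreal_divide_times using v by simp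
  then have "hausdorff_ratio TYPE('a) * (?v * ennreal (r ^ DIM('a))) = ?H * ennreal (r ^ DIM('a))"
    by (simp flip: mult.assoc)
  then show ?thesis using hausdorff_measure_ball[OF assms, of "DIM('a)" a] 1 by (simp add: mult.commute)
qed

text \<open>By the Vitali covering theorem an open set is a countable disjoint union of balls up to a null set.\<close>

lemma hausdorff_measure_open_le:
  fixes U :: "'a::euclidean_space set"
  assumes "open U"
  shows "hausdorff_measure DIM('a) U \<le> hausdorff_ratio TYPE('a) * emeasure lborel U"
proof -
  define K where "K = {(x, r). x \<in> U \<and> 0 < r \<and> ball x r \<subseteq> U}"
  have fine: "\<exists>i. i \<in> K \<and> x \<in> ball (fst i) (snd i) \<and> snd i < d" if x: "x \<in> U" and d: "0 < d" for x and d :: real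
  proof -
    obtain s where s: "s > 0" "ball x s \<subseteq> U" using assms x by (rule openE)
    have "min s (d / 2) > 0" "min s (d / 2) < d" "ball x (min s (d / 2)) \<subseteq> ball x s" using s(1) d by auto
    then show ?thesis using s x by (intro exI[of _ "(x, min s (d / 2))"]) (auto simp: K_def)
  qed
  obtain I where I: "countable I" "I \<subseteq> K"
    "pairwise (\<lambda>i j. disjnt (ball (fst i) (snd i)) (ball (fst j) (snd j))) I"
    "negligible (U - (\<Union>i\<in>I. ball (fst i) (snd i)))"
    by (rule Vitali_covering_theorem_balls[of U K fst snd, OF fine])
  define B where "B = enumerate_family I (\<lambda>i. ball (fst i) (snd i))"
  have UB: "(\<Union>n. B n) = (\<Union>i\<in>I. ball (fst i) (snd i))"
    unfolding B_def by (rule UN_enumerate_family[OF I(1)])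
  have in_K: "from_nat_into I n \<in> K" if "n \<in> to_nat_on I ` I" for n
    using that I(1,2) by auto
  have HB: "hausdorff_measure DIM('a) (B n) = hausdorff_ratio TYPE('a) * emeasure lborel (B n)" for n
  proof (cases "n \<in> to_nat_on I ` I")
    case True
    then have "snd (from_nat_into I n) > 0" using in_K[OF True] by (auto simp: K_def)
    then show ?thesis using True by (simp add: B_def enumerate_family_def hausdorff_measure_ball_ratio)
  next
    case False
    then show ?thesis by (simp add: B_def enumerate_family_def hausdorff_measure_empty)
  qed
  have "U \<subseteq> (\<Union>n. B n) \<union> (U - (\<Union>n. B n))" by blast
  then have "hausdorff_measure DIM('a) U \<le> hausdorff_measure DIM('a) ((\<Union>n. B n) \<union> (U - (\<Union>n. B n)))"
    by (rule hausdorff_measure_mono)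
  also have "\<dots> \<le> hausdorff_measure DIM('a) (\<Union>n. B n) + hausdorff_measure DIM('a) (U - (\<Union>n. B n))"
    by (rule hausdorff_measure_Un)
  also have "hausdorff_measure DIM('a) (U - (\<Union>n. B n)) = 0"
    using I(4) unfolding UB by (rule hausdorff_measure_negligible)
  also have "hausdorff_measure DIM('a) (\<Union>n. B n) + 0 \<le> (\<Sum>n. hausdorff_measure DIM('a) (B n))"
    using hausdorff_measure_countable_subadditive[of "DIM('a)" B] by simp
  also have "\<dots> = hausdorff_ratio TYPE('a) * (\<Sum>n. emeasure lborel (B n))"
    unfolding HB by simp
  also have "(\<Sum>n. emeasure lborel (B n)) = emeasure lborel (\<Union>n. B n)"
  proof (rule suminf_emeasure)
    show "range B \<subseteq> sets lborel" by (auto simp: B_def enumerate_family_def)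
    show "disjoint_family B" unfolding B_def by (rule disjoint_enumerate_family[OF I(1,3)])
  qed
  also have "hausdorff_ratio TYPE('a) * emeasure lborel (\<Union>n. B n) \<le> hausdorff_ratio TYPE('a) * emeasure lborel U"
  proof (intro mult_left_mono emeasure_mono)
    show "(\<Union>n. B n) \<subseteq> U"
      unfolding UB
    proof (rule UN_least)
      fix i assume "i \<in> I"
      then have "i \<in> K" using I(2) by blast
      then show "ball (fst i) (snd i) \<subseteq> U" by (simp add: K_def case_prod_unfold)
    qed
  qed (use assms in auto)
  finally show ?thesis .
qed

text \<open>On a ball equality is known. If \<open>V\<close> lies in a ball, then the measure of the ball is at most that of
  \<open>V\<close> plus that of an open neighbourhood of the rest, to which the upper bound applies. Unbounded
  sets are exhausted by bounded ones.\<close>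

lemma hausdorff_measure_open_ge:
  fixes U :: "'a::euclidean_space set"
  assumes U: "open U" and fin: "hausdorff_ratio TYPE('a) < top"
  shows "hausdorff_ratio TYPE('a) * emeasure lborel U \<le> hausdorff_measure DIM('a) U"
proof -
  let ?c = "hausdorff_ratio TYPE('a)" and ?H = "hausdorff_measure DIM('a) :: 'a set \<Rightarrow> ennreal"
  have bounded_case: "?c * emeasure lborel V \<le> ?H V" if V: "open V" "V \<subseteq> ball 0 R" and R: "R > 0" for V :: "'a set" and R :: real
  proof (rule ennreal_le_epsilon)
    fix e :: real assume "e > 0"
    obtain k where k: "?c = ennreal k" "k \<ge> 0" using fin by (cases ?c) auto
    let ?D = "ball (0::'a) R - V"
    have D: "?D \<in> sets borel" using V(1) by auto
    have De: "emeasure lborel ?D < top"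
      using emeasure_bounded_finite[OF bounded_subset[OF bounded_ball, of ?D 0 R]] by auto
    have e1: "e / (k + 1) > 0" using \<open>e > 0\<close> k(2) by simp
    have Dl: "?D \<in> sets lebesgue" using D by (intro sets_completionI_sets) simp
    obtain T where T: "open T" "?D \<subseteq> T" "emeasure lebesgue (T - ?D) < ennreal (e / (k + 1))"
      by (rule sets_lebesgue_outer_open[OF Dl e1]) (rule that)
    have "T - ?D \<in> sets lborel" using T(1) D by auto
    then have T3: "emeasure lborel (T - ?D) \<le> ennreal (e / (k + 1))"
      using T(3) by (simp add: less_imp_le)
    have "emeasure lborel T = emeasure lborel (?D \<union> (T - ?D))" using T(2) by (intro arg_cong2[of _ _ _ _ emeasure]) auto
    also have "\<dots> = emeasure lborel ?D + emeasure lborel (T - ?D)"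
      using D T(1) by (intro plus_emeasure[symmetric]) auto
    also have "\<dots> \<le> emeasure lborel ?D + ennreal (e / (k + 1))" by (intro add_left_mono T3)
    finally have emT: "emeasure lborel T \<le> emeasure lborel ?D + ennreal (e / (k + 1))" .
    have "?c * emeasure lborel ?D + ?c * emeasure lborel V = ?c * emeasure lborel (?D \<union> V)"
      using D V(1) by (subst plus_emeasure[symmetric]) (auto simp: distrib_left)
    also have "?D \<union> V = ball 0 R" using V(2) by blast
    also have "?c * emeasure lborel (ball (0::'a) R) = ?H (ball 0 R)"
      using R by (simp add: hausdorff_measure_ball_ratio)
    also have "\<dots> \<le> ?H (V \<union> T)" using T(2) by (intro hausdorff_measure_mono) auto
    also have "\<dots> \<le> ?H V + ?H T" by (rule hausdorff_measure_Un)
    also have "\<dots> \<le> ?H V + ?c * (emeasure lborel ?D + ennreal (e / (k + 1)))"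
      using hausdorff_measure_open_le[OF T(1)] mult_left_mono[OF emT, of ?c]
      by (intro add_left_mono) (auto intro: order_trans)
    also have "\<dots> = ?c * emeasure lborel ?D + (?H V + ?c * ennreal (e / (k + 1)))"
      by (simp add: distrib_left add_ac)
    finally have "?c * emeasure lborel V \<le> ?H V + ?c * ennreal (e / (k + 1))"
      using De fin unfolding ennreal_add_left_cancel_le by (auto simp: ennreal_mult_eq_top_iff)
    also have "?c * ennreal (e / (k + 1)) \<le> ennreal e"
    proof -
      have "k * (e / (k + 1)) \<le> e" using k(2) \<open>e > 0\<close> by (simp add: field_simps)
      then show ?thesis using k \<open>e > 0\<close> by (simp add: ennreal_leI flip: ennreal_mult)
    qed
    then have "?H V + ?c * ennreal (e / (k + 1)) \<le> ?H V + ennreal e" by (rule add_left_mono)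
    finally show "?c * emeasure lborel V \<le> ?H V + ennreal e" .
  qed
  let ?V = "\<lambda>n::nat. U \<inter> ball 0 (real (Suc n))"
  have inc: "incseq ?V" by (auto simp: incseq_def)
  have Un: "(\<Union>n. ?V n) = U"
  proof
    show "U \<subseteq> (\<Union>n. ?V n)"
    proof
      fix x assume "x \<in> U"
      moreover obtain n where "norm x < real n" using reals_Archimedean2 by blast
      ultimately show "x \<in> (\<Union>n. ?V n)" by (intro UN_I[of n]) auto
    qed
  qed auto
  have "range ?V \<subseteq> sets lborel" using U by auto
  from SUP_emeasure_incseq[OF this inc] have sup: "(SUP n. emeasure lborel (?V n)) = emeasure lborel U"
    by (simp only: Un)
  have "?c * emeasure lborel U = (SUP n. ?c * emeasure lborel (?V n))"
    unfolding sup[symmetric] SUP_mult_left_ennreal ..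
  also have "\<dots> \<le> ?H U"
  proof (rule SUP_least)
    fix n
    have "?c * emeasure lborel (?V n) \<le> ?H (?V n)"
      by (rule bounded_case[of _ "real (Suc n)"]) (use U in auto)
    also have "\<dots> \<le> ?H U" by (rule hausdorff_measure_mono) auto
    finally show "?c * emeasure lborel (?V n) \<le> ?H U" .
  qed
  finally show ?thesis .
qed

lemma hausdorff_measure_open:
  fixes U :: "'a::euclidean_space set"
  assumes U: "open U"
  shows "hausdorff_measure DIM('a) U = hausdorff_ratio TYPE('a) * emeasure lborel U"
proof (cases "hausdorff_ratio TYPE('a) < top")
  case True
  then show ?thesis
    by (intro antisym hausdorff_measure_open_le hausdorff_measure_open_ge U)
next
  case False
  then have top: "hausdorff_ratio TYPE('a) = top" by (simp add: less_top[symmetric])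
  show ?thesis
  proof (cases "U = {}")
    case True
    then show ?thesis by (simp add: hausdorff_measure_empty)
  next
    case False
    then obtain a where "a \<in> U" by blast
    then obtain r where ar: "r > 0" "ball a r \<subseteq> U" by (rule openE[OF U])
    have pos: "emeasure lborel (ball a r) \<noteq> 0"
      using content_ball_pos[OF ar(1), of a] by (auto simp: measure_def)
    have "hausdorff_measure DIM('a) (ball a r) = top"
      using pos by (simp add: hausdorff_measure_ball_ratio[OF ar(1)] top ennreal_top_mult)
    then have "hausdorff_measure DIM('a) U = top"
      using hausdorff_measure_mono[OF ar(2), of "DIM('a)"] by (simp add: top_unique)
    moreover have "emeasure lborel U \<noteq> 0"
    proof -
      have "emeasure lborel (ball a r) \<le> emeasure lborel U"
        by (rule emeasure_mono[OF ar(2)]) (use U in simp)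
      then show ?thesis using pos by (metis le_zero_eq)
    qed
    ultimately show ?thesis by (simp add: top ennreal_top_mult)
  qed
qed

section \<open>The wave cone and localized plane waves\<close>

text \<open>It is enough to test the plane waves with the profile \<open>h = id\<close>.\<close>

lemma wave_cone_direction:
  fixes z :: "(real^'n) \<times> (real^'n^'n)"
  assumes "z \<in> wave_cone"
  obtains \<tau> \<xi> where "norm \<xi> = 1" "fst z \<bullet> \<xi> = 0" "snd z *v \<xi> = - \<tau> *\<^sub>R fst z"
proof -
  have id: "smooth (\<lambda>s::real. s)" by (rule smooth_linear) (rule bounded_linear_ident)
  obtain \<tau> and \<xi> :: "real^'n" where \<xi>: "norm \<xi> = 1" and
    sol: "\<forall>h :: real \<Rightarrow> real. smooth h \<longrightarrow> (\<forall>p. lin_op 0 (\<lambda>(x, t). h (\<tau> * t + \<xi> \<bullet> x) *\<^sub>R z) p = 0)"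
    using assms unfolding wave_cone_def by auto
  let ?f = "\<lambda>p. (\<xi>, \<tau>) \<bullet> p"
  have lin: "bounded_linear ?f" by (rule bounded_linear_inner_right)
  have f: "smooth ?f" by (rule smooth_linear[OF lin])
  have df: "dir_deriv v ?f p = ?f v" for v p
    by (rule dir_deriv_eqI) (rule bounded_linear_imp_has_derivative[OF lin])
  have "(\<lambda>(x, t). (\<tau> * t + \<xi> \<bullet> x) *\<^sub>R z) = (\<lambda>p. ?f p *\<^sub>R z)"
    by (auto simp: fun_eq_iff add.commute)
  then have 0: "lin_op 0 (\<lambda>p. ?f p *\<^sub>R z) 0 = 0" using sol[rule_format, OF id, of 0] by simp
  have sm: "smooth (\<lambda>p. c * ?f p)" for c using f by simp
  have d: "dir_deriv v (\<lambda>p. c * ?f p) p = c * ?f v" for v c p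
    by (simp add: dir_deriv_cmult[OF f] df)
  have fst: "fst \<circ> (\<lambda>p. ?f p *\<^sub>R z) = (\<lambda>p. \<chi> i. fst z $ i * ?f p)"
    and snd: "snd \<circ> (\<lambda>p. ?f p *\<^sub>R z) = (\<lambda>p. \<chi> i j. snd z $ i $ j * ?f p)"
    by (simp_all add: fun_eq_iff vec_eq_iff)
  have "div_vec (fst \<circ> (\<lambda>p. ?f p *\<^sub>R z)) 0 = fst z \<bullet> \<xi>"
    unfolding fst div_vec_def inner_vec_def[of "fst z"]
    by (simp add: space_partial_eq_dx[OF sm] d inner_axis)
  moreover have "time_derivative (fst \<circ> (\<lambda>p. ?f p *\<^sub>R z)) 0 = \<tau> *\<^sub>R fst z"
    unfolding fst by (simp add: time_derivative_eq_dt[OF sm] d vec_eq_iff)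
  moreover have "div_mat (snd \<circ> (\<lambda>p. ?f p *\<^sub>R z)) 0 = snd z *v \<xi>"
    unfolding snd div_mat_def
    by (simp add: space_partial_eq_dx[OF sm] d inner_axis matrix_vector_mult_def)
  ultimately have "fst z \<bullet> \<xi> = 0" "\<tau> *\<^sub>R fst z + snd z *v \<xi> = 0"
    using 0 by (simp_all add: lin_op_def zero_prod_def)
  then show ?thesis
    using \<xi> by (intro that[of \<xi> \<tau>]) (simp_all add: add_eq_0_iff)
qed

text \<open>In dimension one \<open>\<xi>\<close> is a unit, and trace-free matrices vanish. This removes the case in which
  \<open>bilap_inverse_div\<close> is not trace-free.\<close>

lemma wave_cone_trivial_in_dimension_one:
  fixes z :: "(real^'n) \<times> (real^'n^'n)"
  assumes z: "z \<in> wave_cone" and n: "\<not> CARD('n) \<ge> 2"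
  shows "z = 0"
proof -
  have "CARD('n) > 0" by simp
  with n have "CARD('n) = 1" by linarith
  then obtain i :: 'n where i: "UNIV = {i}" by (rule card_1_singletonE)
  then have all: "j = i" for j by blast
  obtain \<tau> \<xi> where \<xi>: "norm \<xi> = 1" "fst z \<bullet> \<xi> = 0"
    by (rule wave_cone_direction[OF z]) (rule that)
  have "\<xi> $ i \<noteq> 0"
  proof
    assume "\<xi> $ i = 0"
    then have "\<xi> = 0" using all by (metis vec_eq_iff zero_index)
    then show False using \<xi>(1) by simp
  qed
  moreover have "fst z $ i * \<xi> $ i = 0" using \<xi>(2) by (simp add: inner_vec_def i)
  ultimately have "fst z $ i = 0" by simp
  moreover have "snd z $ i $ i = 0"
    using z by (auto simp: wave_cone_def state_space_def sym_tracefree_def trace_def i)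
  ultimately have "fst z = 0" "snd z = 0"
    using all by (metis vec_eq_iff zero_index)+
  then show ?thesis by (simp add: prod_eq_iff)
qed

lemma zero_in_state_space: "0 \<in> state_space"
  by (simp add: state_space_def sym_tracefree_def zero_prod_def transpose_def trace_def vec_eq_iff)

lemma lin_op_zero: "lin_op B (\<lambda>p. 0) p = 0"
  by (cases p) (simp add: lin_op_def div_vec_def div_mat_def space_partial_def time_derivative_def
      o_def zero_prod_def vec_eq_iff)

text \<open>What is required of the perturbation apart from its size; the compact set \<open>S\<close> will lie in \<open>\<O>\<close>.\<close>

definition localized_solution ::
    "real^'n^'n \<Rightarrow> ((real^'n) \<times> real) set \<Rightarrow> ((real^'n) \<times> real \<Rightarrow> (real^'n) \<times> (real^'n^'n)) \<Rightarrow> bool" where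
  "localized_solution B S w \<longleftrightarrow> smooth w \<and> range w \<subseteq> state_space \<and> (\<forall>p. p \<notin> S \<longrightarrow> w p = 0) \<and>
     (\<forall>t. has_bochner_integral lborel (\<lambda>x. w (x, t)) 0) \<and> (\<forall>p. lin_op B w p = 0)"

text \<open>In dimension one the cone is trivial and the zero field serves as \<open>w'\<close>.\<close>

lemma (in plane_wave) localized_plane_wave:
  fixes z :: "(real^'n) \<times> (real^'n^'n)"
  assumes z: "z \<in> wave_cone"
    and dir: "norm \<xi> = 1" "fst z \<bullet> \<xi> = 0" "snd z *v \<xi> = - \<tau> *\<^sub>R fst z" and N: "N = 6"
    and G_bounded: "\<And>j. j < N \<Longrightarrow> \<exists>C. \<forall>x. \<bar>G j x\<bar> \<le> C"
  obtains C where "0 \<le> C" "\<And>r. r \<ge> 1 \<Longrightarrow> \<exists>w'. localized_solution B S w' \<and>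
      (\<forall>p. norm (w' p - (\<eta> p * G 6 (r * ((\<xi>, \<tau>) \<bullet> p))) *\<^sub>R z) \<le> C / r)"
proof (cases "CARD('n) \<ge> 2")
  case True
  obtain C where C: "0 \<le> C"
    "\<And>r p. r \<ge> 1 \<Longrightarrow> norm (wave_field B z (wave r) p - (\<eta> p * ripple 6 r p) *\<^sub>R z) \<le> C / r"
    by (rule wave_field_leading_term[OF dir N G_bounded]) (assumption, rule that)
  have zs: "z \<in> state_space" using z by (simp add: wave_cone_def)
  have cl: "closed S" using S by (rule compact_imp_closed)
  show ?thesis
  proof (rule that[OF C(1)])
    fix r :: real assume "r \<ge> 1"
    show "\<exists>w'. localized_solution B S w' \<and>
      (\<forall>p. norm (w' p - (\<eta> p * G 6 (r * ((\<xi>, \<tau>) \<bullet> p))) *\<^sub>R z) \<le> C / r)"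
    proof (intro exI[of _ "wave_field B z (wave r)"] conjI allI)
      show "localized_solution B S (wave_field B z (wave r))"
        unfolding localized_solution_def
      proof (intro conjI allI impI)
        show "smooth (wave_field B z (wave r))" by (rule wave_field_smooth[OF smooth_wave])
        show "range (wave_field B z (wave r)) \<subseteq> state_space"
          using wave_field_state_space[OF smooth_wave zs True] by blast
        show "wave_field B z (wave r) p = 0" if "p \<notin> S" for p
          by (rule wave_field_support[OF cl wave_support that])
        show "has_bochner_integral lborel (\<lambda>x. wave_field B z (wave r) (x, t)) 0" for t
          by (rule wave_field_slices[OF smooth_wave S wave_support])
        show "lin_op B (wave_field B z (wave r)) p = 0" for p
          by (rule wave_field_solves[OF smooth_wave])
      qed
      show "norm (wave_field B z (wave r) p - (\<eta> p * G 6 (r * ((\<xi>, \<tau>) \<bullet> p))) *\<^sub>R z) \<le> C / r" for p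
        using C(2)[OF \<open>r \<ge> 1\<close>, of p] by (simp only: ripple_def)
    qed
  qed
next
  case False
  then have "z = 0" by (rule wave_cone_trivial_in_dimension_one[OF z])
  show ?thesis
  proof (rule that[of 0])
    fix r :: real
    show "\<exists>w'. localized_solution B S w' \<and>
      (\<forall>p. norm (w' p - (\<eta> p * G 6 (r * ((\<xi>, \<tau>) \<bullet> p))) *\<^sub>R z) \<le> 0 / r)"
      by (intro exI[of _ "\<lambda>_. 0"])
         (auto simp: localized_solution_def \<open>z = 0\<close> zero_in_state_space lin_op_zero)
  qed simp
qed

lemma open_inner_compact:
  fixes W :: "'a::euclidean_space set"
  assumes W: "open W" "W \<in> lmeasurable" and "e > 0"
  obtains K where "compact K" "K \<subseteq> W" "measure lebesgue W - e < measure lebesgue K"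
proof -
  obtain C where C: "\<And>n. compact (C n)" "\<And>n. C n \<subseteq> W" "\<And>n. C n \<subseteq> interior (C (Suc n))" "\<Union>(range C) = W"
    by (rule open_Union_compact_subsets[OF W(1)]) (rule that)
  have inc: "incseq C" using C(3) interior_subset by (intro incseq_SucI) blast
  have "C n \<in> lmeasurable" for n by (rule lmeasurable_compact[OF C(1)])
  then have "(\<lambda>n. measure lebesgue (C n)) \<longlonglongrightarrow> measure lebesgue (\<Union>n. C n)"
    using inc C(4) fmeasurableD2[OF W(2)] by (intro Lim_measure_incseq) (auto simp: fmeasurableD)
  then have "(\<lambda>n. measure lebesgue (C n)) \<longlonglongrightarrow> measure lebesgue W" using C(4) by simp
  moreover have "measure lebesgue W - e < measure lebesgue W" using \<open>e > 0\<close> by simp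
  ultimately have "\<forall>\<^sub>F n in sequentially. measure lebesgue W - e < measure lebesgue (C n)"
    by (rule order_tendstoD(1))
  then obtain n where "measure lebesgue W - e < measure lebesgue (C n)"
    by (auto simp: eventually_sequentially)
  then show ?thesis by (intro that[of "C n"] C)
qed

lemma test_maps_I:
  assumes "smooth f" "range f \<subseteq> X" "compact S" "S \<subseteq> W" "\<And>p. p \<notin> S \<Longrightarrow> f p = 0"
  shows "f \<in> test_maps W X"
proof -
  have "support_on UNIV f \<subseteq> S" using assms(5) by (auto simp: support_on_def)
  then have "closure (support_on UNIV f) \<subseteq> S"
    using assms(3) by (intro closure_minimal compact_imp_closed)
  moreover have "compact (closure (support_on UNIV f))"
    using compact_Int_closed[OF assms(3) closed_closure, of "support_on UNIV f"] calculation
    by (simp add: Int_absorb1)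
  ultimately show ?thesis using assms(1,2,4) by (auto simp: test_maps_def)
qed

text \<open>For two disjoint parts, lower bounds for both proportions imply upper bounds.\<close>

lemma proportions_from_lower_bounds:
  fixes a b M l \<mu> \<nu> :: real
  assumes "\<mu> + \<nu> = 1" "a + b \<le> M" "\<mu> * M - l \<le> a" "\<nu> * M - l \<le> b"
  shows "\<bar>a - \<mu> * M\<bar> \<le> l"
proof -
  have "\<mu> * M + \<nu> * M = M" using assms(1) by (simp flip: distrib_right)
  then show ?thesis using assms by (simp add: abs_le_iff)
qed

section \<open>The perturbation\<close>

theorem lemma6:
  fixes B :: "real^'n^'n"
    and w w\<^sub>1 w\<^sub>2 :: "(real^'n) \<times> (real^'n^'n)"
    and \<mu>\<^sub>1 \<mu>\<^sub>2 \<epsilon> :: real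
    and \<O> :: "((real^'n) \<times> real) set"
  assumes "w \<in> state_space" and "w\<^sub>1 \<in> state_space" and "w\<^sub>2 \<in> state_space"
    and "w = \<mu>\<^sub>1 *\<^sub>R w\<^sub>1 + \<mu>\<^sub>2 *\<^sub>R w\<^sub>2"
    and "\<mu>\<^sub>1 + \<mu>\<^sub>2 = 1" and "\<mu>\<^sub>1 > 0" and "\<mu>\<^sub>2 > 0"
    and "w\<^sub>2 - w\<^sub>1 \<in> wave_cone"
    and "open \<O>" and "\<epsilon> > 0"
  shows "\<exists>w' \<in> test_maps \<O> state_space.
    (\<forall>t. integrable lborel (\<lambda>x. w' (x, t)) \<and> (LINT x|lborel. w' (x, t)) = 0) \<and>
    (\<forall>p. lin_op B w' p = 0) \<and>
    (\<forall>p \<in> \<O>. infdist (w + w' p) (closed_segment w\<^sub>1 w\<^sub>2) < \<epsilon>) \<and>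
    (\<exists>\<O>\<^sub>1 \<O>\<^sub>2. open \<O>\<^sub>1 \<and> open \<O>\<^sub>2 \<and> \<O>\<^sub>1 \<subseteq> \<O> \<and> \<O>\<^sub>2 \<subseteq> \<O> \<and> \<O>\<^sub>1 \<inter> \<O>\<^sub>2 = {} \<and>
      (\<forall>p \<in> \<O>\<^sub>1. norm (w + w' p - w\<^sub>1) < \<epsilon>) \<and>
      (\<forall>p \<in> \<O>\<^sub>2. norm (w + w' p - w\<^sub>2) < \<epsilon>) \<and>
      (hausdorff_measure (CARD('n) + 1) \<O> < \<infinity> \<longrightarrow>
        \<bar>enn2real (hausdorff_measure (CARD('n) + 1) \<O>\<^sub>1)
           - \<mu>\<^sub>1 * enn2real (hausdorff_measure (CARD('n) + 1) \<O>)\<bar> < \<epsilon> \<and>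
        \<bar>enn2real (hausdorff_measure (CARD('n) + 1) \<O>\<^sub>2)
           - \<mu>\<^sub>2 * enn2real (hausdorff_measure (CARD('n) + 1) \<O>)\<bar> < \<epsilon>))"
proof -
  let ?H = "hausdorff_measure (CARD('n) + 1) :: ((real^'n) \<times> real) set \<Rightarrow> ennreal"
  let ?c = "hausdorff_ratio TYPE((real^'n) \<times> real)" and ?z = "w\<^sub>2 - w\<^sub>1"
  have H_open: "?H V = ?c * emeasure lborel V" if "open V" for V
    using hausdorff_measure_open[OF that] by simp
  have w_z: "w - w\<^sub>1 = \<mu>\<^sub>2 *\<^sub>R ?z" "w - w\<^sub>2 = - \<mu>\<^sub>1 *\<^sub>R ?z"
  proof -
    have m1: "\<mu>\<^sub>1 = 1 - \<mu>\<^sub>2" and m2: "\<mu>\<^sub>2 = 1 - \<mu>\<^sub>1" using assms(5) by linarith+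
    show "w - w\<^sub>1 = \<mu>\<^sub>2 *\<^sub>R ?z" unfolding assms(4) m1 by (simp add: algebra_simps)
    show "w - w\<^sub>2 = - \<mu>\<^sub>1 *\<^sub>R ?z" unfolding assms(4) m2 by (simp add: algebra_simps)
  qed
  have on_segment: "w + s *\<^sub>R ?z \<in> closed_segment w\<^sub>1 w\<^sub>2" if "- \<mu>\<^sub>2 \<le> s" "s \<le> \<mu>\<^sub>1" for s
  proof -
    have "w + s *\<^sub>R ?z = w\<^sub>1 + (\<mu>\<^sub>2 + s) *\<^sub>R ?z"
      using w_z(1) by (simp add: algebra_simps)
    then have "w + s *\<^sub>R ?z = (1 - (\<mu>\<^sub>2 + s)) *\<^sub>R w\<^sub>1 + (\<mu>\<^sub>2 + s) *\<^sub>R w\<^sub>2"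
      by (simp add: algebra_simps)
    then show ?thesis
      using that assms(5) unfolding closed_segment_def by (intro CollectI exI[of _ "\<mu>\<^sub>2 + s"]) auto
  qed
  show ?thesis
  \<comment> \<open>If the measure is neither \<open>0\<close> nor \<open>\<infinity>\<close>, then the ratio and the volume of \<open>\<O>\<close> are finite and positive.\<close>
  proof (cases "?H \<O> = 0 \<or> ?H \<O> = top")
    case True
    have "w \<in> closed_segment w\<^sub>1 w\<^sub>2" using on_segment[of 0] assms(6,7) by simp
    moreover have "(\<lambda>p. 0) \<in> test_maps \<O> state_space"
      by (rule test_maps_I[of _ _ "{}"]) (auto simp: zero_in_state_space)
    ultimately show ?thesis using assms(6,7,10) True
      by (intro bexI[of _ "\<lambda>p. 0"] conjI exI[of _ "{}"])
         (auto simp: lin_op_zero hausdorff_measure_empty)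
  next
    case False
    then have c: "?c \<noteq> top" "?c \<noteq> 0" and em: "emeasure lborel \<O> \<noteq> top"
      using H_open[OF assms(9)] by (auto simp: ennreal_mult_eq_top_iff ennreal_top_mult split: if_splits)
    obtain k where k: "?c = ennreal k" "k \<ge> 0" using c(1) by (cases ?c) auto
    have O_meas: "\<O> \<in> lmeasurable"
      using assms(9) em by (intro fmeasurableI) (auto simp: less_top[symmetric])
    have H_meas: "enn2real (?H V) = k * measure lebesgue V" if "open V" for V
      using H_open[OF that] k that by (simp add: enn2real_mult measure_def)
    define M where "M = measure lebesgue \<O>"
    have "M \<ge> 0" by (simp add: M_def)
    \<comment> \<open>The width of the transitions. The last two bounds control the pointwise error, which is a multiple
      of \<open>\<delta>\<close> times the length of the segment, and the volume that is lost in the transitions.\<close>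
    define \<delta> where "\<delta> = Min {\<mu>\<^sub>1 / 2, \<mu>\<^sub>2 / 2, \<epsilon> / (8 * (norm ?z + 1)), \<epsilon> / (8 * (k * M + 1))}"
    have nz: "norm ?z + 1 > 0" "k * M + 1 > 0" using k(2) \<open>M \<ge> 0\<close> by (simp_all add: add_nonneg_pos)
    have \<delta>: "\<delta> > 0" "\<delta> \<le> \<mu>\<^sub>1 / 2" "\<delta> \<le> \<mu>\<^sub>2 / 2" "\<delta> \<le> \<epsilon> / (8 * (norm ?z + 1))" "\<delta> \<le> \<epsilon> / (8 * (k * M + 1))"
    proof -
      show "\<delta> > 0" using assms(6,7,10) nz by (simp add: \<delta>_def)
    qed (unfold \<delta>_def, (rule Min_le; simp)+)
    have cancel: "x / (8 * a) * a = x / 8" if "a > 0" for x a :: real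
      using that by simp
    have \<delta>z: "\<delta> * norm ?z \<le> \<epsilon> / 8"
    proof -
      have "\<delta> * norm ?z \<le> \<delta> * (norm ?z + 1)" using \<delta>(1) by (intro mult_left_mono) auto
      also have "\<dots> \<le> \<epsilon> / (8 * (norm ?z + 1)) * (norm ?z + 1)"
        using \<delta>(4) nz by (intro mult_right_mono) auto
      also have "\<dots> = \<epsilon> / 8" by (rule cancel) (rule nz)
      finally show ?thesis .
    qed
    have \<delta>M: "k * (\<delta> * M) \<le> \<epsilon> / 8"
    proof -
      have "k * (\<delta> * M) = \<delta> * (k * M)" by simp
      also have "\<dots> \<le> \<delta> * (k * M + 1)" using \<delta>(1) by (intro mult_left_mono) auto
      also have "\<dots> \<le> \<epsilon> / (8 * (k * M + 1)) * (k * M + 1)"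
        using \<delta>(5) nz by (intro mult_right_mono) auto
      also have "\<dots> = \<epsilon> / 8" by (rule cancel) (rule nz)
      finally show ?thesis .
    qed
    \<comment> \<open>The volume that may be lost near the boundary, and once more by the equidistribution estimate.\<close>
    define e where "e = \<epsilon> / (8 * (k + 1))"
    have e: "e > 0" using assms(10) k(2) by (simp add: e_def)
    have ke: "k * e \<le> \<epsilon> / 8"
    proof -
      have "k * e \<le> (k + 1) * e" using e by (intro mult_right_mono) auto
      also have "\<dots> = \<epsilon> / (8 * (k + 1)) * (k + 1)" by (simp only: e_def mult.commute)
      also have "\<dots> = \<epsilon> / 8" by (rule cancel) (use k(2) in simp)
      finally show ?thesis .
    qed
    obtain K where K: "compact K" "K \<subseteq> \<O>" "M - e < measure lebesgue K"
      by (rule open_inner_compact[OF assms(9) O_meas e, folded M_def]) (rule that)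
    obtain \<eta> :: "(real^'n) \<times> real \<Rightarrow> real" and U S where cut: "smooth \<eta>" "open U" "K \<subseteq> U" "U \<subseteq> \<O>"
      "\<And>x. x \<in> U \<Longrightarrow> \<eta> x = 1" "compact S" "S \<subseteq> \<O>" "\<And>x. x \<notin> S \<Longrightarrow> \<eta> x = 0"
      "\<And>x. 0 \<le> \<eta> x" "\<And>x. \<eta> x \<le> 1"
      by (rule smooth_cutoff[OF K(1) assms(9) K(2)]) (rule that)
    have U_meas: "U \<in> lmeasurable"
      using O_meas cut(2,4) by (intro fmeasurableI2[of \<O> lebesgue U]) auto
    have "\<delta> < \<mu>\<^sub>1" "\<delta> < \<mu>\<^sub>2" using \<delta> assms(6,7) by linarith+
    then obtain h :: "real \<Rightarrow> real" and c' and G :: "nat \<Rightarrow> real \<Rightarrow> real" where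
      h: "continuous_on UNIV h" "\<And>x. h (x + 1) = h x" "\<And>x. -\<mu>\<^sub>2 \<le> h x" "\<And>x. h x \<le> \<mu>\<^sub>1" and
      c': "\<bar>c'\<bar> \<le> 3 * \<delta>" and
      h_high: "\<And>x. \<delta> / 2 \<le> x \<Longrightarrow> x \<le> \<mu>\<^sub>2 - \<delta> / 2 \<Longrightarrow> h x = \<mu>\<^sub>1" and
      h_low: "\<And>x. \<mu>\<^sub>2 + \<delta> / 2 \<le> x \<Longrightarrow> x \<le> 1 - \<delta> / 2 \<Longrightarrow> h x = - \<mu>\<^sub>2" and
      prof: "\<And>j x. (G j has_real_derivative G (Suc j) x) (at x)" "G 6 = (\<lambda>x. h x - c')"
         "\<And>j. j \<le> 6 \<Longrightarrow> \<exists>C. \<forall>x. \<bar>G j x\<bar> \<le> C"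
      by (rule oscillation_profile[OF assms(5) \<delta>(1), of 6]) (rule that)
    obtain \<tau> \<xi> where dir: "norm \<xi> = 1" "fst ?z \<bullet> \<xi> = 0" "snd ?z *v \<xi> = - \<tau> *\<^sub>R fst ?z"
      by (rule wave_cone_direction[OF assms(8)]) (rule that)
    interpret plane_wave \<xi> \<tau> G \<eta> S 6
      by unfold_locales (use prof cut in \<open>auto simp: vanishes_outside_def\<close>)
    obtain C where C: "0 \<le> C" "\<And>r. r \<ge> 1 \<Longrightarrow> \<exists>w'. localized_solution B S w' \<and>
      (\<forall>p. norm (w' p - (\<eta> p * G 6 (r * ((\<xi>, \<tau>) \<bullet> p))) *\<^sub>R ?z) \<le> C / r)"
      by (rule localized_plane_wave[OF assms(8) dir refl prof(3)]) (erule less_imp_le, rule that)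
    have \<zeta>: "(\<xi>, \<tau>) \<noteq> 0" using dir(1) by (auto simp: zero_prod_def)
    have b1: "0 \<le> \<mu>\<^sub>2 + \<delta> / 2" "1 - \<delta> / 2 \<le> 1" and b2: "0 \<le> \<delta> / 2" "\<mu>\<^sub>2 - \<delta> / 2 \<le> 1"
      using \<delta>(1) assms(5-7) by linarith+
    obtain R1 where R1: "R1 > 0" "\<And>r T. \<lbrakk>R1 \<le> r; T \<in> lmeasurable;
        U \<inter> phase_band (\<xi>, \<tau>) r (\<mu>\<^sub>2 + \<delta> / 2) (1 - \<delta> / 2) \<subseteq> T\<rbrakk> \<Longrightarrow>
        (1 - \<delta> / 2 - (\<mu>\<^sub>2 + \<delta> / 2)) * measure lebesgue K - e \<le> measure lebesgue T"
      by (rule phase_intervals_equidistributed[OF K(1) cut(2) U_meas cut(3) \<zeta> b1 e]) (rule that)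
    obtain R2 where R2: "R2 > 0" "\<And>r T. \<lbrakk>R2 \<le> r; T \<in> lmeasurable;
        U \<inter> phase_band (\<xi>, \<tau>) r (\<delta> / 2) (\<mu>\<^sub>2 - \<delta> / 2) \<subseteq> T\<rbrakk> \<Longrightarrow>
        (\<mu>\<^sub>2 - \<delta> / 2 - \<delta> / 2) * measure lebesgue K - e \<le> measure lebesgue T"
      by (rule phase_intervals_equidistributed[OF K(1) cut(2) U_meas cut(3) \<zeta> b2 e]) (rule that)
    \<comment> \<open>The frequency: the expansion error is at most \<open>\<epsilon> / 4\<close>, and both phase intervals are equidistributed.\<close>
    define r where "r = Max {1, 4 * C / \<epsilon>, R1, R2}"
    have r: "r \<ge> 1" "4 * C / \<epsilon> \<le> r" "R1 \<le> r" "R2 \<le> r" by (simp_all add: r_def)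
    have Cr: "C / r \<le> \<epsilon> / 4"
      using r(1,2) assms(10) by (simp add: field_simps)
    obtain w' where sol: "localized_solution B S w'"
      and lead: "\<And>p. norm (w' p - (\<eta> p * G 6 (r * ((\<xi>, \<tau>) \<bullet> p))) *\<^sub>R ?z) \<le> C / r"
      using C(2)[OF r(1)] by blast
    have w': "smooth w'" "range w' \<subseteq> state_space" "\<And>p. p \<notin> S \<Longrightarrow> w' p = 0"
      "\<And>t. has_bochner_integral lborel (\<lambda>x. w' (x, t)) 0" "\<And>p. lin_op B w' p = 0"
      using sol unfolding localized_solution_def by blast+
    define g where "g p = h (r * ((\<xi>, \<tau>) \<bullet> p))" for p
    have g_frac: "h (frac (r * ((\<xi>, \<tau>) \<bullet> p))) = g p" for p
      unfolding g_def by (rule periodic_frac[of h, OF h(2)])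
    \<comment> \<open>Compares \<open>w'\<close> with a constant multiple of \<open>w\<^sub>2 - w\<^sub>1\<close>, through the leading term \<open>\<eta> (g - c')\<close>.\<close>
    have near: "norm (w' p - s *\<^sub>R ?z) \<le> \<bar>\<eta> p * (g p - c') - s\<bar> * norm ?z + \<epsilon> / 4" for p s
    proof -
      have "w' p - s *\<^sub>R ?z = (\<eta> p * (g p - c') - s) *\<^sub>R ?z + (w' p - (\<eta> p * (g p - c')) *\<^sub>R ?z)"
        by (simp add: scaleR_left_diff_distrib)
      then have "norm (w' p - s *\<^sub>R ?z) \<le> norm ((\<eta> p * (g p - c') - s) *\<^sub>R ?z) + norm (w' p - (\<eta> p * (g p - c')) *\<^sub>R ?z)"
        by (metis norm_triangle_ineq)
      also have "norm (w' p - (\<eta> p * (g p - c')) *\<^sub>R ?z) \<le> \<epsilon> / 4"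
        using lead[of p] Cr unfolding prof(2) g_def by linarith
      finally show ?thesis by simp
    qed
    have near': "norm (w' p - s *\<^sub>R ?z) < \<epsilon>" if "\<bar>\<eta> p * (g p - c') - s\<bar> \<le> 4 * \<delta>" for p s
    proof -
      have "\<bar>\<eta> p * (g p - c') - s\<bar> * norm ?z \<le> 4 * \<delta> * norm ?z"
        using that by (intro mult_right_mono) auto
      then show ?thesis using near[of p s] \<delta>z assms(10) by linarith
    qed
    have seg: "infdist (w + w' p) (closed_segment w\<^sub>1 w\<^sub>2) < \<epsilon>" for p
    proof -
      let ?s = "\<eta> p * g p"
      have "\<eta> p * (g p - c') - ?s = - (\<eta> p * c')" by (simp add: right_diff_distrib)
      moreover have "\<bar>\<eta> p\<bar> * \<bar>c'\<bar> \<le> 1 * (3 * \<delta>)"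
        using cut(9,10)[of p] c' by (intro mult_mono) auto
      ultimately have "\<bar>\<eta> p * (g p - c') - ?s\<bar> \<le> 4 * \<delta>" using \<delta>(1) by (simp add: abs_mult)
      from near'[OF this] have "dist (w + w' p) (w + ?s *\<^sub>R ?z) < \<epsilon>" by (simp add: dist_norm)
      moreover have "w + ?s *\<^sub>R ?z \<in> closed_segment w\<^sub>1 w\<^sub>2"
      proof (rule on_segment)
        have gp: "- \<mu>\<^sub>2 \<le> g p" "g p \<le> \<mu>\<^sub>1" using h(3,4) by (simp_all add: g_def)
        have "\<eta> p * g p \<le> \<eta> p * \<mu>\<^sub>1" using gp cut(9) by (intro mult_left_mono) auto
        also have "\<dots> \<le> 1 * \<mu>\<^sub>1" using cut(10) assms(6) by (intro mult_right_mono) auto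
        finally show "?s \<le> \<mu>\<^sub>1" by simp
        have "\<eta> p * (- g p) \<le> \<eta> p * \<mu>\<^sub>2" using gp cut(9) by (intro mult_left_mono) auto
        also have "\<dots> \<le> 1 * \<mu>\<^sub>2" using cut(10) assms(7) by (intro mult_right_mono) auto
        finally show "- \<mu>\<^sub>2 \<le> ?s" by simp
      qed
      ultimately show ?thesis by (meson infdist_le le_less_trans)
    qed
    \<comment> \<open>On \<open>U\<close> the cutoff is \<open>1\<close>; strict inequalities for \<open>g\<close> make the two regions open.\<close>
    define O1 where "O1 = U \<inter> {p. g p < - \<mu>\<^sub>2 + \<delta>}"
    define O2 where "O2 = U \<inter> {p. \<mu>\<^sub>1 - \<delta> < g p}"
    have g_cont: "continuous_on UNIV g"
      unfolding g_def[abs_def] by (rule continuous_on_compose2[OF h(1)]) (auto intro!: continuous_intros)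
    have open1: "open O1" unfolding O1_def
      by (intro open_Int cut(2) open_Collect_less g_cont continuous_on_const)
    have open2: "open O2" unfolding O2_def
      by (intro open_Int cut(2) open_Collect_less g_cont continuous_on_const)
    have disj: "O1 \<inter> O2 = {}"
    proof -
      have "- \<mu>\<^sub>2 + \<delta> \<le> \<mu>\<^sub>1 - \<delta>" using \<delta>(2,3) assms(5-7) by linarith
      then show ?thesis by (auto simp: O1_def O2_def)
    qed
    have sub: "O1 \<subseteq> \<O>" "O2 \<subseteq> \<O>" using cut(4) by (auto simp: O1_def O2_def)
    have close1: "norm (w + w' p - w\<^sub>1) < \<epsilon>" if "p \<in> O1" for p
    proof -
      have p: "\<eta> p = 1" "g p < - \<mu>\<^sub>2 + \<delta>" "- \<mu>\<^sub>2 \<le> g p"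
        using that cut(5) h(3) by (auto simp: O1_def g_def)
      have "\<bar>\<eta> p * (g p - c') - (- \<mu>\<^sub>2)\<bar> \<le> 4 * \<delta>" using p c' by simp
      from near'[OF this] have "norm (w' p + \<mu>\<^sub>2 *\<^sub>R ?z) < \<epsilon>" by simp
      moreover have "w + w' p - w\<^sub>1 = w' p + \<mu>\<^sub>2 *\<^sub>R ?z" unfolding w_z(1)[symmetric] by simp
      ultimately show ?thesis by (simp only:)
    qed
    have close2: "norm (w + w' p - w\<^sub>2) < \<epsilon>" if "p \<in> O2" for p
    proof -
      have p: "\<eta> p = 1" "\<mu>\<^sub>1 - \<delta> < g p" "g p \<le> \<mu>\<^sub>1"
        using that cut(5) h(4) by (auto simp: O2_def g_def)
      have "\<bar>\<eta> p * (g p - c') - \<mu>\<^sub>1\<bar> \<le> 4 * \<delta>" using p c' by simp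
      from near'[OF this] have "norm (w' p + (- \<mu>\<^sub>1) *\<^sub>R ?z) < \<epsilon>" by simp
      moreover have "w + w' p - w\<^sub>2 = w' p + (- \<mu>\<^sub>1) *\<^sub>R ?z" unfolding w_z(2)[symmetric] by simp
      ultimately show ?thesis by (simp only:)
    qed
    have meas: "O1 \<in> lmeasurable" "O2 \<in> lmeasurable"
      using O_meas sub open1 open2 by (auto intro!: fmeasurableI2[of \<O> lebesgue])
    \<comment> \<open>The total loss of volume: transitions, boundary layer and equidistribution error.\<close>
    define l where "l = \<delta> * M + 2 * e"
    have K_le: "measure lebesgue K \<le> M"
      unfolding M_def using K(1,2) O_meas
      by (intro measure_mono_fmeasurable) (auto simp: fmeasurableD lmeasurable_compact)
    have lower: "\<mu> * M - l \<le> (\<mu> - \<delta>) * measure lebesgue K - e" if "\<delta> \<le> \<mu>" "\<mu> \<le> 1" for \<mu>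
    proof -
      have "(\<mu> - \<delta>) * (M - measure lebesgue K) \<le> 1 * e"
        using that K(3) K_le \<delta>(1) by (intro mult_mono) auto
      then show ?thesis by (simp add: l_def algebra_simps)
    qed
    have m1: "\<mu>\<^sub>1 * M - l \<le> measure lebesgue O1"
    proof -
      have "(1 - \<delta> / 2 - (\<mu>\<^sub>2 + \<delta> / 2)) * measure lebesgue K - e \<le> measure lebesgue O1"
      proof (rule R1(2)[OF r(3) meas(1)])
        show "U \<inter> phase_band (\<xi>, \<tau>) r (\<mu>\<^sub>2 + \<delta> / 2) (1 - \<delta> / 2) \<subseteq> O1"
          using h_low \<delta>(1) by (auto simp: O1_def phase_band_def simp flip: g_frac)
      qed
      moreover have "1 - \<delta> / 2 - (\<mu>\<^sub>2 + \<delta> / 2) = \<mu>\<^sub>1 - \<delta>" using assms(5) by simp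
      ultimately show ?thesis using lower[of "\<mu>\<^sub>1"] \<delta>(2) assms(5-7) by simp
    qed
    have m2: "\<mu>\<^sub>2 * M - l \<le> measure lebesgue O2"
    proof -
      have "(\<mu>\<^sub>2 - \<delta> / 2 - \<delta> / 2) * measure lebesgue K - e \<le> measure lebesgue O2"
      proof (rule R2(2)[OF r(4) meas(2)])
        show "U \<inter> phase_band (\<xi>, \<tau>) r (\<delta> / 2) (\<mu>\<^sub>2 - \<delta> / 2) \<subseteq> O2"
          using h_high \<delta>(1) by (auto simp: O2_def phase_band_def simp flip: g_frac)
      qed
      moreover have "\<mu>\<^sub>2 - \<delta> / 2 - \<delta> / 2 = \<mu>\<^sub>2 - \<delta>" by simp
      ultimately show ?thesis using lower[of "\<mu>\<^sub>2"] \<delta>(3) assms(5-7) by simp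
    qed
    have "measure lebesgue O1 + measure lebesgue O2 = measure lebesgue (O1 \<union> O2)"
      using disj meas by (simp add: measure_Un3)
    also have "\<dots> \<le> M" unfolding M_def
      using sub meas O_meas by (intro measure_mono_fmeasurable) (auto simp: fmeasurableD)
    finally have total: "measure lebesgue O1 + measure lebesgue O2 \<le> M" .
    have kl: "k * l < \<epsilon>"
      using \<delta>M ke assms(10) by (simp add: l_def distrib_left)
    have close: "\<bar>k * a - \<mu> * (k * M)\<bar> < \<epsilon>" if "\<bar>a - \<mu> * M\<bar> \<le> l" for a \<mu>
    proof -
      have "k * a - \<mu> * (k * M) = k * (a - \<mu> * M)" by (simp add: algebra_simps)
      then have "\<bar>k * a - \<mu> * (k * M)\<bar> = k * \<bar>a - \<mu> * M\<bar>" using k(2) by (simp add: abs_mult)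
      also have "\<dots> \<le> k * l" using that k(2) by (intro mult_left_mono)
      finally show ?thesis using kl by simp
    qed
    have prop1: "\<bar>enn2real (?H O1) - \<mu>\<^sub>1 * enn2real (?H \<O>)\<bar> < \<epsilon>"
      unfolding H_meas[OF open1] H_meas[OF assms(9)] M_def[symmetric]
      by (rule close, rule proportions_from_lower_bounds[OF assms(5) total m1 m2])
    have prop2: "\<bar>enn2real (?H O2) - \<mu>\<^sub>2 * enn2real (?H \<O>)\<bar> < \<epsilon>"
      unfolding H_meas[OF open2] H_meas[OF assms(9)] M_def[symmetric]
      by (rule close, rule proportions_from_lower_bounds[of "\<mu>\<^sub>2" "\<mu>\<^sub>1" _ "measure lebesgue O1"])
         (use assms(5) total m1 m2 in \<open>simp_all add: add.commute\<close>)
    have regions: "open O1 \<and> open O2 \<and> O1 \<subseteq> \<O> \<and> O2 \<subseteq> \<O> \<and> O1 \<inter> O2 = {} \<and>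
      (\<forall>p \<in> O1. norm (w + w' p - w\<^sub>1) < \<epsilon>) \<and> (\<forall>p \<in> O2. norm (w + w' p - w\<^sub>2) < \<epsilon>) \<and>
      (?H \<O> < \<infinity> \<longrightarrow> \<bar>enn2real (?H O1) - \<mu>\<^sub>1 * enn2real (?H \<O>)\<bar> < \<epsilon> \<and>
          \<bar>enn2real (?H O2) - \<mu>\<^sub>2 * enn2real (?H \<O>)\<bar> < \<epsilon>)"
      using open1 open2 sub disj close1 close2 prop1 prop2 by blast
    show ?thesis
    proof (intro bexI[of _ w'] conjI)
      show "w' \<in> test_maps \<O> state_space"
        by (rule test_maps_I[OF w'(1,2) cut(6,7) w'(3)])
      show "\<forall>t. integrable lborel (\<lambda>x. w' (x, t)) \<and> (LINT x|lborel. w' (x, t)) = 0"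
        using w'(4) by (simp add: has_bochner_integral_iff)
      show "\<forall>p. lin_op B w' p = 0" using w'(5) by simp
      show "\<forall>p\<in>\<O>. infdist (w + w' p) (closed_segment w\<^sub>1 w\<^sub>2) < \<epsilon>" using seg by simp
    qed (rule exI[of _ O1], rule exI[of _ O2], rule regions)
  qed
qed

end
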